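(* Let $1<r<k$. Given a non-canceling arithmetic circuit $C$ computing a polynomial $f\in\mathbb{Z}[X_1,\ldots,X_n]$, the $(r,k)$-Monomial Detection problem can be solved by a deterministic algorithm in time $k^{O(1)}\cdot|C|\cdot r^{18k/r}\cdot 2^{O(k/r)}\cdot n\log^3 n$.
   Context: A monomial $X_1^{d_1}\cdots X_n^{d_n}$ is an \emph{$(r,k)$-monomial} if $d_i\le r$ for all $i$ and $\sum_i d_i=k$. An arithmetic circuit is \emph{non-canceling} if its leaves are labeled only by variables (no constants) and its internal gates are only addition and multiplication gates (no subtraction), each of fan-in at most two; $|C|$ is the number of gates plus the number of leaves. $(r,k)$-Monomial Detection: given such a circuit $C$ computing $f$ and integers $r,k$, determine whether $f$ contains an $(r,k)$-monomial with non-zero coefficient, and if so return one. *)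

theory Defs
  imports Complex_Main "HOL-Library.Poly_Mapping"
begin

section \<open>Polynomials and (r,k)-monomials\<close>

text \<open>
  A monomial is its exponent vector; the variables \<open>X\<^sub>1, \<dots>, X\<^sub>n\<close> are numbered \<open>0, \<dots>, n - 1\<close>.
  The ring structure on \<open>poly_mapping\<close> is the convolution product of the library, so
  \<open>int_mpoly\<close> is the polynomial ring over the integers in countably many variables.
\<close>

type_synonym monomial = "nat \<Rightarrow>\<^sub>0 nat"
type_synonym int_mpoly = "monomial \<Rightarrow>\<^sub>0 int"

definition indet :: "nat \<Rightarrow> int_mpoly" where
  "indet i = Poly_Mapping.single (Poly_Mapping.single i 1) 1"

definition rk_monomial :: "nat \<Rightarrow> nat \<Rightarrow> nat \<Rightarrow> monomial \<Rightarrow> bool" where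
  "rk_monomial n r k m \<longleftrightarrow>
     Poly_Mapping.keys m \<subseteq> {..<n} \<and>
     (\<forall>i<n. Poly_Mapping.lookup m i \<le> r) \<and>
     (\<Sum>i<n. Poly_Mapping.lookup m i) = k"

definition rk_monomial_of :: "nat \<Rightarrow> nat \<Rightarrow> nat \<Rightarrow> int_mpoly \<Rightarrow> monomial \<Rightarrow> bool" where
  "rk_monomial_of n r k f m \<longleftrightarrow> rk_monomial n r k m \<and> Poly_Mapping.lookup f m \<noteq> 0"


section \<open>Non-canceling arithmetic circuits\<close>

text \<open>
  The nodes of the underlying acyclic graph (leaves and internal gates) are listed in a
  topological order; a gate refers to its predecessors by their positions in the list.
  There are neither constants nor subtraction gates.
  Gates of fan-in zero are excluded by \<open>gate_ok\<close>: they would be constants.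
\<close>

datatype gate = Var nat | Sum "nat list" | Prod "nat list"

type_synonym gates = "gate list"

fun gate_ok :: "nat \<Rightarrow> nat \<Rightarrow> gate \<Rightarrow> bool" where
  "gate_ok n p (Var i) \<longleftrightarrow> i < n"
| "gate_ok n p (Sum js) \<longleftrightarrow> length js \<in> {1, 2} \<and> (\<forall>j\<in>set js. j < p)"
| "gate_ok n p (Prod js) \<longleftrightarrow> length js \<in> {1, 2} \<and> (\<forall>j\<in>set js. j < p)"

definition non_canceling_circuit :: "nat \<Rightarrow> gates \<Rightarrow> nat \<Rightarrow> bool" where
  "non_canceling_circuit n C out \<longleftrightarrow>
     (\<forall>p<length C. gate_ok n p (C ! p)) \<and> out < length C"

fun gate_poly :: "int_mpoly list \<Rightarrow> gate \<Rightarrow> int_mpoly" where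
  "gate_poly fs (Var i) = indet i"
| "gate_poly fs (Sum js) = (\<Sum>j\<leftarrow>js. fs ! j)"
| "gate_poly fs (Prod js) = (\<Prod>j\<leftarrow>js. fs ! j)"

definition gates_polys :: "gates \<Rightarrow> int_mpoly list" where
  "gates_polys C = foldl (\<lambda>fs g. fs @ [gate_poly fs g]) [] C"

definition circuit_poly :: "gates \<Rightarrow> nat \<Rightarrow> int_mpoly" where
  "circuit_poly C out = gates_polys C ! out"


section \<open>The word RAM\<close>

text \<open>
  A program is a finite list of instructions, each executed in one time unit.
  Registers are named in the program text, so a program uses only finitely many of them;
  \<open>LOAD\<close> and \<open>STORE\<close> access an addressable memory indirectly. The machine stops as soon as the
  program counter leaves the program.

  The transition function itself works on unbounded naturals. The restriction to machine words
  is imposed on runs: every register and memory cell must stay within \<open>W\<close> at all times.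
  Without this restriction, unit-cost multiplication would be unrealistically powerful.
\<close>

datatype instr =
    SETC nat nat          (* reg[d] := c *)
  | ADD nat nat nat       (* reg[d] := reg[a] + reg[b] *)
  | SUB nat nat nat       (* truncated subtraction *)
  | MULT nat nat nat
  | DIV nat nat nat       (* integer division, with x div 0 = 0 *)
  | LOAD nat nat          (* reg[d] := mem[reg[a]] *)
  | STORE nat nat         (* mem[reg[a]] := reg[b] *)
  | JLESS nat nat nat     (* goto l if reg[a] < reg[b] *)
  | JUMP nat

type_synonym program = "instr list"

record config =
  pc :: nat
  reg :: "nat \<Rightarrow> nat"
  mem :: "nat \<Rightarrow> nat"

definition set_reg :: "nat \<Rightarrow> nat \<Rightarrow> config \<Rightarrow> config" where
  "set_reg d v s = s\<lparr>pc := pc s + 1, reg := (reg s)(d := v)\<rparr>"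

fun exec :: "instr \<Rightarrow> config \<Rightarrow> config" where
  "exec (SETC d c) s = set_reg d c s"
| "exec (ADD d a b) s = set_reg d (reg s a + reg s b) s"
| "exec (SUB d a b) s = set_reg d (reg s a - reg s b) s"
| "exec (MULT d a b) s = set_reg d (reg s a * reg s b) s"
| "exec (DIV d a b) s = set_reg d (reg s a div reg s b) s"
| "exec (LOAD d a) s = set_reg d (mem s (reg s a)) s"
| "exec (STORE a b) s = s\<lparr>pc := pc s + 1, mem := (mem s)(reg s a := reg s b)\<rparr>"
| "exec (JLESS a b l) s = s\<lparr>pc := (if reg s a < reg s b then l else pc s + 1)\<rparr>"
| "exec (JUMP l) s = s\<lparr>pc := l\<rparr>"

definition halted :: "program \<Rightarrow> config \<Rightarrow> bool" where
  "halted P s \<longleftrightarrow> length P \<le> pc s"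

definition step :: "program \<Rightarrow> config \<Rightarrow> config" where
  "step P s = (if halted P s then s else exec (P ! pc s) s)"

definition initial :: "nat list \<Rightarrow> config" where
  "initial xs =
     \<lparr>pc = 0, reg = (\<lambda>_. 0), mem = (\<lambda>i. if i < length xs then xs ! i else 0)\<rparr>"

definition within_words :: "real \<Rightarrow> config \<Rightarrow> bool" where
  "within_words W s \<longleftrightarrow> (\<forall>i. real (reg s i) \<le> W) \<and> (\<forall>i. real (mem s i) \<le> W)"

definition computes_within ::
  "program \<Rightarrow> nat list \<Rightarrow> real \<Rightarrow> real \<Rightarrow> (nat \<Rightarrow> nat) \<Rightarrow> bool" where
  "computes_within P xs T W out_mem \<longleftrightarrow>
     (\<exists>t. real t \<le> T \<and>
          halted P ((step P ^^ t) (initial xs)) \<and>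
          mem ((step P ^^ t) (initial xs)) = out_mem \<and>
          (\<forall>i\<le>t. within_words W ((step P ^^ i) (initial xs))))"


section \<open>(r,k)-Monomial Detection as a problem for the word RAM\<close>

text \<open>A node occupies four words: kind, fan-in, and two arguments (padded with zeros).\<close>

fun encode_gate :: "gate \<Rightarrow> nat list" where
  "encode_gate (Var i) = [0, 0, i, 0]"
| "encode_gate (Sum js) = [1, length js] @ take 2 (js @ [0, 0])"
| "encode_gate (Prod js) = [2, length js] @ take 2 (js @ [0, 0])"

definition encode_instance :: "nat \<Rightarrow> nat \<Rightarrow> nat \<Rightarrow> gates \<Rightarrow> nat \<Rightarrow> nat list" where
  "encode_instance n r k C out = [n, r, k, length C, out] @ concat (map encode_gate C)"

text \<open>
  Output: cell 0 holds the yes/no answer; for yes-instances the cells \<open>1, \<dots>, n\<close>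
  hold the exponents of a monomial as required.
\<close>

definition correct_output :: "nat \<Rightarrow> nat \<Rightarrow> nat \<Rightarrow> int_mpoly \<Rightarrow> (nat \<Rightarrow> nat) \<Rightarrow> bool" where
  "correct_output n r k f M \<longleftrightarrow>
     (if \<exists>m. rk_monomial_of n r k f m
      then M 0 = 1 \<and>
           (\<exists>m. rk_monomial_of n r k f m \<and> (\<forall>i<n. M (i + 1) = Poly_Mapping.lookup m i))
      else M 0 = 0)"

text \<open>
  The time bound, with \<open>k ^ a\<close> for \<open>k\<^bsup>O(1)\<^esup>\<close> and \<open>2 powr (b * k / r)\<close> for
  \<open>2\<^bsup>O(k/r)\<^esup>\<close>; since \<open>k \<ge> 3\<close>, constant factors are absorbed by \<open>k ^ a\<close>.
  The argument of the logarithm is \<open>n + 1\<close> so that the bound does not vanish for \<open>n = 1\<close>;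
  for \<open>n \<ge> 2\<close> this changes it by a constant factor only.
\<close>

definition time_bound :: "nat \<Rightarrow> nat \<Rightarrow> nat \<Rightarrow> nat \<Rightarrow> nat \<Rightarrow> nat \<Rightarrow> real" where
  "time_bound a b n r k s =
     real k ^ a * real s * real r powr (18 * real k / real r) *
     2 powr (real b * real k / real r) * real n * (log 2 (real n + 1)) ^ 3"

end

theory Submission
  imports Defs
begin

text \<open>
  The circuit is evaluated by a dynamic programme over colourings of the variables with
  \<open>q = O(k/r)\<close> colours. A monomial is represented by the vector of its degrees in the colour
  classes, written as a number in base \<open>r + 1\<close>; addition without carries keeps all class degrees at
  most \<open>r\<close>, so only \<open>(r, k)\<close>-monomials are reported, and non-cancellation makes the monomials of a gate
  the union or the Minkowski sum of those of its children. For one colouring this takes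
  \<open>(r + 1)\<^bsup>2 q\<^esup>\<close> steps per gate.

  It remains to enumerate few colourings such that for every \<open>(r, k)\<close>-monomial one of them gives each
  colour class degree at most \<open>r\<close>. The variables are first hashed injectively (on the support) into
  \<open>O(k\<^sup>2)\<close> keys. Then \<open>O(log (k/r))\<close> rounds of hashing into \<open>O(k)\<close>,
      \<open>O(k) / 2\<close>, \<open>O(k) / 4\<close>, \<open>\<dots>\<close> cells follow:
  variables in overloaded cells (of total degree more than \<open>r\<close>) move on to the next round, and by
  averaging over the hash functions their total degree at least halves. Hence there are at most \<open>k/r\<close>
  overloaded cells, and the sequence of all cells can be cut into \<open>O(k/r)\<close> intervals of total
  degree at most \<open>r\<close>, which are the colour classes. The overloaded cells and the cuts are guessed as gaps of
  length \<open>O(r)\<close>, which gives \<open>O(r)\<^bsup>q\<^esup>\<close> possibilities.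
\<close>

section \<open>Digit sums\<close>

text \<open>No guess needs to be checked: a carry-free code has only exponents at most
  \<open>r\<close> behind it, so a bad colouring can miss a monomial but cannot produce a wrong one.
  Only completeness depends on the guess. What shapes the construction is the number of guesses.
  Keys lie in a range of size O(k^2), so each round costs a factor O(k^2) for its seed. The total
  degree at least halves per round and a rest of at most \<open>r\<close> fits into one cell, so
  \<open>J\<close> rounds with \<open>2 * k \<le> r * 2 ^ J\<close> suffice. With rho = k/r, the
  seeds cost about k^(2J) = r^(2J) * rho^(2J). As J is at most 2 + log rho, the first factor is at
  most r^(4 + 4 rho), and the second is 2^(O(log^2 rho)), hence 2^(O(rho)). The very first hash has
  a seed range linear in n up to a power of k, which gives the single factor n. The number of
  separators is about 4 rho: one share of rho for overloaded cells, two for cuts before a class gets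
  too heavy, one for gaps that get too long. In the exponent of r this gives 4 rho for the seeds, 4
  rho for the separators and 8 rho for the pairs of codes, in total 16 rho.\<close>

function digsum :: "nat \<Rightarrow> nat \<Rightarrow> nat" where
  "digsum B u = (if u = 0 \<or> B < 2 then 0 else u mod B + digsum B (u div B))"
  by pat_completeness auto
termination by (relation "measure snd") auto

declare digsum.simps [simp del]

lemma digsum_0 [simp]: "digsum B 0 = 0"
  by (simp add: digsum.simps)

lemma digsum_rec: "2 \<le> B \<Longrightarrow> digsum B u = u mod B + digsum B (u div B)"
  by (cases "u = 0") (simp_all add: digsum.simps[of B u])

lemma digsum_small: "2 \<le> B \<Longrightarrow> u < B \<Longrightarrow> digsum B u = u"
  by (subst digsum_rec) auto

lemma digsum_times_base: "2 \<le> B \<Longrightarrow> digsum B (u * B) = digsum B u"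
  by (subst digsum_rec) auto

lemma digsum_times_power: "2 \<le> B \<Longrightarrow> digsum B (u * B ^ c) = digsum B u"
proof (induction c)
  case (Suc c)
  have "u * B ^ Suc c = (u * B ^ c) * B" by simp
  then show ?case using Suc by (simp only: digsum_times_base)
qed simp

lemma digsum_Suc_le: "2 \<le> B \<Longrightarrow> digsum B (Suc u) \<le> Suc (digsum B u)"
proof (induction u rule: less_induct)
  case (less u)
  show ?case
  proof (cases "Suc (u mod B) = B")
    case True
    then have 1: "Suc u mod B = 0" "Suc u div B = Suc (u div B)"
      by (simp_all add: mod_Suc div_Suc)
    have "u \<noteq> 0" using True less.prems by (intro notI) simp
    then have "u div B < u" using less.prems by simp
    then have "digsum B (Suc (u div B)) \<le> Suc (digsum B (u div B))"
      using less by blast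
    then show ?thesis
      using less.prems 1 by (simp add: digsum_rec[of B "Suc u"] digsum_rec[of B u])
  next
    case False
    then have "Suc u mod B = Suc (u mod B)" "Suc u div B = u div B"
      by (simp_all add: mod_Suc div_Suc)
    then show ?thesis
      using less.prems by (simp add: digsum_rec[of B "Suc u"] digsum_rec[of B u])
  qed
qed

text \<open>A carry trades \<open>B\<close> units of one digit for a single unit of the next, so it
  lowers the total by \<open>B - 1\<close>. This loss is what later reveals an overflow of a colour
  class.\<close>

lemma digsum_add_le: "2 \<le> B \<Longrightarrow> digsum B (u + v) \<le> digsum B u + digsum B v"
proof (induction u arbitrary: v rule: less_induct)
  case (less u)
  show ?case
  proof (cases "u = 0")
    case False
    then have lt: "u div B < u" using less.prems by simp
    have IH: "digsum B (u div B + v div B) \<le> digsum B (u div B) + digsum B (v div B)"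
      using less.IH[OF lt] less.prems by simp
    have un: "digsum B u = u mod B + digsum B (u div B)" "digsum B v = v mod B + digsum B (v div B)"
      "digsum B (u + v) = (u + v) mod B + digsum B ((u + v) div B)"
      using less.prems digsum_rec by blast+
    show ?thesis
    proof (cases "u mod B + v mod B < B")
      case True
      then have "(u + v) mod B = u mod B + v mod B" "(u + v) div B = u div B + v div B"
        using mod_add_eq[of u B v] div_add1_eq[of u v B] by simp_all
      then show ?thesis using IH un by simp
    next
      case F: False
      have "u mod B < B" "v mod B < B" using less.prems by simp_all
      then have lt2: "u mod B + v mod B < 2 * B" by linarith
      have d: "(u mod B + v mod B) div B = 1"
        using F lt2 by (intro div_nat_eqI) auto
      have "(u + v) mod B = (u mod B + v mod B) mod B" by (simp add: mod_add_eq)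
      also have "\<dots> = u mod B + v mod B - B"
        using d minus_div_mult_eq_mod[of "u mod B + v mod B" B] by simp
      \<comment> \<open>The last digit has lost \<open>B\<close>, while the incoming carry adds at
        most one by \<open>digsum_Suc_le\<close>.\<close>
      finally have m: "(u + v) mod B = u mod B + v mod B - B" .
      have "(u + v) div B = Suc (u div B + v div B)"
        using d by (simp add: div_add1_eq[of u v])
      then have "digsum B ((u + v) div B) \<le> Suc (digsum B (u div B + v div B))"
        using digsum_Suc_le less.prems by metis
      then show ?thesis using IH un m F less.prems by linarith
    qed
  qed simp
qed

lemma digsum_sum_le:
  assumes "2 \<le> B" shows "digsum B (\<Sum>i\<in>A. f i) \<le> (\<Sum>i\<in>A. digsum B (f i))"
proof (induction A rule: infinite_finite_induct)
  case (insert x F)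
  then show ?case using digsum_add_le[OF assms, of "f x" "sum f F"] by simp
qed auto

lemma digsum_le: "2 \<le> B \<Longrightarrow> digsum B u \<le> u"
proof (induction u)
  case (Suc u)
  then show ?case using digsum_Suc_le[of B u] by simp
qed simp

text \<open>A number with at least two digits has a positive quotient, whose weight drops from
  \<open>B\<close> per unit to at most one.\<close>

lemma digsum_less:
  assumes "2 \<le> B" "B \<le> u" shows "digsum B u < u"
proof -
  have "u div B > 0" using assms by (simp add: div_greater_zero_iff)
  then have "u div B < u div B * B" using assms by simp
  moreover have "digsum B (u div B) \<le> u div B" using digsum_le assms by blast
  moreover have "digsum B u = u mod B + digsum B (u div B)" using digsum_rec assms by blast
  moreover have "u div B * B + u mod B = u" by simp
  ultimately show ?thesis by linarith
qed

lemma digsum_digits: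
  assumes B: "2 \<le> B" and d: "\<And>c. c < q \<Longrightarrow> d c < B"
  shows "digsum B (\<Sum>c<q. d c * B ^ c) = (\<Sum>c<q. d c)"
    and "(\<Sum>c<q. d c * B ^ c) < B ^ q"
proof -
  have "digsum B (\<Sum>c<q. d c * B ^ c) = (\<Sum>c<q. d c) \<and> (\<Sum>c<q. d c * B ^ c) < B ^ q"
    using d
  proof (induction q arbitrary: d)
    case (Suc q)
    define e where "e c = d (Suc c)" for c
    define s where "s = (\<Sum>c<q. e c * B ^ c)"
    have IH: "digsum B s = (\<Sum>c<q. e c) \<and> s < B ^ q"
      unfolding s_def using Suc.prems by (intro Suc.IH) (auto simp: e_def)
    have eq: "(\<Sum>c<Suc q. d c * B ^ c) = d 0 + B * s"
      by (subst sum.lessThan_Suc_shift) (simp add: s_def e_def sum_distrib_left mult_ac)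
    have d0: "d 0 < B" using Suc.prems by simp
    have "digsum B (d 0 + B * s) = d 0 + digsum B s"
      using B d0 by (subst digsum_rec) auto
    moreover have "d 0 + B * s < B ^ Suc q"
    proof -
      have "B * Suc s \<le> B * B ^ q" using IH by (intro mult_le_mono) auto
      then show ?thesis using d0 by simp
    qed
    ultimately show ?case
      using IH unfolding eq sum.lessThan_Suc_shift[of d q] by (simp add: e_def)
  qed simp
  then show "digsum B (\<Sum>c<q. d c * B ^ c) = (\<Sum>c<q. d c)"
    and "(\<Sum>c<q. d c * B ^ c) < B ^ q" by auto
qed

section \<open>Multiply-shift hashing\<close>

text \<open>Multiply-shift hashing: for \<open>P = 2 ^ l\<close> and \<open>M = 2 ^ m\<close> these
  are the top \<open>m\<close> of the \<open>l\<close> low bits of the product with the odd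
  multiplier \<open>2 * e + 1\<close>. With \<open>e\<close> ranging over all numbers below
  \<open>P\<close>, every odd residue occurs twice, which does not affect averages.\<close>

definition mshash :: "nat \<Rightarrow> nat \<Rightarrow> nat \<Rightarrow> nat \<Rightarrow> nat" where
  "mshash P M e x = ((2 * e + 1) * x mod P) div (P div M)"

lemma mshash_less:
  assumes "M dvd P" "0 < P" shows "mshash P M e x < M"
proof -
  obtain t where t: "P = M * t" using assms by auto
  then have "0 < M" "0 < t" using assms by auto
  moreover have "(2 * e + 1) * x mod P < M * t" using assms t by simp
  ultimately show ?thesis
    unfolding mshash_def t by (simp add: less_mult_imp_div_less)
qed

lemma odd_part:
  assumes "0 < (d::nat)" obtains t o' where "d = 2 ^ t * o'" "odd o'"
  using assms
proof (induction d arbitrary: thesis rule: less_induct)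
  case (less d)
  show ?case
  proof (cases "odd d")
    case True
    then show ?thesis using less.prems(1)[of 0 d] by simp
  next
    case False
    then obtain d' where d': "d = 2 * d'" by auto
    then obtain t o' where "d' = 2 ^ t * o'" "odd o'" using less.IH[of d'] less.prems by auto
    then show ?thesis using less.prems(1)[of "Suc t" o'] d' by simp
  qed
qed

lemma card_odd_less: "card {b::nat. odd b \<and> b < 2 ^ u} \<le> 2 ^ (u - 1)"
proof -
  have "card {b. odd b \<and> b < (2::nat) ^ u} \<le> card {..<(2::nat) ^ (u - 1)}"
  proof (rule card_inj_on_le)
    show "inj_on (\<lambda>b. b div 2) {b. odd b \<and> b < (2::nat) ^ u}"
      by (auto simp: inj_on_def elim!: oddE)
    show "(\<lambda>b. b div 2) ` {b. odd b \<and> b < (2::nat) ^ u} \<subseteq> {..<2 ^ (u - 1)}"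
      by (cases u) (auto simp: less_mult_imp_div_less)
  qed simp
  then show ?thesis by simp
qed

text \<open>The odd factor \<open>o'\<close> is invertible modulo a power of two, so the residue
  fixes \<open>2 * e + 1\<close> modulo \<open>2 ^ (l - t)\<close> and hence \<open>e\<close> modulo
  half of that. This leaves \<open>2 ^ (t + 1)\<close> candidates below
  \<open>2 ^ l\<close>.\<close>

lemma card_mult_residue_le:
  assumes o: "odd o'" and t: "t < l"
  shows "card {e::nat. e < 2 ^ l \<and> (2 * e + 1) * o' mod 2 ^ (l - t) = b} \<le> 2 ^ (t + 1)"
proof -
  define A where "A = {e::nat. e < 2 ^ l \<and> (2 * e + 1) * o' mod 2 ^ (l - t) = b}"
  let ?h = "2 ^ (l - t - 1) :: nat"
  have key: "e mod ?h = e' mod ?h" if "e \<in> A" "e' \<in> A" "e' \<le> e" for e e'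
  proof -
    have "2 ^ (l - t) dvd (2 * e + 1) * o' - (2 * e' + 1) * o'"
    proof -
      have "(2 * e + 1) * o' mod 2 ^ (l - t) = b" "(2 * e' + 1) * o' mod 2 ^ (l - t) = b"
        using that(1,2) unfolding A_def by (simp_all only: mem_Collect_eq)
      then have "(2 * e + 1) * o' mod 2 ^ (l - t) = (2 * e' + 1) * o' mod 2 ^ (l - t)" by (simp only:)
      moreover have "(2 * e' + 1) * o' \<le> (2 * e + 1) * o'" using that by simp
      ultimately show ?thesis by (metis mod_eq_dvd_iff_nat)
    qed
    then have "2 ^ (l - t) dvd (2 * (e - e')) * o'"
      using that by (simp add: algebra_simps)
    then have "(2::nat) ^ (l - t) dvd 2 * (e - e')"
      using o by (subst (asm) coprime_dvd_mult_left_iff) auto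
    moreover have "(2::nat) ^ (l - t) = 2 * ?h"
      using t by (metis Suc_diff_Suc diff_diff_left diff_is_0_eq' Suc_eq_plus1 power_Suc)
    ultimately have "?h dvd e - e'" by simp
    then show ?thesis using that by (metis mod_eq_dvd_iff_nat)
  qed
  have "card A \<le> card {..<(2::nat) ^ (t + 1)}"
  proof (rule card_inj_on_le)
    show "inj_on (\<lambda>e. e div ?h) A"
    proof (rule inj_onI)
      fix e e' assume "e \<in> A" "e' \<in> A" "e div ?h = e' div ?h"
      moreover then have "e mod ?h = e' mod ?h"
        using key by (metis nle_le)
      ultimately show "e = e'" by (metis div_mult_mod_eq)
    qed
    have "l = (t + 1) + (l - t - 1)" using t by simp
    then have "2 ^ l = 2 ^ (t + 1) * ?h" by (metis power_add)
    then show "(\<lambda>e. e div ?h) ` A \<subseteq> {..<2 ^ (t + 1)}"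
      by (auto simp: A_def less_mult_imp_div_less)
  qed simp
  then show ?thesis by (simp add: A_def)
qed

text \<open>Two keys can only collide if their difference, multiplied by the odd multiplier, is close to
  \<open>0\<close> modulo \<open>2\<^sup>l\<close>. Splitting off the even part \<open>2\<^sup>t\<close> of the
      difference reduces this to counting
  odd residues modulo \<open>2\<^bsup>l - t\<^esup>\<close>, and residue \<open>0\<close> cannot occur.\<close>

lemma mshash_collisions_aux:
  fixes x y :: nat
  assumes xy: "y < x" "x < 2 ^ l" and m: "m \<le> l"
  shows "card {e. e < 2 ^ l \<and> mshash (2 ^ l) (2 ^ m) e x = mshash (2 ^ l) (2 ^ m) e y} * 2 ^ m \<le> 2 * 2 ^ l"
proof -
  define P where "P = (2::nat) ^ l"
  define sh where "sh = (2::nat) ^ (l - m)"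
  have sh: "P div 2 ^ m = sh" using m by (simp add: P_def sh_def power_diff)
  have P0: "0 < P" "0 < sh" by (simp_all add: P_def sh_def)
  obtain t o' where d: "x - y = 2 ^ t * o'" and o: "odd o'"
    using xy odd_part[of "x - y"] by auto
  have "2 ^ t \<le> x - y" using d o by (cases o') auto
  then have "(2::nat) ^ t < 2 ^ l" using xy by linarith
  then have t: "t < l" by (simp)
  define P' where "P' = (2::nat) ^ (l - t)"
  have PP': "P = 2 ^ t * P'" using t by (simp add: P_def P'_def power_add[symmetric])
  \<comment> \<open>Odd residues within \<open>sh\<close> of \<open>0\<close> or of the modulus,
    after division by \<open>2 ^ t\<close>. If \<open>2 ^ t\<close> already reaches
    \<open>sh\<close>, no nonzero residue is that close, and the set is empty.\<close>
  define bs where "bs = (if m + t < l then {b. odd b \<and> b < 2 ^ (l - m - t)} \<union>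
      (\<lambda>b. P' - b) ` {b. odd b \<and> b < 2 ^ (l - m - t)} else {})"
  have inbs: "(2 * e + 1) * o' mod P' \<in> bs"
    if "mshash P (2 ^ m) e x = mshash P (2 ^ m) e y" for e
  proof -
    define a where "a = 2 * e + 1"
    define X Y where "X = a * x mod P" and "Y = a * y mod P"
    have XY: "X div sh = Y div sh" using that by (simp add: mshash_def sh a_def X_def Y_def)
    define b where "b = a * o' mod P'"
    have bP: "b < P'" by (simp add: b_def P'_def)
    have "odd (a * o')" using o by (simp add: a_def)
    then have bodd: "odd b" using t by (simp add: b_def P'_def dvd_mod_iff)
    \<comment> \<open>\<open>X + (P - Y)\<close> plays the role of \<open>X - Y\<close> modulo
      \<open>P\<close>, as subtraction on naturals truncates.\<close>
    have "(X + (P - Y)) mod P = 2 ^ t * b"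
    proof -
      have "2 ^ t * b = a * (x - y) mod P"
        by (simp only: b_def PP' d mult_mod_right mult.left_commute)
      also have "\<dots> = (a * (x - y) + (a * y mod P) + (P - a * y mod P)) mod P"
        using P0 by (simp add: add.assoc)
      also have "\<dots> = (a * (x - y) + a * y + (P - a * y mod P)) mod P"
        by (metis mod_add_left_eq mod_add_right_eq)
      also have "a * (x - y) + a * y = a * x" using xy by (simp add: algebra_simps)
      also have "(a * x + (P - a * y mod P)) mod P = (X + (P - Y)) mod P"
        by (simp add: X_def Y_def mod_add_left_eq)
      finally show ?thesis by simp
    qed
    moreover have "X < P" "Y < P" using P0 by (simp_all add: X_def Y_def)
    moreover have "X < Y + sh" "Y < X + sh"
    proof -
      have "X = Y div sh * sh + X mod sh" "Y = Y div sh * sh + Y mod sh"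
        using div_mult_mod_eq[of X sh] div_mult_mod_eq[of Y sh] XY by simp_all
      moreover have "X mod sh < sh" "Y mod sh < sh" using P0 by simp_all
      ultimately show "X < Y + sh" "Y < X + sh" by linarith+
    qed
    ultimately have "2 ^ t * b < sh \<or> P < 2 ^ t * b + sh"
    proof (cases "Y \<le> X")
      case True
      then have "X + (P - Y) = (X - Y) + P" using \<open>Y < P\<close> by simp
      then have "(X + (P - Y)) mod P = (X - Y) mod P" by (metis mod_add_self2)
      then have "(X + (P - Y)) mod P = X - Y" using \<open>X < P\<close> by simp
      then show ?thesis using \<open>X < Y + sh\<close> \<open>(X + (P - Y)) mod P = 2 ^ t * b\<close> True by linarith
    next
      case False
      then have "(X + (P - Y)) mod P = X + (P - Y)" using \<open>Y < P\<close> by (intro mod_less) simp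
      then show ?thesis using \<open>Y < X + sh\<close> \<open>(X + (P - Y)) mod P = 2 ^ t * b\<close> False \<open>Y <
          P\<close> by linarith
    qed
    then have near: "2 ^ t * b < sh \<or> 2 ^ t * (P' - b) < sh"
      using P0(2) unfolding PP' diff_mult_distrib2 by linarith
    have b0: "0 < b" "0 < P' - b" using bodd bP by (auto intro!: Nat.gr0I)
    have lt: "m + t < l"
    proof (rule ccontr)
      assume "\<not> m + t < l"
      then have "sh \<le> 2 ^ t" using m by (auto simp: sh_def)
      then have "sh \<le> 2 ^ t * b" "sh \<le> 2 ^ t * (P' - b)"
        using b0 by (metis Suc_leI mult.right_neutral One_nat_def mult_le_mono)+
      then show False using near by linarith
    qed
    have shd: "sh = 2 ^ t * 2 ^ (l - m - t)" using lt by (simp add: sh_def power_add[symmetric])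
    have "odd (P' - b)" using bodd bP t by (simp add: P'_def)
    then have "b \<in> bs"
      using near lt bodd bP by (auto simp: bs_def shd intro!: image_eqI[of _ _ "P' - b"])
    then show ?thesis by (simp add: b_def a_def)
  qed
  have fin: "finite bs" by (simp add: bs_def)
  \<comment> \<open>At most \<open>2 * 2 ^ (l - m - t - 1)\<close> residues, each hit by at most
    \<open>2 ^ (t + 1)\<close> seeds. The powers of \<open>t\<close> cancel, so the final bound does
    not depend on the difference of the keys.\<close>
  have cbs: "card bs * 2 ^ m * 2 ^ (t + 1) \<le> 2 * 2 ^ l"
  proof (cases "m + t < l")
    case True
    let ?O = "{b. odd b \<and> b < (2::nat) ^ (l - m - t)}"
    have "card bs \<le> card ?O + card ((\<lambda>b. P' - b) ` ?O)"
      using True by (simp add: bs_def card_Un_le)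
    also have "\<dots> \<le> 2 * card ?O" using card_image_le[of ?O "\<lambda>b. P' - b"] by simp
    also have "\<dots> \<le> 2 * 2 ^ (l - m - t - 1)" using card_odd_less[of "l - m - t"] by simp
    also have "\<dots> = 2 ^ Suc (l - m - t - 1)" by (simp only: power_Suc)
    also have "Suc (l - m - t - 1) = l - m - t" using True by linarith
    finally have "card bs * (2 ^ m * 2 ^ (t + 1)) \<le> 2 ^ (l - m - t) * (2 ^ m * 2 ^ (t + 1))"
      by (rule mult_le_mono1)
    also have "\<dots> = 2 ^ (l - m - t + (m + (t + 1)))" by (simp only: power_add)
    also have "l - m - t + (m + (t + 1)) = Suc l" using True by linarith
    also have "(2::nat) ^ Suc l = 2 * 2 ^ l" by (simp only: power_Suc)
    finally show ?thesis by (simp add: mult.assoc)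
  qed (simp add: bs_def)
  have sub: "{e. e < P \<and> mshash P (2 ^ m) e x = mshash P (2 ^ m) e y}
      \<subseteq> (\<Union>b\<in>bs. {e. e < 2 ^ l \<and> (2 * e + 1) * o' mod 2 ^ (l - t) = b})"
    using inbs unfolding P'_def P_def by fast
  have "card {e. e < P \<and> mshash P (2 ^ m) e x = mshash P (2 ^ m) e y}
      \<le> card (\<Union>b\<in>bs. {e. e < 2 ^ l \<and> (2 * e + 1) * o' mod 2 ^ (l - t) = b})"
    using fin by (intro card_mono sub finite_UN_I) auto
  also have "\<dots> \<le> (\<Sum>b\<in>bs. card {e. e < 2 ^ l \<and> (2 * e + 1) * o' mod 2 ^ (l - t) = b})"
    using fin by (rule card_UN_le)
  also have "\<dots> \<le> (\<Sum>b\<in>bs. 2 ^ (t + 1))"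
    using o t by (intro sum_mono card_mult_residue_le)
  finally have "card {e. e < P \<and> mshash P (2 ^ m) e x = mshash P (2 ^ m) e y} \<le> card bs * 2 ^ (t + 1)"
    by simp
  then have "card {e. e < P \<and> mshash P (2 ^ m) e x = mshash P (2 ^ m) e y} * 2 ^ m
      \<le> card bs * 2 ^ (t + 1) * 2 ^ m" by (rule mult_le_mono1)
  also have "\<dots> = card bs * 2 ^ m * 2 ^ (t + 1)" by (simp only: mult_ac)
  finally show ?thesis using cbs unfolding P_def by (rule order_trans)
qed

lemma mshash_collisions:
  fixes x y :: nat
  assumes "x \<noteq> y" "x < 2 ^ l" "y < 2 ^ l" "m \<le> l"
  shows "card {e. e < 2 ^ l \<and> mshash (2 ^ l) (2 ^ m) e x = mshash (2 ^ l) (2 ^ m) e y} * 2 ^ m \<le> 2 * 2 ^ l"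
proof (cases "y < x")
  case False
  then have "x < y" using assms by simp
  moreover have "{e. e < 2 ^ l \<and> mshash (2 ^ l) (2 ^ m) e x = mshash (2 ^ l) (2 ^ m) e y}
      = {e. e < 2 ^ l \<and> mshash (2 ^ l) (2 ^ m) e y = mshash (2 ^ l) (2 ^ m) e x}"
    by (intro Collect_cong) metis
  ultimately show ?thesis using mshash_collisions_aux[of x y l m] assms(3,4) by (simp only:)
next
  case True
  then show ?thesis using mshash_collisions_aux[of y x l m] assms(2,4) by blast
qed

text \<open>Averaging over the seeds: by the union bound over partners \<open>j\<close>, item
  \<open>i\<close> collides for at most a fraction \<open>2 * card A / 2 ^ m\<close> of them, so
  some seed keeps the colliding weight below that fraction of the total. Unit weights give
  injectivity of the keys, degrees as weights give the halving in each round.\<close>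

lemma mshash_good:
  fixes key :: "'a \<Rightarrow> nat" and wt :: "'a \<Rightarrow> nat"
  assumes fin: "finite A" and inj: "inj_on key A" and ub: "\<And>i. i \<in> A \<Longrightarrow> key i < 2 ^ l" and m: "m \<le> l"
  obtains e where "e < 2 ^ l"
    "(\<Sum>i | i \<in> A \<and> (\<exists>j\<in>A. j \<noteq> i \<and> mshash (2 ^ l) (2 ^ m) e (key i) = mshash (2 ^ l)
        (2 ^ m) e (key j)). wt i) * 2 ^ m
       \<le> 2 * card A * (\<Sum>i\<in>A. wt i)"
proof -
  define h where "h e i = mshash (2 ^ l) (2 ^ m) e (key i)" for e i
  define bad where "bad e = (\<Sum>i | i \<in> A \<and> (\<exists>j\<in>A. j \<noteq> i \<and> h e i = h e j). wt i)" for e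
  have total: "(\<Sum>e<2 ^ l. bad e * 2 ^ m) \<le> 2 ^ l * (2 * card A * (\<Sum>i\<in>A. wt i))"
  proof -
    have b: "bad e \<le> (\<Sum>i\<in>A. \<Sum>j\<in>A. if j \<noteq> i \<and> h e i = h e j then wt i else 0)" for e
    proof -
      have "bad e = (\<Sum>i\<in>A. if \<exists>j\<in>A. j \<noteq> i \<and> h e i = h e j then wt i else 0)"
        unfolding bad_def by (simp only: sum.inter_filter[OF fin])
      also have "\<dots> \<le> (\<Sum>i\<in>A. \<Sum>j\<in>A. if j \<noteq> i \<and> h e i = h e j then wt i else 0)"
      proof (rule sum_mono)
        fix i assume i: "i \<in> A"
        show "(if \<exists>j\<in>A. j \<noteq> i \<and> h e i = h e j then wt i else 0) \<le> (\<Sum>j\<in>A. if j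
            \<noteq> i \<and> h e i = h e j then wt i else 0)"
        proof (cases "\<exists>j\<in>A. j \<noteq> i \<and> h e i = h e j")
          case True
          then obtain j where j: "j \<in> A" "j \<noteq> i \<and> h e i = h e j" by blast
          have "(if j \<noteq> i \<and> h e i = h e j then wt i else 0) \<le> (\<Sum>j\<in>A. if j \<noteq> i \<and> h e
              i = h e j then wt i else 0)"
            using fin j(1) by (intro member_le_sum) simp_all
          then show ?thesis unfolding if_P[OF True] if_P[OF j(2)] .
        next
          case False
          show ?thesis unfolding if_not_P[OF False] by simp
        qed
      qed
      finally show ?thesis .
    qed
    \<comment> \<open>Interchanging the sums puts the seeds innermost, where the collision count for
      a fixed pair of items applies.\<close>
    have "(\<Sum>e<2 ^ l. bad e * 2 ^ m)
        \<le> (\<Sum>e<2 ^ l. (\<Sum>i\<in>A. \<Sum>j\<in>A. if j \<noteq> i \<and> h e i = h e j then wt i else 0) * 2 ^ m)"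
      using b by (intro sum_mono mult_le_mono1)
    also have "\<dots> = (\<Sum>i\<in>A. \<Sum>j\<in>A. (\<Sum>e<2 ^ l. if j \<noteq> i \<and> h e i = h e j then wt i
        else 0) * 2 ^ m)"
      by (simp only: sum_distrib_right) (subst sum.swap, rule sum.cong[OF refl], rule sum.swap)
    also have "\<dots> \<le> (\<Sum>i\<in>A. \<Sum>j\<in>A. wt i * (2 * 2 ^ l))"
    proof (intro sum_mono)
      fix i j assume ij: "i \<in> A" "j \<in> A"
      show "(\<Sum>e<2 ^ l. if j \<noteq> i \<and> h e i = h e j then wt i else 0) * 2 ^ m \<le> wt i * (2 * 2 ^ l)"
      proof (cases "j = i")
        case False
        then have "key i \<noteq> key j" using ij inj by (auto dest: inj_onD)
        then have c: "card {e. e < 2 ^ l \<and> h e i = h e j} * 2 ^ m \<le> 2 * 2 ^ l"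
          unfolding h_def using ij ub m by (intro mshash_collisions) auto
        have "(\<Sum>e<2 ^ l. if j \<noteq> i \<and> h e i = h e j then wt i else 0) = wt i * card {e. e < 2 ^ l \<and> h
            e i = h e j}"
          using False by (simp add: sum.If_cases Int_def)
        then have "(\<Sum>e<2 ^ l. if j \<noteq> i \<and> h e i = h e j then wt i else 0) * 2 ^ m
            = wt i * (card {e. e < 2 ^ l \<and> h e i = h e j} * 2 ^ m)" by (simp only: mult.assoc)
        also have "\<dots> \<le> wt i * (2 * 2 ^ l)" using c by (rule mult_le_mono2)
        finally show ?thesis .
      qed simp
    qed
    also have "\<dots> = 2 ^ l * (2 * card A * (\<Sum>i\<in>A. wt i))"
      by (simp add: sum_distrib_left sum_distrib_right mult_ac)
    finally show ?thesis .
  qed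
  have "\<exists>e<2 ^ l. bad e * 2 ^ m \<le> 2 * card A * (\<Sum>i\<in>A. wt i)"
  proof (rule ccontr)
    assume "\<not> (\<exists>e<2 ^ l. bad e * 2 ^ m \<le> 2 * card A * (\<Sum>i\<in>A. wt i))"
    then have gt: "2 * card A * (\<Sum>i\<in>A. wt i) < bad e * 2 ^ m" if "e < 2 ^ l" for e
      using that not_le by blast
    have "(0::nat) \<in> {..<2 ^ l}" by simp
    then have "{..<(2::nat) ^ l} \<noteq> {}" by blast
    then have "(\<Sum>e<(2::nat) ^ l. 2 * card A * (\<Sum>i\<in>A. wt i)) < (\<Sum>e<2 ^ l. bad e * 2 ^ m)"
      using gt by (intro sum_strict_mono) simp_all
    then show False using total by simp
  qed
  then obtain e where "e < 2 ^ l" "bad e * 2 ^ m \<le> 2 * card A * (\<Sum>i\<in>A. wt i)" by blast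
  then show ?thesis unfolding bad_def h_def by (rule that)
qed

section \<open>Separators\<close>

text \<open>A number \<open>z\<close> in base \<open>D\<close> describes a set of separators among the positions
    \<open>0, 1, \<dots>\<close>:
  its digits, lowest first, are the gaps between consecutive separators. A position which is not a
  separator is coloured by the number \<open>c\<close> of separators below it, and \<open>walk\<close> returns \<open>pw
      * B ^ c\<close>.
  For a separator, or a position beyond the last one, it returns \<open>0\<close>.\<close>

function walk :: "nat \<Rightarrow> nat \<Rightarrow> nat \<Rightarrow> nat \<Rightarrow> nat \<Rightarrow> nat" where
  "walk D B z x pw =
     (if z = 0 \<or> D < 2 then 0
      else if x < z mod D then pw
      else if z mod D < x then walk D B (z div D) (x - z mod D - 1) (pw * B)
      else 0)"
  by pat_completeness auto
termination by (relation "measure (\<lambda>(D, B, z, x, pw). z)") auto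

declare walk.simps [simp del]

lemma walk_0 [simp]: "walk D B 0 x pw = 0"
  by (simp add: walk.simps)

fun gap_colour :: "nat list \<Rightarrow> nat \<Rightarrow> nat option" where
  "gap_colour [] x = None"
| "gap_colour (d # ds) x =
     (if x < d then Some 0 else if x = d then None else map_option Suc (gap_colour ds (x - d - 1)))"

fun of_digits :: "nat \<Rightarrow> nat list \<Rightarrow> nat" where
  "of_digits D [] = 0"
| "of_digits D (d # ds) = d + D * of_digits D ds"

lemma of_digits_less: "\<forall>d\<in>set ds. d < D \<Longrightarrow> of_digits D ds < D ^ length ds"
proof (induction ds)
  case (Cons d ds)
  then have "D * Suc (of_digits D ds) \<le> D * D ^ length ds"
    by (intro mult_le_mono2) auto
  then show ?case using Cons.prems by auto
qed simp

text \<open>\<open>walk\<close> stops when the remaining number is \<open>0\<close> and so cannot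
  see trailing zero gaps. This is consistent, since a list of zero gaps consists of separators only
  and colours nothing.\<close>

lemma gap_colour_zero_digits:
  "of_digits D ds = 0 \<Longrightarrow> 0 < D \<Longrightarrow> gap_colour ds x = None"
  by (induction ds arbitrary: x) auto

lemma walk_gap_colour:
  assumes "2 \<le> D" "\<forall>d\<in>set ds. d < D"
  shows "walk D B (of_digits D ds) x pw = (case gap_colour ds x of None \<Rightarrow> 0 | Some c \<Rightarrow> pw * B ^ c)"
  using assms(2)
proof (induction ds arbitrary: x pw)
  case (Cons d ds)
  have d: "d < D" using Cons.prems by simp
  show ?case
  proof (cases "of_digits D (d # ds) = 0")
    case True
    then have "gap_colour (d # ds) x = None" using gap_colour_zero_digits[of D "d # ds"] assms by simp
    then show ?thesis using True by (simp only: walk_0 option.case)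
  next
    case False
    have "of_digits D (d # ds) mod D = d" "of_digits D (d # ds) div D = of_digits D ds"
      using d by simp_all
    then show ?thesis
      using False assms(1) Cons by (subst walk.simps) (auto split: option.split)
  qed
qed simp

definition gap_total :: "nat list \<Rightarrow> nat" where
  "gap_total ds = (\<Sum>d\<leftarrow>ds. d + 1)"

lemma gap_total_simps [simp]:
  "gap_total [] = 0" "gap_total (d # ds) = d + 1 + gap_total ds" "gap_total (ds @ ds') = gap_total ds + gap_total ds'"
  by (simp_all add: gap_total_def)

lemma gap_colour_append1: "x < gap_total ds \<Longrightarrow> gap_colour (ds @ ds') x = gap_colour ds x"
  by (induction ds arbitrary: x) auto

lemma gap_colour_append2:
  "gap_total ds \<le> x \<Longrightarrow>
   gap_colour (ds @ ds') x = map_option (\<lambda>c. c + length ds) (gap_colour ds' (x - gap_total ds))"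
proof (induction ds arbitrary: x)
  case (Cons d ds)
  have "x - d - 1 - gap_total ds = x - gap_total (d # ds)" by simp
  with Cons show ?case by (auto simp: option.map_comp comp_def)
qed (simp add: option.map_ident)

text \<open>The colouring while the list of gaps is still being built from left to right.\<close>

definition part_colour :: "nat list \<Rightarrow> nat \<Rightarrow> nat option" where
  "part_colour ds x = (if x < gap_total ds then gap_colour ds x else Some (length ds))"

lemma part_colour_snoc:
  assumes "x < gap_total ds + e"
  shows "part_colour (ds @ [e]) x = part_colour ds x"
  using assms by (auto simp: part_colour_def gap_colour_append1 gap_colour_append2)

lemma part_colour_sep:
  "part_colour (ds @ [e]) (gap_total ds + e) = None"
  by (simp add: part_colour_def gap_colour_append2)

lemma part_colour_final:
  assumes "x < gap_total ds + e" "e \<le> d"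
  shows "gap_colour (ds @ [d]) x = part_colour ds x"
  using assms by (auto simp: part_colour_def gap_colour_append1 gap_colour_append2)

text \<open>Cells occupy the odd positions only. The even positions stay free for cuts between
  classes, so that a cut removes no cell.\<close>

definition class_weight :: "(nat \<Rightarrow> nat) \<Rightarrow> nat set \<Rightarrow> nat list \<Rightarrow> nat
    \<Rightarrow> nat \<Rightarrow> nat" where
  "class_weight w Bd ds P c = (\<Sum>p | p < P \<and> p \<notin> Bd \<and> part_colour ds (2 * p + 1) = Some c. w p)"

text \<open>\<open>sep_state w Bd r D P x ds e l C F\<close>: all positions below \<open>x\<close> (and so all cells
    below \<open>P\<close>, cell
  \<open>p\<close> being position \<open>2 * p + 1\<close>) have been processed, \<open>e\<close> of them after the last
      separator; \<open>l\<close> is the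
  weight of the current colour class; \<open>C\<close> separators have been set since the class would have become
  too heavy, and \<open>F\<close> since the gap would have become too long.\<close>

definition sep_state ::
    "(nat \<Rightarrow> nat) \<Rightarrow> nat set \<Rightarrow> nat \<Rightarrow> nat \<Rightarrow> nat \<Rightarrow>
        nat \<Rightarrow> nat list \<Rightarrow> nat \<Rightarrow> nat \<Rightarrow> nat \<Rightarrow> nat \<Rightarrow>
        bool" where
  "sep_state w Bd r D P x ds e l C F \<longleftrightarrow>
     (\<forall>d\<in>set ds. d < D) \<and> gap_total ds + e = x \<and> 2 * P \<le> x \<and>
     length ds = card (Bd \<inter> {..<P}) + C + F \<and> F * (D - 2) + e \<le> x \<and>
     (\<forall>p<P. p \<in> Bd \<longrightarrow> part_colour ds (2 * p + 1) = None) \<and>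
     (\<forall>p<P. p \<notin> Bd \<longrightarrow> (\<exists>c\<le>length ds. part_colour ds (2 * p + 1) = Some c)) \<and>
     (\<forall>c. class_weight w Bd ds P c \<le> (if c = length ds then l else r))"

lemma class_weight_snoc:
  assumes "2 * P \<le> gap_total ds + e"
  shows "class_weight w Bd (ds @ [e]) P c = class_weight w Bd ds P c"
proof -
  have "part_colour (ds @ [e]) (2 * p + 1) = part_colour ds (2 * p + 1)" if "p < P" for p
    using assms that by (intro part_colour_snoc) simp
  then show ?thesis unfolding class_weight_def by (intro sum.cong) auto
qed

lemma sep_state_snoc:
  assumes "sep_state w Bd r D P x ds e l C F" "e < D" "l \<le> r"
    and len: "Suc (card (Bd \<inter> {..<P}) + C + F) = card (Bd \<inter> {..<P}) + C' + F'"
    and F': "F' * (D - 2) \<le> x + 1"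
  shows "sep_state w Bd r D P (x + 1) (ds @ [e]) 0 0 C' F'"
proof -
  note st = assms(1)[unfolded sep_state_def]
  have P: "2 * P \<le> gap_total ds + e" using st by simp
  have pc: "part_colour (ds @ [e]) (2 * p + 1) = part_colour ds (2 * p + 1)" if "p < P" for p
    using P that by (intro part_colour_snoc) simp
  have cw: "class_weight w Bd ds P c \<le> (if c = length (ds @ [e]) then 0 else r)" for c
  proof (cases "c = length (ds @ [e])")
    case True
    have "{p. p < P \<and> p \<notin> Bd \<and> part_colour ds (2 * p + 1) = Some c} = {}"
      using st True by fastforce
    then have "class_weight w Bd ds P c = 0" unfolding class_weight_def by (simp only: sum.empty)
    then show ?thesis by simp
  next
    case False
    have "class_weight w Bd ds P c \<le> (if c = length ds then l else r)" using st by blast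
    then show ?thesis using False assms(3) by (auto split: if_splits)
  qed
  show ?thesis
    unfolding sep_state_def class_weight_snoc[OF P]
  proof (intro conjI)
    show "\<forall>p<P. p \<notin> Bd \<longrightarrow> (\<exists>c\<le>length (ds @ [e]). part_colour (ds @ [e]) (2 * p
        + 1) = Some c)"
      using st pc by (metis le_SucI length_append_singleton)
    show "\<forall>c. class_weight w Bd ds P c \<le> (if c = length (ds @ [e]) then 0 else r)" using cw by blast
    show "\<forall>p<P. p \<in> Bd \<longrightarrow> part_colour (ds @ [e]) (2 * p + 1) = None" using st pc by simp
  qed (use st assms(2) len F' in auto)
qed

lemma class_weight_Suc:
  "class_weight w Bd ds (Suc P) c =
     class_weight w Bd ds P c + (if P \<notin> Bd \<and> part_colour ds (2 * P + 1) = Some c then w P else 0)"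
proof -
  let ?S = "\<lambda>P. {p. p < P \<and> p \<notin> Bd \<and> part_colour ds (2 * p + 1) = Some c}"
  have "?S (Suc P) = (if P \<notin> Bd \<and> part_colour ds (2 * P + 1) = Some c then insert P (?S P) else ?S P)"
    by (auto simp: less_Suc_eq)
  then show ?thesis unfolding class_weight_def by auto
qed

text \<open>A greedy scan with two amortised accounts: separators that end a heavy class are paid by
  weight, those that end a long gap by positions.\<close>

lemma sep_scan:
  assumes r: "0 < r" and D: "3 \<le> D" and w: "\<And>p. w p \<le> r" "\<And>p. p \<in> Bd \<Longrightarrow> w p = 0"
  shows "\<exists>ds e l C F. sep_state w Bd r D P (2 * P) ds e l C F \<and> e < D \<and> l \<le> r \<and>
           C * r + l \<le> 2 * (\<Sum>p<P. w p)"
proof (induction P)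
  case 0
  have "sep_state w Bd r D 0 (2 * 0) [] 0 0 0 0"
    by (simp add: sep_state_def class_weight_def)
  then show ?case using D by force
next
  case (Suc P)
  then obtain ds e l C F where st: "sep_state w Bd r D P (2 * P) ds e l C F"
    and e: "e < D" and l: "l \<le> r" and C: "C * r + l \<le> 2 * (\<Sum>p<P. w p)" by blast
  \<comment> \<open>The even position \<open>2 * P\<close> comes first; it carries a separator if
    cell \<open>P\<close> would overload the class or if the gap is about to become too
    long.\<close>
  have "\<exists>ds e l C F. sep_state w Bd r D P (2 * P + 1) ds e l C F \<and> e < D - 1 \<and> l + w P \<le> r \<and>
      C * r + l \<le> 2 * (\<Sum>p<P. w p) + w P"
  proof (cases "r < l + w P")
    case True
    have "sep_state w Bd r D P (2 * P + 1) (ds @ [e]) 0 0 (Suc C) F"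
      using st e l by (rule sep_state_snoc) (use st in \<open>auto simp: sep_state_def\<close>)
    \<comment> \<open>The weight \<open>w P\<close> of the cell that does not fit completes the
      payment of \<open>r\<close> for the closed class. It is charged again as the initial load of
      the next class, hence the factor two.\<close>
    moreover have "Suc C * r + 0 \<le> 2 * (\<Sum>p<P. w p) + w P" using C True by simp
    moreover have "0 < D - 1" "0 + w P \<le> r" using D w(1) by simp_all
    ultimately show ?thesis by blast
  next
    case False
    show ?thesis
    \<comment> \<open>Two positions pass before the next opportunity to cut, so a gap is closed as
      soon as it reaches \<open>D - 2\<close>; then it never reaches \<open>D\<close>.\<close>
    proof (cases "e < D - 2")
      case True
      have "sep_state w Bd r D P (2 * P + 1) ds (Suc e) l C F"
        using st unfolding sep_state_def by (elim conjE, intro conjI) (assumption | linarith)+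
      then show ?thesis using True False C
        by (intro exI[of _ ds] exI[of _ "Suc e"] exI[of _ l] exI[of _ C] exI[of _ F]) auto
    next
      case F2: False
      have "sep_state w Bd r D P (2 * P + 1) (ds @ [e]) 0 0 C (Suc F)"
        using st e l by (rule sep_state_snoc) (use st F2 in \<open>auto simp: sep_state_def\<close>)
      moreover have "C * r + 0 \<le> 2 * (\<Sum>p<P. w p) + w P" using C by simp
      moreover have "0 < D - 1" "0 + w P \<le> r" using D w(1) by simp_all
      ultimately show ?thesis by blast
    qed
  qed
  then obtain ds e l C F where st: "sep_state w Bd r D P (2 * P + 1) ds e l C F"
    and e: "e < D - 1" and l: "l + w P \<le> r" and C: "C * r + l \<le> 2 * (\<Sum>p<P. w p) + w P" by blast
  note st' = st[unfolded sep_state_def]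
  have tot: "gap_total ds + e = 2 * P + 1" using st' by simp
  have pcP: "part_colour ds (2 * P + 1) = Some (length ds)"
    using tot by (simp add: part_colour_def)
  show ?case
  proof (cases "P \<in> Bd")
    case False
    have bd: "Bd \<inter> {..<Suc P} = Bd \<inter> {..<P}" using False by (auto simp: less_Suc_eq)
    have cw: "class_weight w Bd ds (Suc P) c \<le> (if c = length ds then l + w P else r)" for c
    proof -
      have "class_weight w Bd ds P c \<le> (if c = length ds then l else r)" using st' by blast
      then show ?thesis using False pcP by (auto simp: class_weight_Suc)
    qed
    have "sep_state w Bd r D (Suc P) (2 * Suc P) ds (Suc e) (l + w P) C F"
      unfolding sep_state_def bd using st' cw pcP False by (auto simp: less_Suc_eq)
    moreover have "Suc e < D" "C * r + (l + w P) \<le> 2 * (\<Sum>p<Suc P. w p)" using e C by simp_all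
    ultimately show ?thesis using l by blast
  next
    case True
    have "Bd \<inter> {..<Suc P} = insert P (Bd \<inter> {..<P})" using True by (auto simp: less_Suc_eq)
    then have bd: "card (Bd \<inter> {..<Suc P}) = Suc (card (Bd \<inter> {..<P}))" by simp
    have P2: "2 * P \<le> gap_total ds + e" using tot by simp
    have pc: "part_colour (ds @ [e]) (2 * p + 1) = part_colour ds (2 * p + 1)" if "p < P" for p
      using P2 that by (intro part_colour_snoc) simp
    have pcs: "part_colour (ds @ [e]) (2 * P + 1) = None"
      using part_colour_sep[of ds e] tot by simp
    have cw: "class_weight w Bd (ds @ [e]) (Suc P) c \<le> (if c = length (ds @ [e]) then 0 else r)" for c
    proof -
      have "class_weight w Bd (ds @ [e]) (Suc P) c = class_weight w Bd ds P c"
        using True by (simp add: class_weight_Suc class_weight_snoc[OF P2])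
      moreover have "class_weight w Bd ds P c \<le> (if c = length (ds @ [e]) then 0 else r)"
      proof (cases "c = length (ds @ [e])")
        case True
        have "{p. p < P \<and> p \<notin> Bd \<and> part_colour ds (2 * p + 1) = Some c} = {}"
          using st' True by fastforce
        then have "class_weight w Bd ds P c = 0" unfolding class_weight_def by (simp only: sum.empty)
        then show ?thesis by simp
      next
        case False
        have "class_weight w Bd ds P c \<le> (if c = length ds then l else r)" using st' by blast
        then show ?thesis using False l by (auto split: if_splits)
      qed
      ultimately show ?thesis by simp
    qed
    have "sep_state w Bd r D (Suc P) (2 * Suc P) (ds @ [e]) 0 0 C F"
      unfolding sep_state_def bd using st' cw pc pcs True e
      by (auto simp: less_Suc_eq intro: le_SucI)
    moreover have "C * r + 0 \<le> 2 * (\<Sum>p<Suc P. w p)" using C by simp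
    moreover have "0 < D" using D by simp
    ultimately show ?thesis by blast
  qed
qed

text \<open>The number of separators, times \<open>r\<close>, is at most \<open>k\<close> for the
  cells in \<open>Bd\<close>, \<open>2 * k\<close> for cuts by weight and \<open>k\<close> for cuts
  by length. The last of the \<open>q\<close> gaps closes the final class.\<close>

lemma separators_exist:
  fixes w :: "nat \<Rightarrow> nat"
  assumes r: "0 < r" and w: "\<And>p. w p \<le> r" "\<And>p. p \<in> Bd \<Longrightarrow> w p = 0"
    and D: "2 * N \<le> k * ((D - 2) div r)" "3 \<le> D"
    and Bd: "card (Bd \<inter> {..<N}) * r \<le> k" and tw: "(\<Sum>p<N. w p) \<le> k" and q: "4 * k div r + 1 \<le> q"
  obtains z c where "z < D ^ q"
    "\<And>p B pw. p < N \<Longrightarrow> p \<in> Bd \<Longrightarrow> walk D B z (2 * p + 1) pw = 0"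
    "\<And>p B pw. p < N \<Longrightarrow> p \<notin> Bd \<Longrightarrow> walk D B z (2 * p + 1) pw = pw * B ^ c p
        \<and> c p < q"
    "\<And>j. (\<Sum>p | p < N \<and> p \<notin> Bd \<and> c p = j. w p) \<le> r"
proof -
  obtain ds e l C F where st: "sep_state w Bd r D N (2 * N) ds e l C F"
    and e: "e < D" and l: "l \<le> r" and C: "C * r + l \<le> 2 * (\<Sum>p<N. w p)"
    using sep_scan[OF r D(2), of w Bd N] w by blast
  note st' = st[unfolded sep_state_def]
  \<comment> \<open>Each separator forced by length consumes \<open>D - 2\<close> of the
    \<open>2 * N\<close> positions; the premise on \<open>D\<close> converts this into the budget
    \<open>k\<close>.\<close>
  have "F * r \<le> k"
  proof (cases "F = 0")
    case False
    have Fk: "F * (D - 2) \<le> k * ((D - 2) div r)" using st' D by linarith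
    have "0 < (D - 2) div r"
    proof (rule ccontr)
      assume "\<not> 0 < (D - 2) div r"
      then have "F * (D - 2) = 0" using Fk by simp
      then show False using False D(2) by simp
    qed
    moreover have "F * r * ((D - 2) div r) \<le> F * (D - 2)"
      by (simp add: mult.assoc mult_le_mono2)
    ultimately show ?thesis using Fk by (metis mult_le_cancel2 order_trans)
  qed simp
  moreover have "C * r \<le> 2 * k" using C tw by linarith
  moreover have "length ds * r = card (Bd \<inter> {..<N}) * r + C * r + F * r"
    using st' by (simp add: algebra_simps)
  ultimately have "length ds * r \<le> 4 * k" using Bd by linarith
  then have "length ds \<le> 4 * k div r" using r by (simp add: less_eq_div_iff_mult_less_eq)
  \<comment> \<open>The final gap is the largest digit \<open>D - 1\<close>. It reaches past the
    last cell, so the class still open at the end of the scan gets its colour.\<close>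
  then have len: "length (ds @ [D - 1]) \<le> q" using q by simp
  define z where "z = of_digits D (ds @ [D - 1])"
  have dig: "\<forall>d\<in>set (ds @ [D - 1]). d < D" using st' D by auto
  have "z < D ^ q"
    using of_digits_less[OF dig] power_increasing[OF len, of D] D unfolding z_def by linarith
  have wk: "walk D B z (2 * p + 1) pw = (case part_colour ds (2 * p + 1) of None \<Rightarrow> 0 | Some c \<Rightarrow>
      pw * B ^ c)"
    if "p < N" for p B pw
  proof -
    have "gap_colour (ds @ [D - 1]) (2 * p + 1) = part_colour ds (2 * p + 1)"
    proof (rule part_colour_final)
      have "gap_total ds + e = 2 * N" using st' by blast
      then show "2 * p + 1 < gap_total ds + e" using that by linarith
    qed (use e in simp)
    moreover have "walk D B z (2 * p + 1) pw
        = (case gap_colour (ds @ [D - 1]) (2 * p + 1) of None \<Rightarrow> 0 | Some c \<Rightarrow> pw * B ^ c)"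
      unfolding z_def using dig D by (intro walk_gap_colour) auto
    ultimately show ?thesis by simp
  qed
  define c where "c p = the (part_colour ds (2 * p + 1))" for p
  have bad_sep: "\<forall>p<N. p \<in> Bd \<longrightarrow> part_colour ds (2 * p + 1) = None"
    and good: "\<forall>p<N. p \<notin> Bd \<longrightarrow> (\<exists>c\<le>length ds. part_colour ds (2 * p + 1) = Some c)"
    and cw: "\<forall>c. class_weight w Bd ds N c \<le> (if c = length ds then l else r)"
    by (insert st', (elim conjE, assumption)+)
  have sc: "part_colour ds (2 * p + 1) = Some (c p) \<and> c p \<le> length ds" if pN: "p < N" "p \<notin> Bd" for p
  proof -
    obtain c' where "c' \<le> length ds" "part_colour ds (2 * p + 1) = Some c'" using good pN by blast
    then show ?thesis unfolding c_def by simp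
  qed
  have nb: "part_colour ds (2 * p + 1) = None" if "p < N" "p \<in> Bd" for p
    using bad_sep that by simp
  show ?thesis
  proof (rule that[of z c])
    show "z < D ^ q" by fact
    show "walk D B z (2 * p + 1) pw = 0" if "p < N" "p \<in> Bd" for p B pw
      using wk[OF that(1)] nb[OF that] by simp
    show "walk D B z (2 * p + 1) pw = pw * B ^ c p \<and> c p < q" if "p < N" "p \<notin> Bd" for p B pw
      using wk[OF that(1)] sc[OF that] len by simp
    show "(\<Sum>p | p < N \<and> p \<notin> Bd \<and> c p = j. w p) \<le> r" for j
    proof -
      have "{p. p < N \<and> p \<notin> Bd \<and> c p = j} = {p. p < N \<and> p \<notin> Bd \<and> part_colour ds (2 * p
          + 1) = Some j}"
        using sc by (intro Collect_cong) auto
      then have "(\<Sum>p | p < N \<and> p \<notin> Bd \<and> c p = j. w p) = class_weight w Bd ds N j"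
        by (simp only: class_weight_def)
      moreover have "class_weight w Bd ds N j \<le> (if j = length ds then l else r)" using cw ..
      ultimately show ?thesis using l by (simp split: if_splits)
    qed
  qed
qed

section \<open>Rounds of hashing\<close>

text \<open>A round with \<open>M\<close> cells uses the numbers from \<open>M\<close> to
  \<open>2 * M - 1\<close>, as in a binary heap. Halving \<open>M\<close> thus keeps the rounds
  disjoint without any stored offsets.\<close>

fun place :: "nat set \<Rightarrow> nat \<Rightarrow> nat list \<Rightarrow> nat \<Rightarrow> nat \<Rightarrow> nat option" where
  "place Bd K [] M y = None"
| "place Bd K (e # es) M y =
     (if M + mshash K M e y \<in> Bd then place Bd K es (M div 2) y else Some (M + mshash K M e y))"

lemma place_not_bad: "place Bd K es M y = Some p \<Longrightarrow> p \<notin> Bd"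
  by (induction es arbitrary: M) (auto split: if_splits)

lemma mshash_pow_less: "m \<le> l \<Longrightarrow> mshash (2 ^ l) (2 ^ m) e y < 2 ^ m"
  by (rule mshash_less) (auto simp: le_imp_power_dvd)

lemma place_less:
  "place Bd (2 ^ l) es (2 ^ m) y = Some p \<Longrightarrow> m \<le> l \<Longrightarrow> length es \<le> m + 1
      \<Longrightarrow> p < 2 * 2 ^ m"
proof (induction es arbitrary: m)
  case (Cons e es)
  show ?case
  proof (cases "2 ^ m + mshash (2 ^ l) (2 ^ m) e y \<in> Bd")
    case True
    then have pl: "place Bd (2 ^ l) es (2 ^ m div 2) y = Some p" using Cons.prems by simp
    then have "es \<noteq> []" by auto
    then obtain m' where m': "m = Suc m'" using Cons.prems by (cases m) auto
    then have "p < 2 * 2 ^ m'" using Cons.IH[of m'] Cons.prems pl by simp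
    then show ?thesis using m' by simp
  next
    case False
    then show ?thesis using Cons.prems mshash_pow_less[of m l e y] by simp
  qed
qed simp

text \<open>Later rounds look only at smaller cell numbers, so overloaded cells of an earlier round
  can be added without changing them.\<close>

lemma place_cong:
  "Bd \<inter> {..<2 * 2 ^ m} = Bd' \<inter> {..<2 * 2 ^ m} \<Longrightarrow> m \<le> l \<Longrightarrow> length es \<le>
      m + 1 \<Longrightarrow>
   place Bd (2 ^ l) es (2 ^ m) y = place Bd' (2 ^ l) es (2 ^ m) y"
proof (induction es arbitrary: m)
  case (Cons e es)
  let ?p = "2 ^ m + mshash (2 ^ l) (2 ^ m) e y"
  have "?p < 2 * 2 ^ m" using mshash_pow_less[of m l e y] Cons.prems by simp
  then have iff: "?p \<in> Bd \<longleftrightarrow> ?p \<in> Bd'" using Cons.prems(1) by blast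
  have "place Bd (2 ^ l) es (2 ^ m div 2) y = place Bd' (2 ^ l) es (2 ^ m div 2) y"
  proof (cases m)
    case 0
    then show ?thesis using Cons.prems by simp
  next
    case (Suc m')
    have "Bd \<inter> {..<2 * 2 ^ m'} = (Bd \<inter> {..<2 * 2 ^ m}) \<inter> {..<2 * 2 ^ m'}" using Suc by auto
    also have "\<dots> = Bd' \<inter> {..<2 * 2 ^ m'}" using Suc by (subst Cons.prems(1)) auto
    finally show ?thesis using Cons.IH[of m'] Suc Cons.prems by simp
  qed
  then show ?case using iff by simp
qed simp

text \<open>In every round the items in overloaded cells are passed on to the next round, which has half
  as many cells. An overloaded cell contains two different items, so by \<open>mshash_good\<close> their total
  weight can be made at most half of the weight of the current round.\<close>

lemma rounds_exist:
  fixes key :: "'a \<Rightarrow> nat" and wt :: "'a \<Rightarrow> nat"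
  assumes "finite A" "inj_on key A" "\<And>i. i \<in> A \<Longrightarrow> key i < 2 ^ l"
    and "\<And>i. i \<in> A \<Longrightarrow> 0 < wt i \<and> wt i \<le> r" and "0 < r"
    and "2 * sum wt A \<le> r * 2 ^ J" "m \<le> l" "1 \<le> J" "J \<le> m + 1" "4 * sum wt A \<le> 2 ^ m"
  shows "\<exists>es Bd. length es = J \<and> (\<forall>e\<in>set es. e < 2 ^ l) \<and> Bd \<subseteq> {..<2 * 2 ^ m} \<and>
      card Bd * r \<le> sum wt A \<and>
      (\<forall>i\<in>A. \<exists>p. place Bd (2 ^ l) es (2 ^ m) (key i) = Some p) \<and>
      (\<forall>p. (\<Sum>i | i \<in> A \<and> place Bd (2 ^ l) es (2 ^ m) (key i) = Some p. wt i) \<le> r)"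
  using assms(8,1-4,6,7,9-10)
proof (induction J arbitrary: A m rule: dec_induct)
  case base
  \<comment> \<open>For \<open>J = 1\<close> the total weight is at most \<open>r\<close>: one round
    with an arbitrary seed suffices, and no cell is overloaded.\<close>
  have "(\<Sum>i | i \<in> A \<and> place {} (2 ^ l) [0] (2 ^ m) (key i) = Some p. wt i) \<le> r" for p
  proof -
    have "(\<Sum>i | i \<in> A \<and> place {} (2 ^ l) [0] (2 ^ m) (key i) = Some p. wt i) \<le> sum wt A"
      using base by (intro sum_mono2) auto
    then show ?thesis using base by simp
  qed
  then show ?case by (intro exI[of _ "[0]"] exI[of _ "{}"]) auto
next
  case (step J)
  from mshash_good[OF step.prems(1,2,3,6), of wt]
  obtain e where e: "e < 2 ^ l"
    and good: "(\<Sum>i | i \<in> A \<and> (\<exists>j\<in>A. j \<noteq> i \<and> mshash (2 ^ l) (2 ^ m) e (key i) =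
        mshash (2 ^ l) (2 ^ m) e (key j)). wt i) * 2 ^ m
       \<le> 2 * card A * sum wt A" by blast
  define pos where "pos i = 2 ^ m + mshash (2 ^ l) (2 ^ m) e (key i)" for i
  define load where "load p = (\<Sum>i | i \<in> A \<and> pos i = p. wt i)" for p
  define Bd1 where "Bd1 = {p. r < load p}"
  define A' where "A' = {i \<in> A. pos i \<in> Bd1}"
  have finA': "finite A'" "A' \<subseteq> A" using step.prems by (auto simp: A'_def)
  have pos: "2 ^ m \<le> pos i" "pos i < 2 * 2 ^ m" for i
    using mshash_pow_less[OF step.prems(6), of e "key i"] by (simp_all add: pos_def)
  have half: "2 * sum wt A' \<le> sum wt A"
  proof -
    have "A' \<subseteq> {i. i \<in> A \<and> (\<exists>j\<in>A. j \<noteq> i \<and> mshash (2 ^ l) (2 ^ m) e (key i) =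
        mshash (2 ^ l) (2 ^ m) e (key j))}"
    proof
      fix i assume i: "i \<in> A'"
      have "\<exists>j\<in>A. j \<noteq> i \<and> pos j = pos i"
      proof (rule ccontr)
        assume "\<not> (\<exists>j\<in>A. j \<noteq> i \<and> pos j = pos i)"
        then have "{j. j \<in> A \<and> pos j = pos i} = {i}" using i by (auto simp: A'_def)
        then have "load (pos i) = wt i" by (simp add: load_def)
        then show False using i step.prems(4)[of i] by (auto simp: A'_def Bd1_def)
      qed
      then show "i \<in> {i. i \<in> A \<and> (\<exists>j\<in>A. j \<noteq> i \<and> mshash (2 ^ l) (2 ^ m) e (key i) =
          mshash (2 ^ l) (2 ^ m) e (key j))}"
        using i by (auto simp: A'_def pos_def)
    qed
    then have "sum wt A' \<le> (\<Sum>i | i \<in> A \<and> (\<exists>j\<in>A. j \<noteq> i \<and> mshash (2 ^ l) (2 ^ m)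
        e (key i) = mshash (2 ^ l) (2 ^ m) e (key j)). wt i)"
      using step.prems(1) by (intro sum_mono2) auto
    then have "sum wt A' * 2 ^ m \<le> 2 * card A * sum wt A" using good by (meson mult_le_mono1 order_trans)
    \<comment> \<open>Positive weights bound the number of items by their weight; with
      \<open>4 * sum wt A \<le> 2 ^ m\<close> the colliding fraction
      \<open>2 * card A / 2 ^ m\<close> is at most one half.\<close>
    moreover have "card A \<le> sum wt A"
    proof -
      have "(\<Sum>i\<in>A. 1) \<le> sum wt A" using step.prems(4) by (intro sum_mono) (auto simp: Suc_le_eq)
      then show ?thesis by simp
    qed
    then have "2 * card A * sum wt A \<le> 2 * sum wt A * sum wt A" by (intro mult_le_mono) auto
    ultimately have "2 * sum wt A' * 2 ^ m \<le> 4 * sum wt A * sum wt A" by linarith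
    also have "\<dots> \<le> 2 ^ m * sum wt A" using step.prems(8) by (intro mult_le_mono1)
    also have "\<dots> = sum wt A * 2 ^ m" by (rule mult.commute)
    finally show ?thesis by simp
  qed
  obtain m' where m': "m = Suc m'" using step.hyps step.prems(7) by (cases m) auto
  have "\<exists>es Bd. length es = J \<and> (\<forall>e\<in>set es. e < 2 ^ l) \<and> Bd \<subseteq> {..<2 * 2 ^ m'} \<and>
      card Bd * r \<le> sum wt A' \<and>
      (\<forall>i\<in>A'. \<exists>p. place Bd (2 ^ l) es (2 ^ m') (key i) = Some p) \<and>
      (\<forall>p. (\<Sum>i | i \<in> A' \<and> place Bd (2 ^ l) es (2 ^ m') (key i) = Some p. wt i) \<le> r)"
  proof (rule step.IH)
    show "inj_on key A'" using step.prems(2) finA'(2) by (rule inj_on_subset)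
    show "2 * sum wt A' \<le> r * 2 ^ J" "4 * sum wt A' \<le> 2 ^ m'"
      using half step.prems(5,8) m' by simp_all
  qed (use finA' step.prems m' in auto)
  then obtain es Bd' where es: "length es = J" "\<forall>e\<in>set es. e < 2 ^ l" and Bd': "Bd' \<subseteq> {..<2 ^ m}"
    and cBd': "card Bd' * r \<le> sum wt A'"
    and pl: "\<forall>i\<in>A'. \<exists>p. place Bd' (2 ^ l) es (2 ^ m') (key i) = Some p"
    and ld: "\<forall>p. (\<Sum>i | i \<in> A' \<and> place Bd' (2 ^ l) es (2 ^ m') (key i) = Some p. wt i) \<le> r"
    using m' by auto
  \<comment> \<open>The overloaded cells of this round lie at \<open>2 ^ m\<close> or above, those
    of the later rounds below.\<close>
  define Bd where "Bd = Bd1 \<union> Bd'"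
  have Bd1: "Bd1 \<subseteq> pos ` A"
  proof
    fix p assume "p \<in> Bd1"
    then have "load p \<noteq> 0" by (auto simp: Bd1_def)
    then have "{i. i \<in> A \<and> pos i = p} \<noteq> {}" unfolding load_def by (metis sum.empty)
    then show "p \<in> pos ` A" by auto
  qed
  then have finBd1: "finite Bd1" using step.prems(1) finite_surj by blast
  have inBd: "pos i \<in> Bd \<longleftrightarrow> i \<in> A'" if "i \<in> A" for i
    using that pos(1)[of i] Bd' by (auto simp: Bd_def A'_def)
  have place': "place Bd (2 ^ l) (e # es) (2 ^ m) (key i) =
      (if i \<in> A' then place Bd' (2 ^ l) es (2 ^ m') (key i) else Some (pos i))" if "i \<in> A" for i
  proof -
    have "Bd \<inter> {..<2 * 2 ^ m'} = Bd' \<inter> {..<2 * 2 ^ m'}"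
    proof -
      have "p \<notin> Bd1" if "p < 2 * 2 ^ m'" for p
      proof
        assume "p \<in> Bd1"
        then obtain i where "p = pos i" using Bd1 by blast
        then show False using pos(1)[of i] that m' by simp
      qed
      then show ?thesis by (auto simp: Bd_def)
    qed
    then have "place Bd (2 ^ l) es (2 ^ m') (key i) = place Bd' (2 ^ l) es (2 ^ m') (key i)"
      using m' step.prems es(1) by (intro place_cong) auto
    then show ?thesis using inBd[OF that] m' by (simp add: pos_def)
  qed
  \<comment> \<open>Each overloaded cell of this round holds more than \<open>r\<close> of the
    weight of \<open>A'\<close>. The overloaded cells of the later rounds are paid by the weight of
    \<open>A'\<close> once more, and \<open>half\<close> covers both payments.\<close>
  have "card Bd1 * r \<le> sum wt A'"
  proof -
    have "card Bd1 * r = (\<Sum>p\<in>Bd1. r)" by simp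
    also have "\<dots> \<le> (\<Sum>p\<in>Bd1. load p)" by (intro sum_mono) (auto simp: Bd1_def)
    also have "\<dots> = (\<Sum>p\<in>Bd1. \<Sum>i | i \<in> A' \<and> pos i = p. wt i)"
      unfolding load_def by (intro sum.cong refl arg_cong2[where f = sum]) (auto simp: A'_def)
    also have "\<dots> = sum wt A'"
      using finBd1 finA'(1) by (intro sum.group) (auto simp: A'_def)
    finally show ?thesis .
  qed
  moreover have "card Bd \<le> card Bd1 + card Bd'" unfolding Bd_def by (rule card_Un_le)
  then have "card Bd * r \<le> card Bd1 * r + card Bd' * r" by (metis add_mult_distrib mult_le_mono1)
  ultimately have "card Bd * r \<le> sum wt A" using cBd' half by linarith
  moreover have "Bd \<subseteq> {..<2 * 2 ^ m}"
    using Bd1 Bd' pos(2) by (fastforce simp: Bd_def)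
  moreover have "\<forall>i\<in>A. \<exists>p. place Bd (2 ^ l) (e # es) (2 ^ m) (key i) = Some p"
    using place' pl by simp
  moreover have "(\<Sum>i | i \<in> A \<and> place Bd (2 ^ l) (e # es) (2 ^ m) (key i) = Some p. wt i) \<le> r" for p
  proof (cases "p < 2 ^ m")
    case True
    then have "{i. i \<in> A \<and> place Bd (2 ^ l) (e # es) (2 ^ m) (key i) = Some p}
        = {i. i \<in> A' \<and> place Bd' (2 ^ l) es (2 ^ m') (key i) = Some p}"
    proof (intro Collect_cong)
      fix i
      show "(i \<in> A \<and> place Bd (2 ^ l) (e # es) (2 ^ m) (key i) = Some p)
          = (i \<in> A' \<and> place Bd' (2 ^ l) es (2 ^ m') (key i) = Some p)"
      proof (cases "i \<in> A")
        case iA: True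
        have "pos i \<noteq> p" using pos(1)[of i] True by linarith
        then show ?thesis unfolding place'[OF iA] using iA by simp
      next
        case False
        then show ?thesis using finA'(2) by blast
      qed
    qed
    then show ?thesis using ld by simp
  next
    case False
    have sub: "{i. i \<in> A \<and> place Bd (2 ^ l) (e # es) (2 ^ m) (key i) = Some p} \<subseteq> {i. i \<in> A \<and>
        i \<notin> A' \<and> pos i = p}"
    proof safe
      fix i assume i: "i \<in> A" "place Bd (2 ^ l) (e # es) (2 ^ m) (key i) = Some p"
      have "i \<notin> A'"
      proof
        assume "i \<in> A'"
        then have "place Bd' (2 ^ l) es (2 ^ m') (key i) = Some p" using i place' by simp
        then have "p < 2 * 2 ^ m'" using m' step.prems es(1) by (intro place_less) auto
        then show False using False m' by simp
      qed
      then show "i \<in> A' \<Longrightarrow> False" "pos i = p" using i place' by auto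
    qed
    show ?thesis
    proof (cases "\<exists>i. i \<in> A \<and> i \<notin> A' \<and> pos i = p")
      case True
      then have "load p \<le> r" by (auto simp: A'_def Bd1_def)
      moreover have "(\<Sum>i | i \<in> A \<and> place Bd (2 ^ l) (e # es) (2 ^ m) (key i) = Some p. wt i) \<le> load p"
        unfolding load_def using sub step.prems(1) by (intro sum_mono2) auto
      ultimately show ?thesis by linarith
    next
      case F: False
      then have "{i. i \<in> A \<and> place Bd (2 ^ l) (e # es) (2 ^ m) (key i) = Some p} = {}" using sub by blast
      then show ?thesis by (simp only: sum.empty)
    qed
  qed
  ultimately show ?case
    using es e by (intro exI[of _ "e # es"] exI[of _ Bd]) (auto simp del: place.simps)
qed

section \<open>Guessing a colouring of the variables\<close>

text \<open>The set of overloaded cells is not an argument: a cell counts as overloaded when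
  \<open>walk\<close> returns \<open>0\<close> at its position. The counter \<open>t\<close> will
  start at \<open>r\<close> and double up to \<open>K2 = 2 * k\<close>, so it allows exactly
  \<open>J\<close> rounds, and no logarithm has to be computed.\<close>

function rounds :: "nat \<Rightarrow> nat \<Rightarrow> nat \<Rightarrow> nat \<Rightarrow> nat \<Rightarrow> nat
    \<Rightarrow> nat \<Rightarrow> nat \<Rightarrow> nat \<Rightarrow> nat" where
  "rounds D B K z K2 y h M t =
     (if t = 0 \<or> K2 \<le> t then 0
      else if 0 < walk D B z (2 * (M + mshash K M (h mod K) y) + 1) 1
        then walk D B z (2 * (M + mshash K M (h mod K) y) + 1) 1
      else rounds D B K z K2 y (h div K) (M div 2) (2 * t))"
  by pat_completeness auto
termination by (relation "measure (\<lambda>(D, B, K, z, K2, y, h, M, t). K2 - t)") auto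

declare rounds.simps [simp del]

lemma rounds_place:
  assumes wk: "\<And>p. p < 2 * 2 ^ m \<Longrightarrow> p \<in> Bd \<Longrightarrow> walk D B z (2 * p + 1) 1 = 0"
    "\<And>p. p < 2 * 2 ^ m \<Longrightarrow> p \<notin> Bd \<Longrightarrow> walk D B z (2 * p + 1) 1 = B ^ c p"
    and B: "0 < B"
    and "m \<le> l" "length es \<le> m + 1" "\<forall>e\<in>set es. e < 2 ^ l" "0 < t" "t * 2 ^ length es < 2 * K2"
    and "place Bd (2 ^ l) es (2 ^ m) y = Some p"
  shows "rounds D B (2 ^ l) z K2 y (of_digits (2 ^ l) es) (2 ^ m) t = B ^ c p"
  using assms(1,2,4-)
proof (induction es arbitrary: m t)
  case (Cons e es)
  let ?p = "2 ^ m + mshash (2 ^ l) (2 ^ m) e y"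
  have p: "?p < 2 * 2 ^ m" using mshash_pow_less[of m l e y] Cons.prems by simp
  have e: "of_digits (2 ^ l) (e # es) mod 2 ^ l = e" "of_digits (2 ^ l) (e # es) div 2 ^ l = of_digits (2 ^ l) es"
    using Cons.prems by simp_all
  \<comment> \<open>At least one round is left, so the premise on \<open>t\<close> keeps the counter
    below \<open>K2\<close> now and, after doubling, for the remaining rounds.\<close>
  have "t * 2 \<le> t * 2 ^ length (e # es)" by simp
  then have t: "\<not> (t = 0 \<or> K2 \<le> t)" using Cons.prems(6,7) by linarith
  show ?case
  proof (cases "?p \<in> Bd")
    case True
    then have pl: "place Bd (2 ^ l) es (2 ^ m div 2) y = Some p" using Cons.prems by simp
    then have "es \<noteq> []" by auto
    then obtain m' where m': "m = Suc m'" using Cons.prems by (cases m) auto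
    have "rounds D B (2 ^ l) z K2 y (of_digits (2 ^ l) es) (2 ^ m') (2 * t) = B ^ c p"
      using pl Cons.prems m' by (intro Cons.IH) auto
    moreover have "walk D B z (2 * ?p + 1) 1 = 0" using Cons.prems(1) p True by blast
    ultimately show ?thesis using t m' unfolding rounds.simps[of D B _ _ _ _ "of_digits (2 ^ l) (e # es)"] e by simp
  next
    case False
    then have "p = ?p" using Cons.prems(8) by simp
    moreover have "walk D B z (2 * ?p + 1) 1 = B ^ c ?p" using Cons.prems(2) p False by blast
    ultimately show ?thesis using t B unfolding rounds.simps[of D B _ _ _ _ "of_digits (2 ^ l) (e # es)"] e by simp
  qed
qed simp

text \<open>The lower bounds make the hashing work: \<open>2 ^ kap\<close> exceeds
  \<open>2 * k * k\<close>, so the first hash can be made injective on \<open>k\<close> items;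
  \<open>2 ^ mu \<ge> 4 * k\<close> gives the halving; \<open>2 ^ lam\<close> covers the variable
  numbers. The upper bounds serve the running time.\<close>

locale guesses =
  fixes n r k kap mu lam :: nat
  assumes r1: "1 < r" and rk: "r < k" and n0: "0 < n"
    and kap: "3 * (k * k) < 2 ^ kap" "2 ^ kap \<le> 6 * (k * k)"
    and mu: "4 * k \<le> 2 ^ mu" "2 ^ mu < 8 * k"
    and lam: "kap \<le> lam" "n \<le> 2 ^ lam" "lam = kap \<or> 2 ^ lam < 2 * n"
begin

definition "B = r + 1"
definition "K = (2::nat) ^ kap"
definition "MU = (2::nat) ^ mu"
definition "Lam = (2::nat) ^ lam"
text \<open>There are fewer than \<open>32 * k\<close> positions, so gaps of length about
  \<open>32 * r\<close> would do. The power of two \<open>64\<close> also makes \<open>D ^ q\<close>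
  easy to estimate as \<open>(2 ^ q) ^ 6 * r ^ q\<close>.\<close>

definition "D = 64 * r"
definition "q = 4 * k div r + 1"
definition "BQ = B ^ q"
definition "J = (LEAST j. 2 * k \<le> r * 2 ^ j)"
definition "HH = Lam * K ^ J"
text \<open>A guess is a single number in mixed radix: the seed of the first hash below
  \<open>Lam\<close>, then \<open>J\<close> round seeds below \<open>K\<close>, then the number of
  the separators. A single counter thus enumerates all guesses.\<close>

definition "G = HH * D ^ q"

definition colour :: "nat \<Rightarrow> nat \<Rightarrow> nat" where
  "colour g i = rounds D B K (g div HH) (2 * k)
     (mshash Lam K (g mod HH mod Lam) i) (g mod HH div Lam) MU r"

lemma J_ge: "2 * k \<le> r * 2 ^ J"
  unfolding J_def
proof (rule LeastI)
  have "2 * k \<le> 1 * 2 ^ (2 * k)" using less_exp[of "2 * k"] by simp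
  also have "\<dots> \<le> r * 2 ^ (2 * k)" using r1 by (intro mult_le_mono1) simp
  finally show "2 * k \<le> r * 2 ^ (2 * k)" .
qed

lemma J_pos: "0 < J"
  using J_ge r1 rk by (cases J) auto

lemma J_le: "r * 2 ^ J < 4 * k"
proof -
  have "\<not> 2 * k \<le> r * 2 ^ (J - 1)"
    using J_pos not_less_Least[of "J - 1" "\<lambda>j. 2 * k \<le> r * 2 ^ j"] unfolding J_def by simp
  moreover have "(2::nat) ^ J = 2 * 2 ^ (J - 1)" using J_pos by (cases J) auto
  ultimately show ?thesis by simp
qed

lemma mu_le_kap: "mu \<le> kap"
proof -
  have "8 * k \<le> 3 * (k * k)" using r1 rk by (simp add: mult.assoc[symmetric])
  then have "(2::nat) ^ mu < 2 ^ kap" using mu kap by linarith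
  then show ?thesis by simp
qed

lemma B_pos: "2 \<le> B" and D_ge: "2 \<le> D"
  using r1 by (simp_all add: B_def D_def)

text \<open>The hashing rounds place the items into cells of load at most \<open>r\<close>; these
  loads are the weights for the separators, with the overloaded cells as forced separators. The
  three ingredients are then packed into one guess.\<close>

theorem colouring_exists:
  assumes A: "A \<subseteq> {..<n}" and wt: "\<And>i. i \<in> A \<Longrightarrow> 0 < wt i \<and> wt i \<le> r" and sum:
      "sum wt A \<le> k"
  obtains g c where "g < G" "\<And>i. i \<in> A \<Longrightarrow> colour g i = B ^ c i \<and> c i < q"
    "\<And>j. (\<Sum>i | i \<in> A \<and> c i = j. wt i) \<le> r"
proof -
  have fin: "finite A" using A finite_subset by blast
  have cA: "card A \<le> k"
  proof -
    have "(\<Sum>i\<in>A. 1) \<le> sum wt A" using wt by (intro sum_mono) (auto simp: Suc_le_eq)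
    then show ?thesis using sum by simp
  qed
  obtain e0 where e0: "e0 < 2 ^ lam" and key: "inj_on (mshash Lam K e0) A"
  proof -
    have "\<And>i. i \<in> A \<Longrightarrow> id i < 2 ^ lam" using A lam(2) by fastforce
    from mshash_good[OF fin inj_on_id this lam(1), where ?wt = "\<lambda>_. 1"]
    obtain e where e: "e < 2 ^ lam" and
      good: "(\<Sum>i | i \<in> A \<and> (\<exists>j\<in>A. j \<noteq> i \<and> mshash Lam K e i = mshash Lam K e j). 1)
          * K \<le> 2 * card A * card A"
      unfolding Lam_def K_def by auto
    let ?S = "{i. i \<in> A \<and> (\<exists>j\<in>A. j \<noteq> i \<and> mshash Lam K e i = mshash Lam K e j)}"
    have "2 * card A * card A \<le> 2 * k * k" using cA by (intro mult_le_mono) auto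
    also have "\<dots> < K" using kap(1) by (simp add: K_def)
    finally have lt: "2 * card A * card A < K" .
    have "card ?S * K \<le> 2 * card A * card A" using good by simp
    \<comment> \<open>With unit weights the number of colliding items is an integer below one, hence
      zero.\<close>
    then have "card ?S * K < K" using lt by (rule order_le_less_trans)
    then have "card ?S = 0" using mult_less_cancel2[of "card ?S" K 1] by simp
    moreover have "finite ?S" using fin by simp
    ultimately have S: "?S = {}" by (simp only: card_0_eq)
    have "inj_on (mshash Lam K e) A"
    proof (rule inj_onI, rule ccontr)
      fix i j assume "i \<in> A" "j \<in> A" "mshash Lam K e i = mshash Lam K e j" "i \<noteq> j"
      then have "i \<in> ?S" by auto
      then show False unfolding S by simp
    qed
    then show ?thesis using that e by blast
  qed
  define y where "y = mshash Lam K e0"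
  have yK: "y i < 2 ^ kap" for i
    using mshash_pow_less[OF lam(1)] by (simp add: y_def Lam_def K_def)
  have Jmu: "J \<le> mu + 1"
  proof -
    have "2 * 2 ^ J \<le> r * 2 ^ J" using r1 by (intro mult_le_mono1) simp
    then have "2 * 2 ^ J < 2 * (2::nat) ^ mu * 2" using J_le mu(1) by linarith
    then have "2 ^ J < (2::nat) ^ Suc mu" by simp
    then show "J \<le> mu + 1" by (simp del: power_Suc)
  qed
  have "\<exists>es Bd. length es = J \<and> (\<forall>e\<in>set es. e < 2 ^ kap) \<and> Bd \<subseteq> {..<2 * 2 ^ mu} \<and>
      card Bd * r \<le> sum wt A \<and>
      (\<forall>i\<in>A. \<exists>p. place Bd (2 ^ kap) es (2 ^ mu) (y i) = Some p) \<and>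
      (\<forall>p. (\<Sum>i | i \<in> A \<and> place Bd (2 ^ kap) es (2 ^ mu) (y i) = Some p. wt i) \<le> r)"
  proof (rule rounds_exist)
    show "2 * sum wt A \<le> r * 2 ^ J" using J_ge sum by linarith
    show "J \<le> mu + 1" by (rule Jmu)
  qed (use fin key yK wt r1 mu_le_kap J_pos mu(1) sum in \<open>auto simp: y_def\<close>)
  then obtain es Bd where es: "length es = J" "\<forall>e\<in>set es. e < 2 ^ kap" and Bd: "Bd \<subseteq> {..<2 * 2 ^ mu}"
    and cBd: "card Bd * r \<le> sum wt A"
    and pl: "\<forall>i\<in>A. \<exists>p. place Bd (2 ^ kap) es (2 ^ mu) (y i) = Some p"
    and ld: "\<forall>p. (\<Sum>i | i \<in> A \<and> place Bd (2 ^ kap) es (2 ^ mu) (y i) = Some p. wt i) \<le> r" by blast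
  define p where "p i = the (place Bd (2 ^ kap) es (2 ^ mu) (y i))" for i
  have p: "place Bd (2 ^ kap) es (2 ^ mu) (y i) = Some (p i)" if "i \<in> A" for i
    using pl that unfolding p_def by fastforce
  \<comment> \<open>The load of a cell after all rounds. It vanishes on \<open>Bd\<close>, because
    an item hashed to an overloaded cell moves on, and is at most \<open>r\<close>
    elsewhere.\<close>
  define w where "w x = (\<Sum>i | i \<in> A \<and> p i = x. wt i)" for x
  have w_eq: "w x = (\<Sum>i | i \<in> A \<and> place Bd (2 ^ kap) es (2 ^ mu) (y i) = Some x. wt i)" for x
    unfolding w_def using p by (intro sum.cong Collect_cong) auto
  have wb: "w x = 0" if "x \<in> Bd" for x
  proof -
    have "{i. i \<in> A \<and> p i = x} = {}" using p place_not_bad that by blast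
    then show ?thesis unfolding w_def by (simp only: sum.empty)
  qed
  have pN: "p i < 2 * 2 ^ mu" if "i \<in> A" for i
    using place_less[OF p[OF that] mu_le_kap] es(1) Jmu by simp
  have pBd: "p i \<notin> Bd" if "i \<in> A" for i
    using p[OF that] by (rule place_not_bad)
  have wsum: "(\<Sum>x<2 * 2 ^ mu. w x) = sum wt A"
    unfolding w_def using fin pN by (intro sum.group) auto
  have D63: "(D - 2) div r = 63"
    using r1 unfolding D_def by (intro div_nat_eqI) auto
  obtain z c where z: "z < D ^ q"
    and wk0: "\<And>p B pw. p < 2 * 2 ^ mu \<Longrightarrow> p \<in> Bd \<Longrightarrow> walk D B z (2 * p + 1) pw = 0"
    and wk1: "\<And>p B pw. p < 2 * 2 ^ mu \<Longrightarrow> p \<notin> Bd \<Longrightarrow> walk D B z (2 * p + 1) pw =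
        pw * B ^ c p \<and> c p < q"
    and cls: "\<And>j. (\<Sum>p | p < 2 * 2 ^ mu \<and> p \<notin> Bd \<and> c p = j. w p) \<le> r"
  proof (rule separators_exist[of r w Bd "2 * 2 ^ mu" k D q])
    show "0 < r" using r1 by simp
    show "w x \<le> r" for x using ld unfolding w_eq by blast
    show "2 * (2 * 2 ^ mu) \<le> k * ((D - 2) div r)" using mu(2) unfolding D63 by linarith
    show "3 \<le> D" using r1 by (simp add: D_def)
    have "Bd \<inter> {..<2 * 2 ^ mu} = Bd" using Bd by blast
    then show "card (Bd \<inter> {..<2 * 2 ^ mu}) * r \<le> k" using cBd sum by simp
    show "(\<Sum>p<2 * 2 ^ mu. w p) \<le> k" using wsum sum by simp
  qed (auto simp: wb q_def)
  define g where "g = (e0 + Lam * of_digits K es) + HH * z"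
  have LK: "0 < Lam" "0 < K" by (simp_all add: Lam_def K_def)
  have "of_digits K es < K ^ J" using of_digits_less[of es K] es by (simp add: K_def)
  then have "Lam * Suc (of_digits K es) \<le> Lam * K ^ J" by (intro mult_le_mono2) simp
  then have lo: "e0 + Lam * of_digits K es < HH" using e0 by (simp add: HH_def Lam_def)
  have g: "g mod HH = e0 + Lam * of_digits K es" "g div HH = z"
    using lo by (simp_all add: g_def)
  have gl: "g mod HH mod Lam = e0" "g mod HH div Lam = of_digits K es"
    using e0 by (simp_all add: g Lam_def)
  have "g < G"
  proof -
    have "g < HH * Suc z" using lo by (simp add: g_def)
    also have "\<dots> \<le> HH * D ^ q" using z by (intro mult_le_mono2) simp
    finally show ?thesis by (simp add: G_def)
  qed
  moreover have "colour g i = B ^ c (p i) \<and> c (p i) < q" if i: "i \<in> A" for i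
  proof -
    have "rounds D B (2 ^ kap) z (2 * k) (y i) (of_digits (2 ^ kap) es) (2 ^ mu) r = B ^ c (p i)"
    proof (rule rounds_place[where c = c and p = "p i" and Bd = Bd])
      show "walk D B z (2 * p + 1) 1 = 0" if "p < 2 * 2 ^ mu" "p \<in> Bd" for p
        using wk0 that by blast
      show "walk D B z (2 * p + 1) 1 = B ^ c p" if "p < 2 * 2 ^ mu" "p \<notin> Bd" for p
        using wk1[OF that] by simp
      show "0 < B" using B_pos by simp
      show "0 < r" using r1 by simp
      show "place Bd (2 ^ kap) es (2 ^ mu) (y i) = Some (p i)" by (rule p[OF i])
      show "r * 2 ^ length es < 2 * (2 * k)" using J_le es by simp
    qed (use mu_le_kap es Jmu r1 in auto)
    moreover have "colour g i = rounds D B (2 ^ kap) z (2 * k) (y i) (of_digits (2 ^ kap) es) (2 ^ mu) r"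
      unfolding colour_def gl unfolding g(2) by (simp add: y_def K_def MU_def)
    moreover have "c (p i) < q" using wk1[OF pN[OF i] pBd[OF i]] by blast
    ultimately show ?thesis by simp
  qed
  moreover have "(\<Sum>i | i \<in> A \<and> c (p i) = j. wt i) \<le> r" for j
  proof -
    let ?P = "{x. x < 2 * 2 ^ mu \<and> x \<notin> Bd \<and> c x = j}"
    have "(\<Sum>i | i \<in> A \<and> c (p i) = j. wt i) = (\<Sum>x\<in>?P. \<Sum>i | i \<in> {i. i \<in> A \<and> c (p
        i) = j} \<and> p i = x. wt i)"
      using fin pN pBd by (intro sum.group[symmetric]) auto
    also have "\<dots> = (\<Sum>x\<in>?P. w x)"
      unfolding w_def by (intro sum.cong refl Collect_cong) auto
    also have "\<dots> \<le> r" by (rule cls)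
    finally show ?thesis .
  qed
  ultimately show ?thesis by (rule that[of g "\<lambda>i. c (p i)"])
qed

end

section \<open>Monomials of a circuit\<close>

lemma gates_polys_snoc: "gates_polys (C @ [g]) = gates_polys C @ [gate_poly (gates_polys C) g]"
  by (simp add: gates_polys_def)

lemma length_gates_polys [simp]: "length (gates_polys C) = length C"
  by (induction C rule: rev_induct) (simp_all add: gates_polys_snoc, simp add: gates_polys_def)

lemma gate_poly_append:
  assumes "gate_ok n p g" "p \<le> length fs"
  shows "gate_poly (fs @ gs) g = gate_poly fs g"
proof -
  have eq: "map ((!) (fs @ gs)) js = map ((!) fs) js" if "\<forall>j\<in>set js. j < p" for js
    using that assms(2) by (auto simp: nth_append)
  show ?thesis
  proof (cases g)
    case (Sum js)
    then show ?thesis using assms(1) eq[of js] by (simp del: map_eq_conv)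
  next
    case (Prod js)
    then show ?thesis using assms(1) eq[of js] by (simp del: map_eq_conv)
  qed simp
qed

lemma gates_polys_nth:
  assumes "\<forall>p<length C. gate_ok n p (C ! p)" "p < length C"
  shows "gates_polys C ! p = gate_poly (gates_polys C) (C ! p)"
  using assms
proof (induction C arbitrary: p rule: rev_induct)
  case (snoc g C)
  have ok: "\<forall>p<length C. gate_ok n p (C ! p)" "gate_ok n (length C) g"
    using snoc.prems(1) by (auto simp: nth_append less_Suc_eq)
  show ?case
  proof (cases "p < length C")
    case True
    have "gate_poly (gates_polys C @ [gate_poly (gates_polys C) g]) (C ! p) = gate_poly (gates_polys C) (C ! p)"
      using ok(1) True by (intro gate_poly_append[of n p]) auto
    then show ?thesis
      using snoc.IH[OF ok(1) True] True by (simp add: gates_polys_snoc nth_append)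
  next
    case False
    then have "p = length C" using snoc.prems by simp
    moreover have "gate_poly (gates_polys C @ [gate_poly (gates_polys C) g]) g = gate_poly (gates_polys C) g"
      using ok(2) by (intro gate_poly_append[of n "length C"]) auto
    ultimately show ?thesis by (simp add: gates_polys_snoc nth_append)
  qed
qed simp

lemma keys_add_nonneg:
  fixes f g :: "'a \<Rightarrow>\<^sub>0 int"
  assumes "\<And>m. 0 \<le> Poly_Mapping.lookup f m" "\<And>m. 0 \<le> Poly_Mapping.lookup g m"
  shows "Poly_Mapping.keys (f + g) = Poly_Mapping.keys f \<union> Poly_Mapping.keys g"
proof -
  have eq: "Poly_Mapping.lookup f m + Poly_Mapping.lookup g m = 0 \<longleftrightarrow>
      Poly_Mapping.lookup f m = 0 \<and> Poly_Mapping.lookup g m = 0" for m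
    using assms[of m] by linarith
  show ?thesis by (intro set_eqI) (simp only: Un_iff in_keys_iff lookup_add eq de_Morgan_conj)
qed

text \<open>A coefficient of the product is a sum of nonnegative terms, so any one of them is a
  lower bound. This is where non-cancellation enters for multiplication gates.\<close>

lemma lookup_mult_nonneg:
  fixes f g :: int_mpoly
  assumes f: "\<And>m. 0 \<le> Poly_Mapping.lookup f m" and g: "\<And>m. 0 \<le> Poly_Mapping.lookup g m"
  shows "0 \<le> Poly_Mapping.lookup (f * g) m"
    and "Poly_Mapping.lookup f a * Poly_Mapping.lookup g b \<le> Poly_Mapping.lookup (f * g) (a + b)"
proof -
  define h where "h m l = (\<Sum>x. Poly_Mapping.lookup g x when m = l + x)" for m l
  have h: "0 \<le> h m l" for m l
    unfolding h_def using g by (subst Sum_any.expand_set, intro sum_nonneg) (simp add: when_def)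
  have eq: "Poly_Mapping.lookup (f * g) m = (\<Sum>l\<in>Poly_Mapping.keys f. Poly_Mapping.lookup f l * h m l)" for m
    unfolding lookup_mult h_def by (rule Sum_any.expand_superset) (auto simp: in_keys_iff)
  show "0 \<le> Poly_Mapping.lookup (f * g) m"
    unfolding eq using f h by (intro sum_nonneg) simp
  have ab: "h (a + b) a = Poly_Mapping.lookup g b"
    unfolding h_def by (simp add: Sum_any_when_equal')
  show "Poly_Mapping.lookup f a * Poly_Mapping.lookup g b \<le> Poly_Mapping.lookup (f * g) (a + b)"
  proof (cases "a \<in> Poly_Mapping.keys f")
    case True
    then have "Poly_Mapping.lookup f a * h (a + b) a \<le> Poly_Mapping.lookup (f * g) (a + b)"
      unfolding eq using f h by (intro member_le_sum) auto
    then show ?thesis unfolding ab .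
  next
    case False
    then have "Poly_Mapping.lookup f a = 0" by (simp add: in_keys_iff)
    moreover have "0 \<le> Poly_Mapping.lookup (f * g) (a + b)"
      unfolding eq using f h by (intro sum_nonneg) simp
    ultimately show ?thesis by simp
  qed
qed

lemma keys_mult_nonneg:
  fixes f g :: int_mpoly
  assumes f: "\<And>m. 0 \<le> Poly_Mapping.lookup f m" and g: "\<And>m. 0 \<le> Poly_Mapping.lookup g m"
  shows "Poly_Mapping.keys (f * g) = {a + b | a b. a \<in> Poly_Mapping.keys f \<and> b \<in> Poly_Mapping.keys g}"
proof
  show "Poly_Mapping.keys (f * g) \<subseteq> {a + b | a b. a \<in> Poly_Mapping.keys f \<and> b \<in> Poly_Mapping.keys g}"
    by (rule keys_mult)
  show "{a + b | a b. a \<in> Poly_Mapping.keys f \<and> b \<in> Poly_Mapping.keys g} \<subseteq> Poly_Mapping.keys (f * g)"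
  proof safe
    fix a b assume "a \<in> Poly_Mapping.keys f" "b \<in> Poly_Mapping.keys g"
    then have "0 < Poly_Mapping.lookup f a" "0 < Poly_Mapping.lookup g b"
      using f[of a] g[of b] by (auto simp: in_keys_iff less_le)
    then have "0 < Poly_Mapping.lookup f a * Poly_Mapping.lookup g b" by simp
    then have "0 < Poly_Mapping.lookup (f * g) (a + b)"
      using lookup_mult_nonneg(2)[OF f g, of a b] by linarith
    then show "a + b \<in> Poly_Mapping.keys (f * g)" by (simp add: in_keys_iff)
  qed
qed

locale circuit =
  fixes n :: nat and C :: gates
  assumes ok: "p < length C \<Longrightarrow> gate_ok n p (C ! p)"
begin

abbreviation "gpoly p \<equiv> gates_polys C ! p"

definition gmonos :: "nat \<Rightarrow> monomial set" where
  "gmonos p = Poly_Mapping.keys (gpoly p)"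

lemma gpoly_nonneg: "p < length C \<Longrightarrow> 0 \<le> Poly_Mapping.lookup (gpoly p) m"
proof (induction p arbitrary: m rule: less_induct)
  case (less p)
  have eq: "gpoly p = gate_poly (gates_polys C) (C ! p)"
    using ok less.prems by (intro gates_polys_nth) auto
  show ?case
  proof (cases "C ! p")
    case (Var i)
    then show ?thesis unfolding eq by (simp add: indet_def lookup_single when_def)
  next
    case (Sum js)
    then have "length js = 1 \<or> length js = 2" "\<forall>j\<in>set js. j < p" using ok[OF less.prems] by auto
    then show ?thesis
      using less Sum by (auto simp: eq length_Suc_conv numeral_2_eq_2 lookup_add)
  next
    case (Prod js)
    then have "length js = 1 \<or> length js = 2" "\<forall>j\<in>set js. j < p" using ok[OF less.prems] by auto
    then show ?thesis
      using less Prod by (auto simp: eq length_Suc_conv numeral_2_eq_2 intro!: lookup_mult_nonneg)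
  qed
qed

lemma gmonos_Var:
  assumes "p < length C" "C ! p = Var i"
  shows "i < n" "gmonos p = {Poly_Mapping.single i 1}"
proof -
  have eq: "gpoly p = gate_poly (gates_polys C) (C ! p)"
    using ok assms by (intro gates_polys_nth) auto
  show "i < n" using ok[OF assms(1)] assms(2) by simp
  show "gmonos p = {Poly_Mapping.single i 1}"
    unfolding gmonos_def eq using assms(2) by (simp add: indet_def)
qed

lemma gate_child:
  assumes "p < length C" "C ! p = Sum js \<or> C ! p = Prod js"
  shows "length js = 1 \<or> length js = 2" "j \<in> set js \<Longrightarrow> j < p"
  using ok[OF assms(1)] assms(2) by auto

text \<open>Gates of fan-in one are treated like additions of a node to itself.\<close>

definition union_gate :: "nat \<Rightarrow> nat \<Rightarrow> nat \<Rightarrow> bool" where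
  "union_gate p a b \<longleftrightarrow> C ! p = Sum [a, b] \<or> a = b \<and> (C ! p = Sum [a] \<or> C ! p = Prod [a])"

lemma gmonos_union:
  assumes "p < length C" "union_gate p a b"
  shows "a < p" "b < p" "gmonos p = gmonos a \<union> gmonos b"
proof -
  have eq: "gpoly p = gate_poly (gates_polys C) (C ! p)"
    using ok assms by (intro gates_polys_nth) auto
  show ab: "a < p" "b < p"
    using gate_child(2)[OF assms(1), of "[a, b]"] gate_child(2)[OF assms(1), of "[a]"] assms(2)
    by (auto simp: union_gate_def)
  show "gmonos p = gmonos a \<union> gmonos b"
    unfolding gmonos_def eq using assms ab by (auto simp: union_gate_def keys_add_nonneg gpoly_nonneg)
qed

lemma gmonos_Prod:
  assumes "p < length C" "C ! p = Prod [a, b]"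
  shows "a < p" "b < p" "gmonos p = {m + m' | m m'. m \<in> gmonos a \<and> m' \<in> gmonos b}"
proof -
  have eq: "gpoly p = gate_poly (gates_polys C) (C ! p)"
    using ok assms by (intro gates_polys_nth) auto
  show ab: "a < p" "b < p" using gate_child(2)[of p "[a, b]"] assms by auto
  have "gmonos p = Poly_Mapping.keys (gpoly a * gpoly b)" using eq assms(2) by (simp add: gmonos_def)
  then show "gmonos p = {m + m' | m m'. m \<in> gmonos a \<and> m' \<in> gmonos b}"
    using assms ab by (simp add: gmonos_def keys_mult_nonneg gpoly_nonneg)
qed

lemma gate_cases:
  assumes "p < length C"
  obtains (Var) i where "C ! p = Var i" "i < n"
    | (Union) a b where "union_gate p a b" "a < p" "b < p"
    | (Prod) a b where "C ! p = Prod [a, b]" "a < p" "b < p"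
proof (cases "C ! p")
  case (Var i)
  then show ?thesis using that(1) gmonos_Var(1)[OF assms] by blast
next
  case (Sum js)
  then have "(\<exists>a. js = [a]) \<or> (\<exists>a b. js = [a, b])"
    using gate_child(1)[OF assms, of js] by (auto simp: length_Suc_conv numeral_2_eq_2)
  then have "\<exists>a b. union_gate p a b" using Sum by (auto simp: union_gate_def)
  then show ?thesis using that(2) gmonos_union(1,2)[OF assms] by blast
next
  case (Prod js)
  then have "(\<exists>a. js = [a]) \<or> (\<exists>a b. js = [a, b])"
    using gate_child(1)[OF assms, of js] by (auto simp: length_Suc_conv numeral_2_eq_2)
  then have "(\<exists>a. union_gate p a a) \<or> (\<exists>a b. C ! p = Prod [a, b])" using Prod by (auto simp: union_gate_def)
  then show ?thesis using that(2,3) gmonos_union(1,2)[OF assms] gmonos_Prod(1,2)[OF assms] by blast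
qed

definition mdeg :: "monomial \<Rightarrow> nat" where
  "mdeg m = (\<Sum>i<n. Poly_Mapping.lookup m i)"

lemma mdeg_add: "mdeg (m + m') = mdeg m + mdeg m'"
  by (simp add: mdeg_def lookup_add sum.distrib)

lemma mdeg_single: "i < n \<Longrightarrow> mdeg (Poly_Mapping.single i 1) = 1"
  by (simp add: mdeg_def lookup_single when_def)

text \<open>Without constants a circuit cannot produce the monomial of degree zero. The positive
  degree makes the traceback progress at every product.\<close>

lemma gmonos_props:
  "p < length C \<Longrightarrow> m \<in> gmonos p \<Longrightarrow> Poly_Mapping.keys m \<subseteq> {..<n} \<and> 0 < mdeg m"
proof (induction p arbitrary: m rule: less_induct)
  case (less p)
  from less.prems(1) show ?case
  proof (cases rule: gate_cases)
    case (Var i)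
    then show ?thesis using less.prems(2) gmonos_Var(2)[OF less.prems(1)] mdeg_single by auto
  next
    case (Union a b)
    then show ?thesis using less gmonos_union(3)[OF less.prems(1)] by auto
  next
    case (Prod a b)
    then obtain m1 m2 where m: "m = m1 + m2" "m1 \<in> gmonos a" "m2 \<in> gmonos b"
      using less.prems(2) gmonos_Prod(3)[OF less.prems(1)] by blast
    then have "Poly_Mapping.keys m1 \<subseteq> {..<n} \<and> 0 < mdeg m1" "Poly_Mapping.keys m2 \<subseteq> {..<n}
        \<and> 0 < mdeg m2"
      using less Prod by auto
    moreover have "Poly_Mapping.keys m \<subseteq> Poly_Mapping.keys m1 \<union> Poly_Mapping.keys m2"
      unfolding m by (rule keys_add)
    ultimately show ?thesis using mdeg_add[of m1 m2] m(1) by auto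
  qed
qed

end

section \<open>The dynamic programme for one colouring\<close>

locale coloured_circuit = circuit +
  fixes B q :: nat and col :: "nat \<Rightarrow> nat"
  assumes B2: "2 \<le> B" and col: "i < n \<Longrightarrow> col i = 0 \<or> (\<exists>c<q. col i = B ^ c)"
begin

definition code :: "monomial \<Rightarrow> nat" where
  "code m = (\<Sum>i<n. Poly_Mapping.lookup m i * col i)"

text \<open>A monomial is represented by the vector of its degrees in the colour classes, read as a number
  in base \<open>B\<close>. Digit sums detect carries: \<open>digsum B (code m) = mdeg m\<close> says that all these degrees
  are less than \<open>B\<close>.\<close>

definition realizes :: "nat \<Rightarrow> nat \<Rightarrow> monomial \<Rightarrow> bool" where
  "realizes p u m \<longleftrightarrow>
     m \<in> gmonos p \<and> (\<forall>i<n. 0 < Poly_Mapping.lookup m i \<longrightarrow> 0 < col i) \<and> code m = u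
         \<and> digsum B u = mdeg m"

definition reach :: "nat \<Rightarrow> nat \<Rightarrow> bool" where
  "reach p u \<longleftrightarrow> u < B ^ q \<and> (\<exists>m. realizes p u m)"

lemma code_add: "code (m + m') = code m + code m'"
  by (simp add: code_def lookup_add sum.distrib algebra_simps)

lemma code_single: "i < n \<Longrightarrow> code (Poly_Mapping.single i 1) = col i"
  by (simp add: code_def lookup_single when_def if_distrib[of "\<lambda>x. x * _"] cong: if_cong)

lemma digsum_pow: "digsum B (B ^ c) = 1"
  using digsum_times_power[OF B2, of 1 c] digsum_small[OF B2, of 1] B2 by simp

lemma col_props:
  assumes "i < n" shows "col i < B ^ q" "0 < col i \<Longrightarrow> digsum B (col i) = 1"
proof -
  have "B ^ c < B ^ q" if "c < q" for c using that B2 by simp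
  then show "col i < B ^ q" using col[OF assms] B2 by auto
  show "0 < col i \<Longrightarrow> digsum B (col i) = 1" using col[OF assms] digsum_pow by auto
qed

lemma digsum_mult_col_le: "i < n \<Longrightarrow> digsum B (x * col i) \<le> digsum B x"
  using col[of i] digsum_times_power[OF B2] by auto

lemma digsum_code_le: "digsum B (code m) \<le> mdeg m"
proof -
  have "digsum B (code m) \<le> (\<Sum>i<n. digsum B (Poly_Mapping.lookup m i * col i))"
    unfolding code_def by (rule digsum_sum_le[OF B2])
  also have "\<dots> \<le> mdeg m"
    unfolding mdeg_def
    by (intro sum_mono order_trans[OF digsum_mult_col_le digsum_le[OF B2]]) auto
  finally show ?thesis .
qed

text \<open>An exponent of at least \<open>B\<close> has a digit sum strictly below itself, and a
  colour only shifts its digits or erases them. By subadditivity the digit sum of the code then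
  stays below the degree. This holds for every colouring, hence soundness of all guesses.\<close>

lemma realizes_bounded:
  assumes "realizes p u m" "i < n" shows "Poly_Mapping.lookup m i < B"
proof (rule ccontr)
  assume "\<not> Poly_Mapping.lookup m i < B"
  then have "digsum B (Poly_Mapping.lookup m i) < Poly_Mapping.lookup m i" using digsum_less[OF B2] by simp
  then have lt: "digsum B (Poly_Mapping.lookup m i * col i) < Poly_Mapping.lookup m i"
    using digsum_mult_col_le[OF assms(2), of "Poly_Mapping.lookup m i"] by linarith
  have le: "digsum B (Poly_Mapping.lookup m j * col j) \<le> Poly_Mapping.lookup m j" if "j < n" for j
    using digsum_mult_col_le[OF that] digsum_le[OF B2] by (rule order_trans)
  have "digsum B (code m) \<le> (\<Sum>i<n. digsum B (Poly_Mapping.lookup m i * col i))"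
    unfolding code_def by (rule digsum_sum_le[OF B2])
  also have "\<dots> < mdeg m"
    unfolding mdeg_def using lt le assms(2) by (intro sum_strict_mono_ex1) auto
  finally show False using assms(1) by (simp add: realizes_def)
qed

lemma reach_Var:
  assumes "p < length C" "C ! p = Var i"
  shows "realizes p u m \<longleftrightarrow> m = Poly_Mapping.single i 1 \<and> u = col i \<and> 0 < u"
    and "reach p u \<longleftrightarrow> u = col i \<and> 0 < u"
proof -
  note v = gmonos_Var[OF assms]
  have c: "code (Poly_Mapping.single i 1) = col i" "mdeg (Poly_Mapping.single i 1) = 1"
    using code_single mdeg_single v(1) by auto
  show r: "realizes p u m \<longleftrightarrow> m = Poly_Mapping.single i 1 \<and> u = col i \<and> 0 < u" for u m
    unfolding realizes_def v(2) using c col_props[OF v(1)] v(1)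
    by (auto simp: lookup_single when_def split: if_splits)
  show "reach p u \<longleftrightarrow> u = col i \<and> 0 < u"
    unfolding reach_def r using col_props(1)[OF v(1)] by auto
qed

lemma reach_union:
  assumes "p < length C" "union_gate p a b"
  shows "realizes p u m \<longleftrightarrow> realizes a u m \<or> realizes b u m" "reach p u \<longleftrightarrow> reach
      a u \<or> reach b u"
  using gmonos_union[OF assms] by (auto simp: realizes_def reach_def)

lemma realizes_Prod:
  assumes "p < length C" "C ! p = Prod [a, b]"
    and "realizes a u m" "realizes b v m'" "digsum B u + digsum B v \<le> digsum B (u + v)"
  shows "realizes p (u + v) (m + m')"
  using assms(3-5) digsum_add_le[OF B2, of u v] gmonos_Prod(3)[OF assms(1,2)]
  by (auto simp: realizes_def code_add mdeg_add lookup_add)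

text \<open>If the sum of two codes attains the full degree, both factors must attain theirs, since
  digit sums are subadditive and bounded by the degrees. So carry-free monomials of a product arise
  from carry-free monomials of the factors, and codes suffice as table indices.\<close>

lemma reach_Prod:
  assumes "p < length C" "C ! p = Prod [a, b]"
  shows "reach p u \<longleftrightarrow> u < B ^ q \<and>
    (\<exists>v\<le>u. reach a v \<and> reach b (u - v) \<and> digsum B v + digsum B (u - v) \<le> digsum B u)"
proof
  assume "reach p u"
  then obtain m where u: "u < B ^ q" and m: "realizes p u m" by (auto simp: reach_def)
  then obtain m1 m2 where mm: "m = m1 + m2" "m1 \<in> gmonos a" "m2 \<in> gmonos b"
    using gmonos_Prod(3)[OF assms] unfolding realizes_def by blast
  have uc: "u = code m1 + code m2" using m by (simp add: realizes_def mm code_add)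
  have "mdeg m1 + mdeg m2 = digsum B (code m1 + code m2)"
    using m uc by (simp add: realizes_def mm mdeg_add)
  then have d: "digsum B (code m1) = mdeg m1" "digsum B (code m2) = mdeg m2"
    using digsum_add_le[OF B2, of "code m1" "code m2"] digsum_code_le[of m1] digsum_code_le[of m2] by linarith+
  have "realizes a (code m1) m1" "realizes b (code m2) m2"
    using m d mm by (auto simp: realizes_def lookup_add)
  then have "reach a (code m1)" "reach b (u - code m1)"
    using u uc by (auto simp: reach_def)
  moreover have "digsum B (code m1) + digsum B (u - code m1) \<le> digsum B u"
    using d m uc by (simp add: realizes_def mm mdeg_add)
  ultimately show "u < B ^ q \<and> (\<exists>v\<le>u. reach a v \<and> reach b (u - v) \<and> digsum B v + digsum B (u -
      v) \<le> digsum B u)"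
    using u uc by (intro conjI exI[of _ "code m1"]) auto
next
  assume "u < B ^ q \<and> (\<exists>v\<le>u. reach a v \<and> reach b (u - v) \<and> digsum B v + digsum B (u - v) \<le>
      digsum B u)"
  then obtain v m m' where "u < B ^ q" "v \<le> u" "realizes a v m" "realizes b (u - v) m'"
      "digsum B v + digsum B (u - v) \<le> digsum B u"
    by (auto simp: reach_def)
  then show "reach p u"
    using realizes_Prod[OF assms, of v m "u - v" m'] by (auto simp: reach_def)
qed

lemma reach_pos:
  assumes "reach p u" "p < length C" shows "0 < digsum B u"
  using assms gmonos_props[of p] by (auto simp: reach_def realizes_def)

lemma realizes_rk_monomial:
  assumes "realizes p u m" "p < length C" "digsum B u = k" "B = r + 1"
  shows "rk_monomial_of n r k (gpoly p) m"
proof -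
  have m: "m \<in> gmonos p" "mdeg m = k" using assms(1,3) by (simp_all add: realizes_def)
  then have "Poly_Mapping.keys m \<subseteq> {..<n}" using gmonos_props assms(2) by blast
  moreover have "\<forall>i<n. Poly_Mapping.lookup m i \<le> r"
    using realizes_bounded[OF assms(1)] assms(4) by fastforce
  moreover have "Poly_Mapping.lookup (gpoly p) m \<noteq> 0" using m(1) by (simp add: gmonos_def in_keys_iff)
  ultimately show ?thesis using m(2) unfolding rk_monomial_of_def rk_monomial_def mdeg_def by blast
qed

text \<open>When every class degree is below \<open>B\<close>, these degrees are the actual digits
  of the code; hence no carry occurs and the digit sum is the degree.\<close>

lemma rk_monomial_reach:
  assumes m: "rk_monomial_of n r k (gpoly p) m" and c: "\<And>i. i \<in> Poly_Mapping.keys m \<Longrightarrow> col i = B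
      ^ c i \<and> c i < q"
    and cls: "\<And>j. (\<Sum>i | i \<in> Poly_Mapping.keys m \<and> c i = j. Poly_Mapping.lookup m i) < B"
  shows "\<exists>u. reach p u \<and> digsum B u = k"
proof -
  let ?A = "Poly_Mapping.keys m"
  define d where "d j = (\<Sum>i | i \<in> ?A \<and> c i = j. Poly_Mapping.lookup m i)" for j
  have A: "?A \<subseteq> {..<n}" and k: "mdeg m = k" and mg: "m \<in> gmonos p"
    using m by (auto simp: rk_monomial_of_def rk_monomial_def mdeg_def gmonos_def in_keys_iff)
  have d: "digsum B (\<Sum>j<q. d j * B ^ j) = (\<Sum>j<q. d j)" "(\<Sum>j<q. d j * B ^ j) < B ^ q"
    using digsum_digits[OF B2, of q d] cls by (auto simp: d_def)
  have nz: "Poly_Mapping.lookup m i = 0" if "i \<notin> ?A" for i using that by (simp add: in_keys_iff)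
  have "code m = (\<Sum>i\<in>?A. Poly_Mapping.lookup m i * col i)"
    unfolding code_def using A nz by (intro sum.mono_neutral_right) auto
  also have "\<dots> = (\<Sum>i\<in>?A. Poly_Mapping.lookup m i * B ^ c i)"
    using c by (intro sum.cong) auto
  also have "\<dots> = (\<Sum>j<q. \<Sum>i | i \<in> ?A \<and> c i = j. Poly_Mapping.lookup m i * B ^ c i)"
    using c by (intro sum.group[symmetric]) auto
  also have "\<dots> = (\<Sum>j<q. d j * B ^ j)"
    unfolding d_def sum_distrib_right by (intro sum.cong refl) auto
  finally have code: "code m = (\<Sum>j<q. d j * B ^ j)" .
  have "mdeg m = (\<Sum>i\<in>?A. Poly_Mapping.lookup m i)"
    unfolding mdeg_def using A nz by (intro sum.mono_neutral_right) auto
  also have "\<dots> = (\<Sum>j<q. d j)"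
    unfolding d_def using c by (intro sum.group[symmetric]) auto
  finally have deg: "mdeg m = (\<Sum>j<q. d j)" .
  have "0 < col i" if "0 < Poly_Mapping.lookup m i" for i
    using c[of i] that B2 by (simp add: in_keys_iff)
  then have "realizes p (code m) m"
    using mg code d deg by (simp add: realizes_def)
  then have "reach p (code m)" using d(2) code by (auto simp: reach_def)
  moreover have "digsum B (code m) = k" using d(1) code deg k by simp
  ultimately show ?thesis by blast
qed

end

section \<open>Structured programs for the word RAM\<close>

datatype com =
    Blk "instr list"
  | Seq com com (infixr \<open>;;\<close> 60)
  | Cond nat nat com com
  | Loop nat nat com

fun clen :: "com \<Rightarrow> nat" where
  "clen (Blk is) = length is"
| "clen (c1 ;; c2) = clen c1 + clen c2"
| "clen (Cond a b c1 c2) = clen c1 + clen c2 + 2"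
| "clen (Loop a b c) = clen c + 3"

text \<open>The argument \<open>p\<close> is the absolute address of the code, as jump targets are
  absolute. The else branch comes first because \<open>JLESS\<close> jumps when its test
  succeeds.\<close>

fun comp :: "nat \<Rightarrow> com \<Rightarrow> program" where
  "comp p (Blk is) = is"
| "comp p (c1 ;; c2) = comp p c1 @ comp (p + clen c1) c2"
| "comp p (Cond a b c1 c2) =
     [JLESS a b (p + 2 + clen c2)] @ comp (p + 1) c2 @ [JUMP (p + 2 + clen c2 + clen c1)] @
     comp (p + 2 + clen c2) c1"
| "comp p (Loop a b c) = [JLESS a b (p + 2), JUMP (p + 3 + clen c)] @ comp (p + 2) c @ [JUMP p]"

lemma length_comp [simp]: "length (comp p c) = clen c"
  by (induction c arbitrary: p) auto

definition fits :: "nat \<Rightarrow> config \<Rightarrow> bool" where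
  "fits w s \<longleftrightarrow> (\<forall>i. reg s i \<le> w) \<and> (\<forall>i. mem s i \<le> w)"

definition runs :: "nat \<Rightarrow> program \<Rightarrow> config \<Rightarrow> nat \<Rightarrow> config \<Rightarrow>
    bool" where
  "runs w P s t s' \<longleftrightarrow> (step P ^^ t) s = s' \<and> (\<forall>i\<le>t. fits w ((step P ^^ i) s))"

lemma runs_0: "fits w s \<Longrightarrow> runs w P s 0 s"
  by (simp add: runs_def)

lemma runs_1: "fits w s \<Longrightarrow> fits w (step P s) \<Longrightarrow> runs w P s 1 (step P s)"
  by (auto simp: runs_def le_Suc_eq)

lemma runs_trans:
  assumes "runs w P s t s'" "runs w P s' t' s''"
  shows "runs w P s (t + t') s''"
  unfolding runs_def
proof (intro conjI allI impI)
  have eq: "(step P ^^ (t + j)) s = (step P ^^ j) s'" for j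
    using assms(1) by (simp add: runs_def funpow_add add.commute[of t])
  show "(step P ^^ (t + t')) s = s''" using assms(2) by (simp add: eq runs_def)
  fix i assume i: "i \<le> t + t'"
  show "fits w ((step P ^^ i) s)"
  proof (cases "i \<le> t")
    case True
    then show ?thesis using assms(1) by (simp add: runs_def)
  next
    case False
    then obtain j where "i = t + j" "j \<le> t'" using i by (metis add_le_cancel_left le_Suc_ex nle_le)
    then show ?thesis using assms(2) eq by (simp add: runs_def)
  qed
qed

lemma runs_fits: "runs w P s t s' \<Longrightarrow> fits w s'"
  by (auto simp: runs_def)

definition placed :: "program \<Rightarrow> nat \<Rightarrow> com \<Rightarrow> bool" where
  "placed P p c \<longleftrightarrow> (\<exists>xs ys. P = xs @ comp p c @ ys \<and> length xs = p)"

lemma step_at: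
  assumes "P = xs @ i # ys" "pc s = length xs"
  shows "step P s = exec i s"
  using assms by (simp add: step_def halted_def)

text \<open>\<open>wp w c Q T R M\<close>: started with registers \<open>R\<close> and memory \<open>M\<close>, the code
    of \<open>c\<close> reaches its end within
  \<open>T\<close> steps in a state satisfying \<open>Q\<close>, and no word exceeds \<open>w\<close> on the way.\<close>

definition wp :: "nat \<Rightarrow> com \<Rightarrow> ((nat \<Rightarrow> nat) \<Rightarrow> (nat \<Rightarrow> nat)
    \<Rightarrow> bool) \<Rightarrow> nat \<Rightarrow> (nat \<Rightarrow> nat) \<Rightarrow> (nat \<Rightarrow> nat)
    \<Rightarrow> bool" where
  "wp w c Q T R M \<longleftrightarrow>
     (\<forall>P p s. placed P p c \<and> pc s = p \<and> reg s = R \<and> mem s = M \<and> fits w s \<longrightarrow>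
        (\<exists>t s'. t \<le> T \<and> runs w P s t s' \<and> pc s' = p + clen c \<and> Q (reg s') (mem s')))"

text \<open>Only \<open>SETC\<close>, \<open>ADD\<close> and \<open>MULT\<close> carry a word-size
  condition: the other assignments copy a present value or yield one no larger than it. Jumps are
  rejected, since \<open>comp\<close> alone creates them.\<close>

fun wpb :: "nat \<Rightarrow> instr list \<Rightarrow> ((nat \<Rightarrow> nat) \<Rightarrow> (nat \<Rightarrow> nat)
    \<Rightarrow> bool) \<Rightarrow> (nat \<Rightarrow> nat) \<Rightarrow> (nat \<Rightarrow> nat) \<Rightarrow> bool" where
  "wpb w [] Q R M = Q R M"
| "wpb w (SETC d c # is) Q R M = (c \<le> w \<and> wpb w is Q (R(d := c)) M)"
| "wpb w (ADD d a b # is) Q R M = (R a + R b \<le> w \<and> wpb w is Q (R(d := R a + R b)) M)"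
| "wpb w (SUB d a b # is) Q R M = wpb w is Q (R(d := R a - R b)) M"
| "wpb w (MULT d a b # is) Q R M = (R a * R b \<le> w \<and> wpb w is Q (R(d := R a * R b)) M)"
| "wpb w (DIV d a b # is) Q R M = wpb w is Q (R(d := R a div R b)) M"
| "wpb w (LOAD d a # is) Q R M = wpb w is Q (R(d := M (R a))) M"
| "wpb w (STORE a b # is) Q R M = wpb w is Q R (M(R a := R b))"
| "wpb w (JLESS a b l # is) Q R M = False"
| "wpb w (JUMP l # is) Q R M = False"

lemma wpb_step:
  assumes "wpb w (i # is) Q (reg s) (mem s)" "fits w s"
  shows "wpb w is Q (reg (exec i s)) (mem (exec i s)) \<and> fits w (exec i s) \<and> pc (exec i s) = pc s + 1"
proof -
  have "x div y \<le> w" "x - y \<le> w" if "x \<le> w" for x y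
    using that by (meson div_le_dividend diff_le_self le_trans)+
  with assms show ?thesis
    by (cases i) (auto simp: set_reg_def fits_def)
qed

lemma wp_Blk:
  assumes "wpb w is Q R M" "length is \<le> T"
  shows "wp w (Blk is) Q T R M"
proof -
  have main: "\<exists>s'. runs w P s (length is) s' \<and> pc s' = pc s + length is \<and> Q (reg s') (mem s')"
    if "wpb w is Q (reg s) (mem s)" "fits w s" "P = xs @ is @ ys" "pc s = length xs" for P s xs ys
    using that
  proof (induction "is" arbitrary: s xs)
    case Nil
    then show ?case using runs_0 by auto
  next
    case (Cons i "is")
    have st: "step P s = exec i s" using Cons.prems by (intro step_at) auto
    note w = wpb_step[OF Cons.prems(1,2)]
    have r1: "runs w P s 1 (exec i s)" using runs_1[of w s P] Cons.prems(2) w by (simp add: st)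
    have "\<exists>s'. runs w P (exec i s) (length is) s' \<and> pc s' = pc (exec i s) + length is \<and> Q (reg s') (mem s')"
      using w Cons.prems by (intro Cons.IH[of _ "xs @ [i]"]) auto
    then obtain s' where "runs w P (exec i s) (length is) s'" "pc s' = pc (exec i s) + length is" "Q (reg s') (mem s')"
      by blast
    then show ?case using runs_trans[OF r1] w by auto
  qed
  show ?thesis
    unfolding wp_def
  proof (intro allI impI, elim conjE)
    fix P p s assume p: "placed P p (Blk is)" "pc s = p" and s: "reg s = R" "mem s = M" "fits w s"
    obtain xs ys where "P = xs @ is @ ys" "length xs = p" using p(1) unfolding placed_def by auto
    then obtain s' where "runs w P s (length is) s'" "pc s' = pc s + length is" "Q (reg s') (mem s')"
      using main[of s P xs ys] assms(1) s p(2) by blast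
    then show "\<exists>t s'. t \<le> T \<and> runs w P s t s' \<and> pc s' = p + clen (Blk is) \<and> Q (reg s') (mem s')"
      using assms(2) p(2) by (intro exI[of _ "length is"] exI[of _ s']) simp
  qed
qed

lemma placed_Seq: "placed P p (c1 ;; c2) \<Longrightarrow> placed P p c1 \<and> placed P (p + clen c1) c2"
  unfolding placed_def
  by (metis (no_types, lifting) append.assoc comp.simps(2) length_append length_comp)

lemma wp_Seq:
  assumes "wp w c1 (\<lambda>R M. wp w c2 Q T2 R M) T1 R M" "T1 + T2 \<le> T"
  shows "wp w (c1 ;; c2) Q T R M"
  unfolding wp_def
proof (intro allI impI, elim conjE)
  fix P p s assume p: "placed P p (c1 ;; c2)" "pc s = p" and s: "reg s = R" "mem s = M" "fits w s"
  note pl = placed_Seq[OF p(1)]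
  obtain t s' where s': "t \<le> T1" "runs w P s t s'" "pc s' = p + clen c1" "wp w c2 Q T2 (reg s') (mem s')"
    using assms(1) pl p(2) s unfolding wp_def[of _ c1] by blast
  then obtain t' s'' where s'': "t' \<le> T2" "runs w P s' t' s''" "pc s'' = p + clen c1 + clen c2" "Q (reg s'') (mem s'')"
    using pl runs_fits[OF s'(2)] unfolding wp_def[of _ c2] by blast
  then show "\<exists>t s'. t \<le> T \<and> runs w P s t s' \<and> pc s' = p + clen (c1 ;; c2) \<and> Q (reg s') (mem s')"
    using runs_trans[OF s'(2) s''(2)] s'(1) assms(2) by (intro exI[of _ "t + t'"] exI[of _ s'']) auto
qed

lemma runs_jless:
  assumes "P = xs @ JLESS a b l # ys" "pc s = length xs" "fits w s"
  shows "runs w P s 1 (s\<lparr>pc := if reg s a < reg s b then l else pc s + 1\<rparr>)"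
  using runs_1[of w s P] assms step_at[OF assms(1,2)] by (simp add: fits_def)

lemma runs_jump:
  assumes "P = xs @ JUMP l # ys" "pc s = length xs" "fits w s"
  shows "runs w P s 1 (s\<lparr>pc := l\<rparr>)"
  using runs_1[of w s P] assms step_at[OF assms(1,2)] by (simp add: fits_def)

lemma wp_Cond:
  assumes "R a < R b \<Longrightarrow> wp w c1 Q T R M" "\<not> R a < R b \<Longrightarrow> wp w c2 Q T R M" "T + 2 \<le> T'"
  shows "wp w (Cond a b c1 c2) Q T' R M"
  unfolding wp_def
proof (intro allI impI, elim conjE)
  fix P p s assume p: "placed P p (Cond a b c1 c2)" "pc s = p" and s: "reg s = R" "mem s = M" "fits w s"
  obtain xs ys where P: "length xs = p"
    "P = xs @ JLESS a b (p + 2 + clen c2) # comp (p + 1) c2 @ JUMP (p + 2 + clen c2 + clen c1) # comp (p + 2 + clen c2) c1 @ ys"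
    using p(1) unfolding placed_def by auto
  have pl2: "placed P (p + 1) c2" unfolding placed_def
    by (intro exI[of _ "xs @ [JLESS a b (p + 2 + clen c2)]"] exI) (use P in auto)
  have pl1: "placed P (p + 2 + clen c2) c1" unfolding placed_def
    by (intro exI[of _ "xs @ JLESS a b (p + 2 + clen c2) # comp (p + 1) c2 @ [JUMP (p + 2 + clen c2 + clen c1)]"] exI)
      (use P in auto)
  define s1 where "s1 = s\<lparr>pc := if reg s a < reg s b then p + 2 + clen c2 else p + 1\<rparr>"
  have r1: "runs w P s 1 s1" unfolding s1_def
    using runs_jless[OF P(2), of s w] p s P(1) by (cases "R a < R b") simp_all
  have s1: "reg s1 = R" "mem s1 = M" "fits w s1" using s by (simp_all add: s1_def fits_def)
  show "\<exists>t s'. t \<le> T' \<and> runs w P s t s' \<and> pc s' = p + clen (Cond a b c1 c2) \<and> Q (reg s') (mem s')"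
  proof (cases "R a < R b")
    case True
    then have "pc s1 = p + 2 + clen c2" using s by (simp add: s1_def)
    then obtain t s' where s': "t \<le> T" "runs w P s1 t s'" "pc s' = p + 2 + clen c2 + clen c1" "Q (reg s') (mem s')"
      using assms(1)[OF True] pl1 s1 unfolding wp_def by blast
    then show ?thesis using runs_trans[OF r1 s'(2)] assms(3)
      by (intro exI[of _ "1 + t"] exI[of _ s']) auto
  next
    case False
    then have "pc s1 = p + 1" using s by (simp add: s1_def)
    then obtain t s' where s': "t \<le> T" "runs w P s1 t s'" "pc s' = p + 1 + clen c2" "Q (reg s') (mem s')"
      using assms(2)[OF False] pl2 s1 unfolding wp_def by blast
    have "runs w P s' 1 (s'\<lparr>pc := p + 2 + clen c2 + clen c1\<rparr>)"
      by (rule runs_jump[of _ "xs @ JLESS a b (p + 2 + clen c2) # comp (p + 1) c2"])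
        (use P s' runs_fits[OF s'(2)] in auto)
    then have "runs w P s (1 + t + 1) (s'\<lparr>pc := p + 2 + clen c2 + clen c1\<rparr>)"
      using runs_trans[OF runs_trans[OF r1 s'(2)]] by blast
    then show ?thesis using s'(1,4) assms(3)
      by (intro exI[of _ "1 + t + 1"] exI[of _ "s'\<lparr>pc := p + 2 + clen c2 + clen c1\<rparr>"]) auto
  qed
qed

text \<open>The first argument of the loop invariant \<open>I\<close> bounds the number of remaining iterations.\<close>

lemma wp_Loop:
  assumes init: "I V R M" and T: "V * (Tb + 2) + 2 \<le> T"
    and body: "\<And>v R M. I v R M \<Longrightarrow> R a < R b \<Longrightarrow> wp w c (\<lambda>R M. \<exists>v'<v. I
        v' R M) Tb R M"
    and final: "\<And>v R M. I v R M \<Longrightarrow> \<not> R a < R b \<Longrightarrow> Q R M"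
  shows "wp w (Loop a b c) Q T R M"
proof -
  have main: "\<exists>t s'. t \<le> v * (Tb + 2) + 2 \<and> runs w P s t s' \<and> pc s' = p + clen c + 3 \<and> Q (reg
      s') (mem s')"
    if P: "length xs = p" "P = xs @ JLESS a b (p + 2) # JUMP (p + 3 + clen c) # comp (p + 2) c @ JUMP p # ys"
      and "pc s = p" "fits w s" "I v (reg s) (mem s)" for v P p s xs ys
    using that(3-)
  proof (induction v arbitrary: s rule: less_induct)
    case (less v)
    define s1 where "s1 = s\<lparr>pc := if reg s a < reg s b then p + 2 else p + 1\<rparr>"
    have r1: "runs w P s 1 s1" unfolding s1_def
      using runs_jless[OF P(2), of s w] less.prems P(1) by (cases "reg s a < reg s b") simp_all
    have s1: "reg s1 = reg s" "mem s1 = mem s" "fits w s1"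
      using less.prems by (simp_all add: s1_def fits_def)
    show ?case
    proof (cases "reg s a < reg s b")
      case True
      have pl: "placed P (p + 2) c" unfolding placed_def
        by (intro exI[of _ "xs @ [JLESS a b (p + 2), JUMP (p + 3 + clen c)]"] exI) (use P in auto)
      have "pc s1 = p + 2" using True by (simp add: s1_def)
      then obtain t s' v' where s': "t \<le> Tb" "runs w P s1 t s'" "pc s' = p + 2 + clen c"
          and v': "v' < v" "I v' (reg s') (mem s')"
        using body[OF less.prems(3) True] pl s1 unfolding wp_def by blast
      define s2 where "s2 = s'\<lparr>pc := p\<rparr>"
      have r2: "runs w P s' 1 s2" unfolding s2_def
        by (rule runs_jump[of _ "xs @ JLESS a b (p + 2) # JUMP (p + 3 + clen c) # comp (p + 2) c"])
          (use P s' runs_fits[OF s'(2)] in auto)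
      have "\<exists>t s'. t \<le> v' * (Tb + 2) + 2 \<and> runs w P s2 t s' \<and> pc s' = p + clen c + 3 \<and> Q (reg
          s') (mem s')"
        using v' runs_fits[OF s'(2)] by (intro less.IH) (auto simp: s2_def fits_def)
      then obtain t3 s3 where s3: "t3 \<le> v' * (Tb + 2) + 2" "runs w P s2 t3 s3" "pc s3 = p + clen c + 3" "Q (reg s3) (mem s3)"
        by blast
      have "runs w P s (1 + t + 1 + t3) s3"
        using runs_trans[OF runs_trans[OF runs_trans[OF r1 s'(2)] r2] s3(2)] .
      moreover have "1 + t + 1 + t3 \<le> v * (Tb + 2) + 2"
      proof -
        have "Suc v' * (Tb + 2) \<le> v * (Tb + 2)" using v'(1) by (intro mult_le_mono1) simp
        then show ?thesis using s'(1) s3(1) by simp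
      qed
      ultimately show ?thesis using s3 by blast
    next
      case False
      have "runs w P s1 1 (s1\<lparr>pc := p + 3 + clen c\<rparr>)"
        by (rule runs_jump[of _ "xs @ [JLESS a b (p + 2)]"]) (use P s1 False in \<open>auto simp: s1_def\<close>)
      from runs_trans[OF r1 this] show ?thesis
        using final[OF less.prems(3) False] s1
        by (intro exI[of _ "1 + 1"] exI[of _ "s1\<lparr>pc := p + 3 + clen c\<rparr>"]) auto
    qed
  qed
  show ?thesis
    unfolding wp_def
  proof (intro allI impI, elim conjE)
    fix P p s assume p: "placed P p (Loop a b c)" "pc s = p" and s: "reg s = R" "mem s = M" "fits w s"
    obtain xs ys where P: "length xs = p"
      "P = xs @ JLESS a b (p + 2) # JUMP (p + 3 + clen c) # comp (p + 2) c @ JUMP p # ys"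
      using p(1) unfolding placed_def by auto
    show "\<exists>t s'. t \<le> T \<and> runs w P s t s' \<and> pc s' = p + clen (Loop a b c) \<and> Q (reg s') (mem s')"
    proof -
      have "I V (reg s) (mem s)" using init s(1,2) by simp
      then obtain t s' where "t \<le> V * (Tb + 2) + 2" "runs w P s t s'" "pc s' = p + clen c + 3" "Q (reg s') (mem s')"
        using main[OF P p(2) s(3)] by blast
      then show ?thesis using T by (intro exI[of _ t] exI[of _ s']) simp
    qed
  qed
qed

text \<open>Symbolic execution of loop-free code, which the simplifier can evaluate. Loops are
  rejected and go through \<open>wp_Loop\<close> with an invariant.\<close>

fun wpc :: "nat \<Rightarrow> com \<Rightarrow> ((nat \<Rightarrow> nat) \<Rightarrow> (nat \<Rightarrow> nat)
    \<Rightarrow> bool) \<Rightarrow> (nat \<Rightarrow> nat) \<Rightarrow> (nat \<Rightarrow> nat) \<Rightarrow> bool" where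
  "wpc w (Blk is) Q R M = wpb w is Q R M"
| "wpc w (c1 ;; c2) Q R M = wpc w c1 (wpc w c2 Q) R M"
| "wpc w (Cond a b c1 c2) Q R M = (if R a < R b then wpc w c1 Q R M else wpc w c2 Q R M)"
| "wpc w (Loop a b c) Q R M = False"

fun ctime :: "com \<Rightarrow> nat" where
  "ctime (Blk is) = length is"
| "ctime (c1 ;; c2) = ctime c1 + ctime c2"
| "ctime (Cond a b c1 c2) = max (ctime c1) (ctime c2) + 2"
| "ctime (Loop a b c) = 0"

lemma wpb_mono: "wpb w is Q R M \<Longrightarrow> (\<And>R M. Q R M \<Longrightarrow> Q' R M) \<Longrightarrow> wpb w is Q' R M"
proof (induction "is" arbitrary: R M)
  case (Cons i "is")
  then show ?case by (cases i) auto
qed auto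

lemma wpc_mono: "wpc w c Q R M \<Longrightarrow> (\<And>R M. Q R M \<Longrightarrow> Q' R M) \<Longrightarrow> wpc w c Q' R M"
proof (induction c arbitrary: Q Q' R M)
  case (Seq c1 c2)
  show ?case using Seq.IH(1)[of "wpc w c2 Q" R M "wpc w c2 Q'"] Seq.IH(2) Seq.prems by auto
next
  case (Cond a b c1 c2)
  then show ?case by (auto split: if_splits)
qed (auto intro: wpb_mono)

lemma wp_wpc: "wpc w c Q R M \<Longrightarrow> ctime c \<le> T \<Longrightarrow> wp w c Q T R M"
proof (induction c arbitrary: Q R M T)
  case (Blk x)
  then show ?case by (simp add: wp_Blk)
next
  case (Seq c1 c2)
  have "wpc w c1 (\<lambda>R M. wp w c2 Q (ctime c2) R M) R M"
    using Seq.prems(1) by (auto intro: wpc_mono Seq.IH(2))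
  then have "wp w c1 (\<lambda>R M. wp w c2 Q (ctime c2) R M) (ctime c1) R M" by (rule Seq.IH(1)) simp
  then show ?case by (rule wp_Seq) (use Seq.prems(2) in simp)
next
  case (Cond a b c1 c2)
  show ?case
    by (rule wp_Cond[where T = "max (ctime c1) (ctime c2)"])
      (use Cond.prems Cond.IH in \<open>auto split: if_splits\<close>)
qed simp

lemma wp_computes:
  assumes "wp w c Q T (\<lambda>_. 0) (mem (initial xs))" "fits w (initial xs)" "real T \<le> T'" "real w \<le> W"
  shows "\<exists>M R. computes_within (comp 0 c) xs T' W M \<and> Q R M"
proof -
  have "placed (comp 0 c) 0 c" unfolding placed_def by auto
  then obtain t s' where s': "t \<le> T" "runs w (comp 0 c) (initial xs) t s'" "pc s' = clen c" "Q (reg s') (mem s')"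
    using assms(1)[unfolded wp_def, rule_format, of "comp 0 c" 0 "initial xs"] assms(2)
    by (auto simp: initial_def)
  have "within_words W s" if "fits w s" for s
  proof -
    have "real x \<le> W" if "x \<le> w" for x using that assms(4) by linarith
    then show ?thesis using that unfolding fits_def within_words_def by blast
  qed
  then have "computes_within (comp 0 c) xs T' W (mem s')"
    unfolding computes_within_def using s' assms(3)
    by (intro exI[of _ t]) (auto simp: halted_def runs_def)
  then show ?thesis using s'(4) by blast
qed

section \<open>The program\<close>

text \<open>Registers \<open>0\<close> to \<open>22\<close> hold \<open>0, 1, 2, n, r, k, length C, out, B, K, MU, Lam,
    Lam div K, D, q, BQ, HH\<close>,
  an unused register, \<open>2 * k\<close>, and the addresses of the table of digit sums, the table of the dynamic
  programme, the exponents of the answer, and the stack. Register \<open>24\<close> bounds the guesses, \<open>25\<close> is the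
  current guess.\<close>

definition walk_body :: com where
  "walk_body =
     Blk [DIV 53 50 13, MULT 54 53 13, SUB 54 50 54, ADD 50 53 0] ;;
     Cond 51 54
       (Blk [ADD 46 52 0, ADD 50 0 0])
       (Cond 54 51
         (Blk [SUB 51 51 54, SUB 51 51 1, MULT 52 52 8])
         (Blk [ADD 50 0 0]))"

definition walk_prog :: com where
  "walk_prog = Blk [ADD 50 42 0, ADD 52 1 0, ADD 46 0 0] ;; Loop 0 50 walk_body"

definition colour_body1 :: com where
  "colour_body1 =
     Blk [DIV 61 41 9, MULT 60 61 9, SUB 60 41 60, ADD 41 61 0, MULT 60 60 2, ADD 60 60 1, MULT 60 60 43,
          DIV 61 60 9, MULT 61 61 9, SUB 60 60 61, DIV 61 9 44, DIV 60 60 61, ADD 60 60 44, MULT 60 60 2,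
          ADD 51 60 1]"

text \<open>A nonzero colour sets the round counter to \<open>2 * k\<close>, which ends the
  loop.\<close>

definition colour_body2 :: com where
  "colour_body2 = Cond 0 46 (Blk [ADD 45 18 0]) (Blk [MULT 45 45 2, DIV 44 44 2])"

definition colour_prog :: com where
  "colour_prog =
     Blk [DIV 42 25 16, MULT 60 42 16, SUB 41 25 60, DIV 61 41 11, MULT 60 61 11, SUB 60 41 60, ADD 41 61 0,
          MULT 60 60 2, ADD 60 60 1, MULT 60 60 40, DIV 61 60 11, MULT 61 61 11, SUB 60 60 61, DIV 43 60 12,
          ADD 44 10 0, ADD 45 4 0, ADD 46 0 0] ;;
     Loop 45 18 (colour_body1 ;; walk_prog ;; colour_body2)"

text \<open>For fan-in below two, \<open>DIV 30 30 30\<close> normalises the kind: division by zero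
  yields \<open>0\<close> and keeps a variable, while a sum or product of one argument becomes kind
  \<open>1\<close> with both arguments equal.\<close>

definition load_prog :: com where
  "load_prog =
     Blk [SETC 60 4, MULT 60 60 28, SETC 61 5, ADD 60 60 61, LOAD 30 60, ADD 60 60 1, LOAD 31 60,
          ADD 60 60 1, LOAD 32 60, ADD 60 60 1, LOAD 33 60] ;;
     Cond 31 2 (Blk [ADD 33 32 0, DIV 30 30 30]) (Blk [])"

definition sum_prog :: com where
  "sum_prog =
     Blk [ADD 60 34 36, LOAD 60 60, ADD 61 35 36, LOAD 61 61, ADD 60 60 61] ;;
     Cond 0 60 (Blk [ADD 37 1 0]) (Blk [])"

definition prod_body :: com where
  "prod_body =
     Blk [ADD 60 34 38, LOAD 60 60, SUB 62 36 38, ADD 61 35 62, LOAD 61 61, MULT 60 60 61, ADD 63 19 38,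
          LOAD 63 63, ADD 64 19 62, LOAD 64 64, ADD 63 63 64, ADD 64 19 36, LOAD 64 64] ;;
     Cond 0 60 (Cond 64 63 (Blk []) (Blk [ADD 37 38 1])) (Blk []) ;;
     Blk [ADD 38 38 1]"

definition prod_prog :: com where
  "prod_prog = Blk [ADD 38 0 0, ADD 39 36 1] ;; Loop 38 39 prod_body"

text \<open>When the code equals the colour, \<open>DIV 37 36 36\<close> yields \<open>1\<close>,
  except for code \<open>0\<close>, where it yields \<open>0\<close>: an uncoloured variable thus
  has no entry.\<close>

definition var_prog :: com where
  "var_prog = Cond 36 46 (Blk []) (Cond 46 36 (Blk []) (Blk [DIV 37 36 36]))"

definition entry_prog :: com where
  "entry_prog =
     Blk [ADD 37 0 0] ;; Cond 30 1 var_prog (Cond 30 2 sum_prog prod_prog) ;;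
     Blk [ADD 60 29 36, STORE 60 37, ADD 36 36 1]"

definition gate_prog :: com where
  "gate_prog =
     load_prog ;; Cond 30 1 (Blk [ADD 40 32 0] ;; colour_prog) (Blk []) ;;
     Blk [MULT 29 28 15, ADD 29 29 20, MULT 34 32 15, ADD 34 34 20, MULT 35 33 15, ADD 35 35 20, ADD 36 0 0] ;;
     Loop 36 15 entry_prog"

definition table_prog :: com where
  "table_prog = Blk [ADD 28 0 0] ;; Loop 28 6 (gate_prog ;; Blk [ADD 28 28 1])"

definition search_body :: com where
  "search_body =
     Blk [ADD 60 29 36, LOAD 60 60, ADD 61 19 36, LOAD 61 61] ;;
     Cond 0 60
       (Cond 61 5 (Blk []) (Cond 5 61 (Blk []) (Blk [ADD 26 1 0, ADD 27 36 0])))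
       (Blk []) ;;
     Blk [ADD 36 36 1]"

definition search_prog :: com where
  "search_prog = Blk [ADD 26 0 0, ADD 36 0 0, MULT 29 7 15, ADD 29 29 20] ;; Loop 36 15 search_body"

text \<open>On success the bound in register \<open>24\<close> is set to \<open>0\<close>. The loop
  then ends before the next table is built, so the table of the successful guess is still available
  for the traceback.\<close>

definition guess_prog :: com where
  "guess_prog =
     Blk [ADD 25 0 0, ADD 26 0 0] ;;
     Loop 25 24 (table_prog ;; search_prog ;; Cond 0 26 (Blk [ADD 24 0 0]) (Blk [ADD 25 25 1]))"

definition pop_prog :: com where
  "pop_prog = Blk [SUB 23 23 1, ADD 60 23 23, ADD 60 60 22, LOAD 28 60, ADD 60 60 1, LOAD 36 60]"

definition push_prog :: com where
  "push_prog =
     Cond 30 1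
       (Blk [ADD 60 21 32, LOAD 61 60, ADD 61 61 1, STORE 60 61])
       (Cond 30 2
         (Blk [MULT 34 32 15, ADD 34 34 20, ADD 60 34 36, LOAD 60 60, ADD 61 23 23, ADD 61 61 22,
               ADD 62 61 1, STORE 62 36] ;;
          Cond 0 60 (Blk [STORE 61 32, ADD 23 23 1]) (Blk [STORE 61 33, ADD 23 23 1]))
         (Blk [MULT 29 28 15, ADD 29 29 20, ADD 60 29 36, LOAD 60 60, SUB 60 60 1, SUB 62 36 60,
               ADD 61 23 23, ADD 61 61 22, STORE 61 32, ADD 61 61 1, STORE 61 60, ADD 61 61 1,
               STORE 61 33, ADD 61 61 1, STORE 61 62, ADD 23 23 2]))"

definition trace_prog :: com where
  "trace_prog =
     Blk [ADD 23 1 0, STORE 22 7, ADD 60 22 1, STORE 60 27] ;;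
     Loop 0 23 (pop_prog ;; load_prog ;; push_prog)"

definition output_prog :: com where
  "output_prog =
     Blk [ADD 36 0 0] ;;
     Loop 36 3 (Blk [ADD 60 21 36, LOAD 60 60, ADD 61 36 1, STORE 61 60, ADD 36 36 1]) ;;
     Blk [STORE 0 1]"

definition init_prog1 :: com where
  "init_prog1 =
     Blk [SETC 1 1, SETC 2 2, LOAD 3 0, LOAD 4 1, LOAD 5 2, SETC 60 3, LOAD 6 60, SETC 60 4, LOAD 7 60,
          ADD 8 4 1, SETC 61 64, MULT 13 4 61, MULT 63 60 5, DIV 14 63 4, ADD 14 14 1, MULT 18 5 2,
          MULT 62 5 5, SETC 61 3, MULT 62 62 61, ADD 62 62 1, ADD 9 1 0, ADD 10 1 0] ;;
     Loop 9 62 (Blk [MULT 9 9 2]) ;;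
     Loop 10 63 (Blk [MULT 10 10 2]) ;;
     Blk [ADD 11 9 0] ;;
     Loop 11 3 (Blk [MULT 11 11 2])"

text \<open>The second loop doubles \<open>r\<close> in register \<open>61\<close> until it reaches
  \<open>2 * k\<close>. This repeats the definition of \<open>J\<close>, so \<open>K ^ J\<close> is
  obtained without storing \<open>J\<close>.\<close>

definition init_prog2 :: com where
  "init_prog2 =
     Blk [DIV 12 11 9, ADD 15 1 0, ADD 24 1 0, ADD 61 0 0] ;;
     Loop 61 14 (Blk [MULT 15 15 8, MULT 24 24 13, ADD 61 61 1]) ;;
     Blk [ADD 16 11 0, ADD 61 4 0] ;;
     Loop 61 18 (Blk [MULT 16 16 9, MULT 61 61 2]) ;;
     Blk [MULT 24 24 16, SETC 60 4, MULT 60 60 6, SETC 61 5, ADD 19 60 61, ADD 20 19 15, MULT 60 6 15,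
          ADD 21 20 60, ADD 22 21 3, ADD 60 0 0]"

definition digsum_body :: com where
  "digsum_body =
     Blk [DIV 61 60 8, MULT 62 61 8, SUB 62 60 62, ADD 61 61 19, LOAD 61 61, ADD 61 61 62,
          ADD 62 60 19, STORE 62 61, ADD 60 60 1]"

definition rk_prog :: com where
  "rk_prog = init_prog1 ;; init_prog2 ;; Loop 60 15 digsum_body ;; guess_prog ;; Cond 0 26 (trace_prog ;; output_prog)
      (Blk [STORE 0 0])"

text \<open>Registers are numbered so that inner code writes only higher numbers than those its
  surroundings rely on; one threshold then serves as frame condition for each subprogram.\<close>

definition pres :: "nat \<Rightarrow> (nat \<Rightarrow> nat) \<Rightarrow> (nat \<Rightarrow> nat) \<Rightarrow> bool" where
  "pres b R R' \<longleftrightarrow> (\<forall>i<b. R' i = R i)"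

lemma pres_refl [simp]: "pres b R R"
  by (simp add: pres_def)

lemma pres_upd [simp]: "b \<le> d \<Longrightarrow> pres b R (R'(d := v)) \<longleftrightarrow> pres b R R'"
  by (auto simp: pres_def)

lemma pres_trans: "pres b R R' \<Longrightarrow> pres b' R' R'' \<Longrightarrow> b \<le> b' \<Longrightarrow> pres b R R''"
  by (auto simp: pres_def)

lemma presD: "pres b R R' \<Longrightarrow> i < b \<Longrightarrow> R' i = R i"
  by (auto simp: pres_def)

section \<open>Memory layout and word size\<close>

locale machine = guesses n r k kap mu lam + circuit n C for n r k kap mu lam C +
  fixes out :: nat
  assumes out: "out < length C"
begin

definition "s = length C"
text \<open>A common bound: all factors are positive, so each of them and each partial product is at
  most \<open>Z\<close>. The word bound \<open>w\<close> has room for the product of two numbers up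
  to \<open>50 * Z\<close>.\<close>

definition "Z = G * BQ * s * n * k"
definition "w = 10000 * (Z * Z)"
text \<open>Memory after the input: digit sums, \<open>s\<close> rows of \<open>BQ\<close> table
  entries, the exponents of the answer, and last the stack, which can grow freely.\<close>

definition "aS = 5 + 4 * s"
definition "aT = aS + BQ"
definition "aE = aT + s * BQ"
definition "aK = aE + n"

definition const_regs :: "(nat \<Rightarrow> nat) \<Rightarrow> bool" where
  "const_regs R \<longleftrightarrow> R 0 = 0 \<and> R 1 = 1 \<and> R 2 = 2 \<and> R 3 = n \<and> R 4 = r \<and> R 5 = k
      \<and> R 6 = s \<and> R 7 = out \<and>
     R 8 = B \<and> R 9 = K \<and> R 10 = MU \<and> R 11 = Lam \<and> R 12 = Lam div K \<and> R 13 = D \<and> R 14 = q \<and>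
     R 15 = BQ \<and> R 16 = HH \<and> R 18 = 2 * k \<and> R 19 = aS \<and> R 20 = aT \<and> R 21 = aE \<and> R 22 = aK"

lemma const_regs_upd [simp]: "23 \<le> d \<Longrightarrow> const_regs (R(d := v)) \<longleftrightarrow> const_regs R"
  by (simp add: const_regs_def)

lemma const_regs_pres: "const_regs R \<Longrightarrow> pres b R R' \<Longrightarrow> 23 \<le> b \<Longrightarrow> const_regs R'"
  by (simp add: const_regs_def pres_def)

lemma w_add: "x \<le> 50 * Z \<Longrightarrow> y \<le> 50 * Z \<Longrightarrow> x + y \<le> w"
proof -
  have "Z \<le> Z * Z" by simp
  then show "x \<le> 50 * Z \<Longrightarrow> y \<le> 50 * Z \<Longrightarrow> x + y \<le> w" unfolding w_def by linarith
qed

lemma w_mult: "x \<le> 50 * Z \<Longrightarrow> y \<le> 50 * Z \<Longrightarrow> x * y \<le> w"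
proof -
  assume "x \<le> 50 * Z" "y \<le> 50 * Z"
  then have "x * y \<le> (50 * Z) * (50 * Z)" by (rule mult_le_mono)
  then show "x * y \<le> w" unfolding w_def by simp
qed

lemma w_small: "x \<le> 50 * Z \<Longrightarrow> x \<le> w"
  using w_add[of x 0] by simp

lemma pos: "0 < B" "0 < K" "0 < MU" "0 < Lam" "0 < D" "0 < q" "0 < BQ" "0 < HH" "0 < G" "0 < s" "0 < n" "0 < k" "0 < r"
  using r1 rk n0 out
  by (auto simp: B_def K_def MU_def Lam_def D_def q_def BQ_def HH_def G_def s_def)

lemma K_dvd_Lam: "K dvd Lam"
  using lam(1) by (simp add: K_def Lam_def le_imp_power_dvd)

lemma MU_le_K: "MU \<le> K"
  using mu_le_kap by (simp add: K_def MU_def)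

lemma bounds:
  "1 \<le> Z" "G \<le> Z" "BQ \<le> Z" "s \<le> Z" "n \<le> Z" "k \<le> Z" "r \<le> Z" "HH \<le> Z" "Lam \<le> Z" "K
      \<le> Z" "MU \<le> Z" "D \<le> Z"
  "B \<le> Z" "q \<le> 5 * Z" "D ^ q \<le> Z" "s * BQ \<le> Z" "n * BQ \<le> Z" "k * s \<le> Z"
proof -
  have le: "x \<le> x * y" if "0 < y" for x y :: nat using that by simp
  note p = pos
  have a: "BQ * s * n * k * G = Z" "G * (BQ * s * n * k) = Z" "BQ * (G * s * n * k) = Z" "s * (G * BQ * n * k) = Z"
    "n * (G * BQ * s * k) = Z" "k * (G * BQ * s * n) = Z" "s * BQ * (G * n * k) = Z" "n * BQ * (G * s * k) = Z"
    "k * s * (G * BQ * n) = Z"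
    by (simp_all add: Z_def mult_ac)
  have p4: "0 < BQ * s * n * k" "0 < G * s * n * k" "0 < G * BQ * n * k" "0 < G * BQ * s * k" "0 < G * BQ * s * n"
    "0 < G * n * k" "0 < G * s * k" "0 < G * BQ * n"
    using p by simp_all
  show G: "G \<le> Z" and BQ: "BQ \<le> Z" and "s \<le> Z" "n \<le> Z" and k: "k \<le> Z" and "s * BQ \<le> Z" "n * BQ
      \<le> Z" "k * s \<le> Z"
    using le[OF p4(1), of G] le[OF p4(2), of BQ] le[OF p4(3), of s] le[OF p4(4), of n] le[OF p4(5), of k]
      le[OF p4(6), of "s * BQ"] le[OF p4(7), of "n * BQ"] le[OF p4(8), of "k * s"] unfolding a by blast+
  show "1 \<le> Z" using G p by simp
  show "r \<le> Z" using k rk by simp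
  have HG: "HH \<le> G" using p by (simp add: G_def)
  have DG: "D ^ q \<le> G" using p by (simp add: G_def)
  have LH: "Lam \<le> HH" using p by (simp add: HH_def)
  have KL: "K \<le> Lam" using dvd_imp_le[OF K_dvd_Lam] p by simp
  show "HH \<le> Z" "Lam \<le> Z" "K \<le> Z" "MU \<le> Z" "D ^ q \<le> Z" using HG DG LH KL MU_le_K G by linarith+
  then show "D \<le> Z" using self_le_power[of D q] p by simp
  show "B \<le> Z" using self_le_power[of B q] p BQ by (simp add: BQ_def)
  have "4 * k div r \<le> 4 * k" by simp
  then show "q \<le> 5 * Z" unfolding q_def using k \<open>1 \<le> Z\<close> by linarith
qed

lemma mod_by_div: "x - x div y * y = x mod (y::nat)" "x - y * (x div y) = x mod (y::nat)"
  by (simp_all add: minus_div_mult_eq_mod minus_mult_div_eq_mod)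

section \<open>Verification of the colouring subroutine\<close>

lemma wp_walk:
  assumes R: "const_regs R" "R 42 < D ^ q" "R 51 \<le> 40 * Z"
    and Q: "\<And>R'. pres 46 R R' \<Longrightarrow> R' 46 = walk D B (R 42) (R 51) 1 \<Longrightarrow> Q R' M"
  shows "wp w walk_prog Q (13 * q + 5) R M"
proof -
  define tgt where "tgt = walk D B (R 42) (R 51) 1"
  \<comment> \<open>\<open>R' 50 < D ^ j\<close> limits the digits still to be read;
    \<open>R' 52 * B ^ j \<le> BQ\<close> reserves word size for the multiplications by
    \<open>B\<close> still to come. A zero in register \<open>50\<close> marks the result as
    final.\<close>
  define I where "I j R' M' \<longleftrightarrow> M' = M \<and> pres 46 R R' \<and>
      (if R' 50 = 0 then R' 46 = tgt else R' 46 = 0 \<and> walk D B (R' 50) (R' 51) (R' 52) = tgt) \<and>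
      R' 50 < D ^ j \<and> R' 50 \<le> Z \<and> R' 52 * B ^ j \<le> BQ \<and> R' 51 \<le> 40 * Z" for j R' M'
  have body: "wp w walk_body (\<lambda>R M. \<exists>v'<v. I v' R M) 11 R' M'"
    if I: "I v R' M'" and lt: "R' 0 < R' 50" for v R' M'
  proof (rule wp_wpc)
    note I' = I[unfolded I_def]
    have c: "const_regs R'" using R(1) I' const_regs_pres by fastforce
    note c' = c[unfolded const_regs_def]
    obtain j where v: "v = Suc j" using I' lt by (cases v) auto
    have zd: "R' 50 div D < D ^ j" using I' pos by (simp add: v less_mult_imp_div_less mult.commute)
    have zZ: "R' 50 div D \<le> Z" "R' 50 div D * D \<le> Z" using I' by (meson div_le_dividend
        div_times_less_eq_dividend le_trans)+
    have pw: "R' 52 * B * B ^ j \<le> BQ" using I' by (simp add: v mult_ac)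
    then have "R' 52 * B \<le> BQ" using pos by (metis (no_types) le_trans mult_le_mono2 mult.right_neutral one_le_power
        Suc_leI One_nat_def)
    moreover have "R' 52 \<le> R' 52 * B" using pos by simp
    moreover from calculation have "R' 52 \<le> BQ" by linarith
    then have ex: "\<exists>v'<Suc j. R' 52 * B ^ v' \<le> BQ" by (intro exI[of _ 0]) simp
    ultimately have pwZ: "R' 52 * B \<le> Z" "R' 52 \<le> Z" using bounds by linarith+
    have nz: "R' 50 \<noteq> 0" using lt c' by simp
    then have "walk D B (R' 50) (R' 51) (R' 52) = tgt" using I' by simp
    then have wk: "(if R' 51 < R' 50 mod D then R' 52
        else if R' 50 mod D < R' 51 then walk D B (R' 50 div D) (R' 51 - R' 50 mod D - 1) (R' 52 * B) else 0) = tgt"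
      using nz D_ge by (simp add: walk.simps[of D B "R' 50"])
    show "wpc w walk_body (\<lambda>R M. \<exists>v'<v. I v' R M) R' M'"
    proof -
      consider "R' 51 < R' 50 mod D" | "R' 50 mod D < R' 51" | "R' 51 = R' 50 mod D" by linarith
      then show ?thesis
      proof cases
        case 1
        then show ?thesis
          using I' c' zZ pwZ wk bounds(1) pos(5) nz ex
          by (simp add: walk_body_def I_def v mod_by_div w_small)
      next
        case 2
        then have "\<not> R' 51 < R' 50 mod D" by simp
        with 2 show ?thesis
          using I' c' zd zZ pw pwZ wk bounds(1) nz
          by (simp add: walk_body_def I_def v mod_by_div w_small) (auto intro!: exI[of _ j])
      next
        case 3
        then show ?thesis
          using I' c' zZ pwZ wk bounds(1) pos(5) nz ex
          by (simp add: walk_body_def I_def v mod_by_div w_small)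
      qed
    qed
  qed (simp add: walk_body_def)
  have loop: "wp w (Loop 0 50 walk_body) Q (13 * q + 2) R' M"
    if R': "pres 46 R R'" "R' 46 = 0" "R' 50 = R 42" "R' 51 = R 51" "R' 52 = 1" for R'
  proof (rule wp_Loop[where I = I and Tb = 11 and V = q])
    show "I q R' M" using R' R bounds by (auto simp: I_def tgt_def BQ_def)
    show "Q R' M'" if I: "I v R' M'" "\<not> R' 0 < R' 50" for v R' M'
    proof -
      have "R' 0 = 0" using I(1) R(1) presD[of 46 R R' 0] by (simp add: I_def const_regs_def)
      then have "R' 46 = tgt" "M' = M" "pres 46 R R'" using I by (auto simp: I_def)
      then show ?thesis using Q by (simp add: tgt_def)
    qed
  qed (use body in auto)
  show ?thesis
    unfolding walk_prog_def
  proof (intro wp_Seq[where ?T1.0 = 3 and ?T2.0 = "13 * q + 2"] wp_Blk)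
    have "R 42 \<le> w" "1 \<le> w" using R(2) bounds(1,15) by (intro w_small; linarith)+
    with loop show "wpb w [ADD 50 42 0, ADD 52 1 0, ADD 46 0 0]
        (\<lambda>R M. wp w (Loop 0 50 walk_body) Q (13 * q + 2) R M) R M"
      using R(1)[unfolded const_regs_def] by simp
  qed simp_all
qed

lemma wp_colour:
  assumes R: "const_regs R" "R 25 < G" "R 40 < n"
    and Q: "\<And>R'. pres 41 R R' \<Longrightarrow> R' 46 = colour (R 25) (R 40) \<Longrightarrow> Q R' M"
  shows "wp w colour_prog Q (2 * k * (13 * q + 26) + 19) R M"
proof -
  note R' = R(1)[unfolded const_regs_def]
  define z where "z = R 25 div HH"
  define y where "y = mshash Lam K (R 25 mod HH mod Lam) (R 40)"
  define tgt where "tgt = colour (R 25) (R 40)"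
  have tgt: "tgt = rounds D B K z (2 * k) y (R 25 mod HH div Lam) MU r"
    by (simp add: tgt_def colour_def z_def y_def)
  have z: "z < D ^ q" using R(2) by (simp add: z_def G_def less_mult_imp_div_less mult.commute)
  have yK: "y < K" unfolding y_def using K_dvd_Lam pos(4) by (rule mshash_less)
  \<comment> \<open>The counter in register \<open>45\<close> is positive and doubles, so it grows
    in every round. The crude bound of \<open>2 * k\<close> iterations is enough, as it costs only a
    power of \<open>k\<close>.\<close>
  define I where "I j R' M' \<longleftrightarrow> M' = M \<and> pres 41 R R' \<and> R' 42 = z \<and> R' 43 = y \<and> R'
      41 \<le> Z \<and> R' 44 \<le> MU \<and>
      0 < R' 45 \<and> R' 45 \<le> 4 * k \<and> 2 * k \<le> R' 45 + j \<and>
      (if 2 * k \<le> R' 45 then R' 46 = tgt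
       else rounds D B K z (2 * k) y (R' 41) (R' 44) (R' 45) = tgt)" for j R' M'
  have body: "wp w (colour_body1 ;; walk_prog ;; colour_body2) (\<lambda>R M. \<exists>v'<v. I v' R M) (13 * q + 24) R' M'"
    if I: "I v R' M'" and lt: "R' 45 < R' 18" for v R' M'
  proof -
    note I' = I[unfolded I_def]
    have c: "const_regs R'" using R(1) I' const_regs_pres by fastforce
    note c' = c[unfolded const_regs_def]
    define h m t where hmt: "h = R' 41" "m = R' 44" "t = R' 45"
    define x where "x = 2 * (m + mshash K m (h mod K) y) + 1"
    define u where "u = walk D B z x 1"
    have lt': "t < 2 * k" using lt c' by (simp add: hmt)
    have v: "0 < v" using I' lt' by (auto simp: hmt)
    have tg: "tgt = (if 0 < u then u else rounds D B K z (2 * k) y (h div K) (m div 2) (2 * t))"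
    proof -
      have "rounds D B K z (2 * k) y h m t = tgt" "t \<noteq> 0" using I' lt' by (simp_all add: hmt)
      moreover have "rounds D B K z (2 * k) y h m t = (if t = 0 \<or> 2 * k \<le> t then 0
          else if 0 < u then u else rounds D B K z (2 * k) y (h div K) (m div 2) (2 * t))"
        unfolding u_def x_def by (rule rounds.simps)
      ultimately show ?thesis using lt' by simp
    qed
    have hK: "h mod K < K" using pos by simp
    have aK: "Suc (2 * (h mod K)) * y mod K div (K div m) \<le> K"
      using pos by (meson div_le_dividend le_trans less_imp_le mod_less_divisor)
    have xZ: "x \<le> 40 * Z" using aK I' bounds by (simp add: x_def mshash_def hmt)
    have step2: "wp w (walk_prog ;; colour_body2) (\<lambda>R M. \<exists>v'<v. I v' R M) (13 * q + 9) R'' M"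
      if R'': "pres 41 R R''" "R'' 42 = z" "R'' 43 = y" "R'' 41 = h div K" "R'' 44 = m" "R'' 45 = t" "R'' 51 = x" for R''
    proof -
      have c: "const_regs R''" using R(1) R'' const_regs_pres by fastforce
      note c'' = c[unfolded const_regs_def]
      show ?thesis
      proof (rule wp_Seq[OF wp_walk[OF c]])
        show "R'' 42 < D ^ q" "R'' 51 \<le> 40 * Z" using R'' z xZ by auto
        fix R3 assume R3: "pres 46 R'' R3" "R3 46 = walk D B (R'' 42) (R'' 51) 1"
        have u: "R3 46 = u" using R3 R'' by (simp add: u_def)
        have c3: "const_regs R3" using c R3 const_regs_pres by fastforce
        note c3' = c3[unfolded const_regs_def]
        have p3: "pres 41 R R3" using R''(1) R3(1) by (rule pres_trans) simp
        have e3: "R3 41 = h div K" "R3 42 = z" "R3 43 = y" "R3 44 = m" "R3 45 = t"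
          using R'' R3(1) by (simp_all add: presD)
        have hd: "h div K \<le> Z" using I' by (metis div_le_dividend le_trans hmt(1))
        have md: "m div 2 \<le> MU" using I' by (metis div_le_dividend le_trans hmt(2))
        show "wp w colour_body2 (\<lambda>R M. \<exists>v'<v. I v' R M) 4 R3 M"
        proof (rule wp_wpc)
          show "wpc w colour_body2 (\<lambda>R M. \<exists>v'<v. I v' R M) R3 M"
          proof (cases "u = 0")
            case True
            have v1: "v - 1 < v" "2 * k \<le> t * 2 + (v - 1)" "t * 2 \<le> 4 * k" "t * 2 \<le> w" "0 < t"
              using v lt' I' bounds(6) by (auto simp: hmt intro!: w_small)
            have "I (v - 1) (R3(45 := t * 2, 44 := m div 2)) M"
              using p3 e3 True u tg v1 hd md by (auto simp: I_def mult.commute rounds.simps)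
            then show ?thesis using c3' e3 True u v1 by (auto simp: colour_body2_def)
          next
            case False
            have v1: "v - 1 < v" "2 * k \<le> w" "0 < k" "m \<le> MU"
              using v I' bounds(6) pos by (auto simp: hmt intro!: w_small)
            have "I (v - 1) (R3(45 := 2 * k)) M"
              using p3 e3 False u tg v1 hd by (auto simp: I_def)
            then show ?thesis using c3' False u v1 by (auto simp: colour_body2_def)
          qed
        qed (simp add: colour_body2_def)
      qed simp
    qed
    show ?thesis
    proof (rule wp_Seq[where ?T1.0 = 15 and ?T2.0 = "13 * q + 9"])
      show "wp w colour_body1 (\<lambda>R M. wp w (walk_prog ;; colour_body2) (\<lambda>R M. \<exists>v'<v. I v' R M) (13
          * q + 9) R M) 15 R' M'"
      proof (rule wp_wpc)
        define X where "X = (h mod K * 2 + 1) * y"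
        have hZ: "h mod K \<le> Z" "h div K * K \<le> Z" "y \<le> Z" "m \<le> Z"
        proof -
          have "h \<le> Z" "m \<le> MU" using I' by (simp_all add: hmt)
          then show "h mod K \<le> Z" "h div K * K \<le> Z" "y \<le> Z" "m \<le> Z"
            using hK yK bounds(10,11) div_times_less_eq_dividend[of h K] by linarith+
        qed
        have X: "X \<le> w" unfolding X_def using hZ bounds(1) by (intro w_mult) linarith+
        have XK: "X mod K div (K div m) \<le> Z"
          using pos bounds(10) by (meson div_le_dividend le_trans less_imp_le mod_less_divisor)
        have f: "h div K \<le> w" "h div K * K \<le> w" "h mod K * 2 \<le> w" "h mod K * 2 + 1 \<le> w" "X div K * K \<le> w"
          "X mod K div (K div m) + m \<le> w" "(X mod K div (K div m) + m) * 2 \<le> w" "(X mod K div (K div m) + m) * 2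
              + 1 \<le> w"
        proof -
          have "h div K \<le> h" "h \<le> Z" using I' by (simp_all add: hmt)
          then show "h div K \<le> w" by (intro w_small) linarith
          have a: "a + m \<le> w \<and> (a + m) * 2 \<le> w \<and> (a + m) * 2 + 1 \<le> w" if "a \<le> Z" for a
            using that hZ(4) bounds(1) by (auto intro!: w_small simp: add_mult_distrib)
          show "X mod K div (K div m) + m \<le> w" "(X mod K div (K div m) + m) * 2 \<le> w"
            "(X mod K div (K div m) + m) * 2 + 1 \<le> w"
            using a[OF XK] by blast+
          show "h div K * K \<le> w" "h mod K * 2 \<le> w" "h mod K * 2 + 1 \<le> w"
            using hZ bounds(1) by (intro w_small; linarith)+
          show "X div K * K \<le> w" using X div_times_less_eq_dividend[of X K] by linarith
        qed
        have x: "(X mod K div (K div m) + m) * 2 + 1 = x"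
          by (simp add: x_def mshash_def X_def mult.commute add.commute)
        show "wpc w colour_body1 (\<lambda>R M. wp w (walk_prog ;; colour_body2) (\<lambda>R M. \<exists>v'<v. I v' R M)
            (13 * q + 9) R M) R' M'"
          using I' c' f X x unfolding hmt[symmetric]
          by (simp add: colour_body1_def mod_by_div X_def[symmetric] hmt[symmetric] step2 del: One_nat_def)
      qed (simp add: colour_body1_def)
    qed simp
  qed
  define T2 where "T2 = 2 * k * (13 * q + 26) + 2"
  show ?thesis
    unfolding colour_prog_def
  proof (rule wp_Seq[where ?T1.0 = 17 and ?T2.0 = T2])
    have loop: "wp w (Loop 45 18 (colour_body1 ;; walk_prog ;; colour_body2)) Q T2 R2 M"
      if R2: "pres 41 R R2" "R2 42 = z" "R2 43 = y" "R2 41 = R 25 mod HH div Lam" "R2 44 = MU" "R2 45 = r" for R2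
    proof (rule wp_Loop[where I = I and Tb = "13 * q + 24" and V = "2 * k"])
      have "R 25 mod HH div Lam \<le> Z" using R(2) bounds(2) by (meson div_le_dividend le_trans less_imp_le mod_less_eq_dividend)
      then show "I (2 * k) R2 M" using R2 r1 rk tgt by (simp add: I_def)
      show "Q R' M'" if I: "I v R' M'" "\<not> R' 45 < R' 18" for v R' M'
      proof -
        have "R' 18 = 2 * k" using I(1) R' presD[of 41 R R' 18] by (simp add: I_def)
        then have "R' 46 = tgt" "M' = M" "pres 41 R R'" using I by (auto simp: I_def)
        then show ?thesis using Q by (simp add: tgt_def)
      qed
    qed (use body in \<open>auto simp: T2_def\<close>)
    define e where "e = R 25 mod HH mod Lam"
    define X where "X = (e * 2 + 1) * R 40"
    have eZ: "e \<le> Z" "R 25 \<le> Z" "R 40 \<le> Z" "R 25 div HH * HH \<le> Z" "R 25 mod HH div Lam * Lam \<le> Z"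
      using R bounds(2,5,9) pos(4) unfolding e_def
      by (meson div_times_less_eq_dividend le_trans less_imp_le mod_less_divisor mod_less_eq_dividend)+
    have X: "X \<le> w" unfolding X_def using eZ bounds(1) by (intro w_mult) linarith+
    have f: "R 25 div HH * HH \<le> w" "R 25 mod HH div Lam * Lam \<le> w" "R 25 mod HH div Lam \<le> w" "e * 2 \<le> w"
        "e * 2 + 1 \<le> w" "X div Lam * Lam \<le> w"
      "MU \<le> w" "r \<le> w"
    proof -
      have "R 25 mod HH div Lam \<le> R 25 mod HH div Lam * Lam" using pos by simp
      then have "R 25 mod HH div Lam \<le> Z" using eZ(5) by linarith
      then show "R 25 div HH * HH \<le> w" "R 25 mod HH div Lam * Lam \<le> w" "R 25 mod HH div Lam \<le> w" "e * 2 \<le> w"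
        "e * 2 + 1 \<le> w" "MU \<le> w" "r \<le> w"
        using eZ bounds(1,7,11) by (intro w_small; linarith)+
      show "X div Lam * Lam \<le> w" using X div_times_less_eq_dividend[of X Lam] by linarith
    qed
    have zR: "R 25 - z * HH = R 25 mod HH" by (simp add: z_def mod_by_div)
    have y: "X mod Lam div (Lam div K) = y" by (simp add: y_def mshash_def X_def e_def mult.commute)
    show "wp w (Blk [DIV 42 25 16, MULT 60 42 16, SUB 41 25 60, DIV 61 41 11, MULT 60 61 11, SUB 60 41 60, ADD 41 61 0,
          MULT 60 60 2, ADD 60 60 1, MULT 60 60 40, DIV 61 60 11, MULT 61 61 11, SUB 60 60 61, DIV 43 60 12,
          ADD 44 10 0, ADD 45 4 0, ADD 46 0 0])
        (\<lambda>R M. wp w (Loop 45 18 (colour_body1 ;; walk_prog ;; colour_body2)) Q T2 R M) 17 R M"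
      by (rule wp_Blk)
        (use R' f X y zR in \<open>simp_all add: mod_by_div e_def[symmetric] X_def[symmetric] z_def[symmetric] loop del:
            One_nat_def\<close>)
  qed (simp add: T2_def)
qed

text \<open>For products the kind is \<open>length js\<close>: a product of one argument is handled
  as a union, and only \<open>2\<close> means a genuine product.\<close>

definition gate_regs :: "gate \<Rightarrow> (nat \<Rightarrow> nat) \<Rightarrow> bool" where
  "gate_regs g R \<longleftrightarrow> (case g of
     Var i \<Rightarrow> R 30 = 0 \<and> R 32 = i \<and> R 33 = i
   | Sum js \<Rightarrow> R 30 = 1 \<and> R 32 = hd js \<and> R 33 = last js
   | Prod js \<Rightarrow> R 30 = length js \<and> R 32 = hd js \<and> R 33 = last js)"

definition "input = encode_instance n r k C out"

end

lemma length_encode_gate: "length (encode_gate g) = 4"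
  by (cases g) auto

lemma nth_concat_map4:
  assumes "\<And>x. length (f x) = 4" "t < 4"
  shows "p < length xs \<Longrightarrow> concat (map f xs) ! (4 * p + t) = f (xs ! p) ! t"
proof (induction xs arbitrary: p)
  case (Cons a xs)
  then show ?case using assms by (cases p) (auto simp: nth_append)
qed simp

context machine
begin

lemma input_gate:
  assumes "p < s" "t < 4" shows "input ! (5 + 4 * p + t) = encode_gate (C ! p) ! t"
  using assms nth_concat_map4[of encode_gate t p C]
  by (simp add: input_def encode_instance_def s_def length_encode_gate nth_append)

lemma wp_load:
  assumes R: "const_regs R" "R 28 < s" and M: "\<forall>j<5 + 4 * s. M j = input ! j"
    and Q: "\<And>R'. (\<And>i. i \<notin> {30, 31, 32, 33, 60, 61} \<Longrightarrow> R' i = R i) \<Longrightarrow>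
        gate_regs (C ! R 28) R' \<Longrightarrow> Q R' M"
  shows "wp w load_prog Q 15 R M"
proof (rule wp_wpc)
  note R' = R(1)[unfolded const_regs_def]
  define p where "p = R 28"
  have m: "M (5 + 4 * p + t) = encode_gate (C ! p) ! t" if "t < 4" for t
    using M input_gate[of p t] R(2) that by (simp add: p_def)
  have m': "M (4 * p + 5) = encode_gate (C ! p) ! 0" "M (6 + 4 * p) = encode_gate (C ! p) ! 1"
     "M (7 + 4 * p) = encode_gate (C ! p) ! 2" "M (8 + 4 * p) = encode_gate (C ! p) ! 3"
    using m[of 0] m[of 1] m[of 2] m[of 3] by (simp_all add: add_ac)
  have p: "R 28 = p" "p \<le> Z" "p < length C" using R bounds by (auto simp: p_def s_def)
  have b: "4 \<le> w" "4 * p \<le> w" "5 \<le> w" "4 * p + 5 \<le> w" "4 * p + 6 \<le> w" "4 * p + 7 \<le> w" "4 * p + 8 \<le> w"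
    using p(2) bounds(1) by (intro w_small; linarith)+
  have idx: "x \<le> Z \<Longrightarrow> x \<le> w" for x by (intro w_small) simp
  from p(3) show "wpc w load_prog Q R M"
  proof (cases rule: gate_cases)
    case (Var i)
    then have "i \<le> w" using bounds(5) by (intro idx) simp
    then show ?thesis using R' m' p b Var
      by (simp add: load_prog_def del: One_nat_def) (rule Q, auto simp: gate_regs_def)
  next
    case (Union a b)
    then have "a \<le> w" using p(2) by (intro idx) simp
    then show ?thesis using R' m' p b Union(1) unfolding union_gate_def
      by (elim disjE conjE; simp add: load_prog_def del: One_nat_def) (rule Q, auto simp: gate_regs_def)+
  next
    case (Prod a b)
    then show ?thesis using R' m' p b
      by (simp add: load_prog_def del: One_nat_def) (rule Q, auto simp: gate_regs_def)
  qed
qed (simp add: load_prog_def)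

end

text \<open>Also a meaningless guess yields only \<open>0\<close> or a power of \<open>B\<close>
  below \<open>B ^ q\<close>. This is all that soundness requires of a colouring.\<close>

lemma walk_range: "z < D ^ q \<Longrightarrow> walk D B z x pw = 0 \<or> (\<exists>c<q. walk D B z x pw = pw * B ^ c)"
proof (induction q arbitrary: z x pw)
  case (Suc q)
  show ?case
  proof (cases "z \<noteq> 0 \<and> 2 \<le> D \<and> z mod D < x")
    case True
    have "z div D < D ^ q" using Suc.prems by (simp add: less_mult_imp_div_less mult.commute)
    from Suc.IH[OF this, of "x - z mod D - 1" "pw * B"] show ?thesis
    proof (elim disjE exE conjE)
      fix c assume "c < q" "walk D B (z div D) (x - z mod D - 1) (pw * B) = pw * B * B ^ c"
      then show ?thesis using True by (intro disjI2 exI[of _ "Suc c"]) (simp add: walk.simps[of D B z])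
    qed (use True in \<open>simp add: walk.simps[of D B z]\<close>)
  qed (auto simp: walk.simps[of D B z])
qed simp

lemma rounds_range:
  "z < D ^ q \<Longrightarrow> rounds D B K z K2 y h M t = 0 \<or> (\<exists>c<q. rounds D B K z K2 y h M t = B ^ c)"
proof (induction "K2 - t" arbitrary: h M t rule: less_induct)
  case less
  let ?u = "walk D B z (2 * (M + mshash K M (h mod K) y) + 1) 1"
  have eq: "rounds D B K z K2 y h M t = (if t = 0 \<or> K2 \<le> t then 0
      else if 0 < ?u then ?u else rounds D B K z K2 y (h div K) (M div 2) (2 * t))"
    by (rule rounds.simps)
  have u: "?u = 0 \<or> (\<exists>c<q. ?u = B ^ c)"
    using walk_range[OF less.prems, of B "2 * (M + mshash K M (h mod K) y) + 1" 1] by simp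
  show ?case
  proof (cases "t = 0 \<or> K2 \<le> t \<or> 0 < ?u")
    case True
    then show ?thesis unfolding eq using u by auto
  next
    case False
    then have "K2 - 2 * t < K2 - t" by auto
    from less.hyps[OF this less.prems] show ?thesis unfolding eq using False by auto
  qed
qed

context machine
begin

lemma coloured: "g < G \<Longrightarrow> coloured_circuit n C B q (colour g)"
proof
  show "2 \<le> B" by (rule B_pos)
  fix i assume "g < G"
  then have "g div HH < D ^ q" by (simp add: G_def less_mult_imp_div_less mult.commute)
  then show "colour g i = 0 \<or> (\<exists>c<q. colour g i = B ^ c)"
    unfolding colour_def by (rule rounds_range)
qed

section \<open>Table entries and the dynamic programme on the machine\<close>

definition "reaches g = coloured_circuit.reach n C B q (colour g)"

definition split_ok :: "nat \<Rightarrow> nat \<Rightarrow> nat \<Rightarrow> nat \<Rightarrow> nat \<Rightarrow> bool" where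
  "split_ok g a b u x \<longleftrightarrow> reaches g a x \<and> reaches g b (u - x) \<and> digsum B x + digsum B (u - x)
      \<le> digsum B u"

text \<open>A positive entry for a multiplication gate is the code of the left factor plus one.\<close>

definition entry_ok :: "nat \<Rightarrow> nat \<Rightarrow> nat \<Rightarrow> nat \<Rightarrow> bool" where
  "entry_ok g p u v \<longleftrightarrow> (0 < v \<longleftrightarrow> reaches g p u) \<and> v \<le> BQ \<and>
     (\<forall>a b. C ! p = Prod [a, b] \<and> 0 < v \<longrightarrow> v - 1 \<le> u \<and> split_ok g a b u (v - 1))"

definition table :: "nat \<Rightarrow> (nat \<Rightarrow> nat) \<Rightarrow> nat \<Rightarrow> bool" where
  "table g M p \<longleftrightarrow> (\<forall>p'<p. \<forall>u<BQ. entry_ok g p' u (M (aT + p' * BQ + u)))"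

definition static :: "(nat \<Rightarrow> nat) \<Rightarrow> bool" where
  "static M \<longleftrightarrow> (\<forall>j<5 + 4 * s. M j = input ! j) \<and> (\<forall>u<BQ. M (aS + u) = digsum B u)"

definition frame :: "(nat \<Rightarrow> nat) \<Rightarrow> (nat \<Rightarrow> nat) \<Rightarrow> bool" where
  "frame M M' \<longleftrightarrow> (\<forall>x. x < aT \<or> aE \<le> x \<longrightarrow> M' x = M x)"

lemma staticD: "static M \<Longrightarrow> u < BQ \<Longrightarrow> M (aS + u) = digsum B u"
  by (simp add: static_def)

lemma frame_refl: "frame M M"
  by (simp add: frame_def)

lemma frame_trans: "frame M M' \<Longrightarrow> frame M' M'' \<Longrightarrow> frame M M''"
  by (simp add: frame_def)

lemma static_frame: "static M \<Longrightarrow> frame M M' \<Longrightarrow> static M'"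
  by (auto simp: static_def frame_def aT_def aS_def)

lemma row_less: "p < s \<Longrightarrow> u < BQ \<Longrightarrow> p * BQ + u < s * BQ"
proof -
  assume "p < s" "u < BQ"
  then have "p * BQ + u < Suc p * BQ" by simp
  also have "\<dots> \<le> s * BQ" using \<open>p < s\<close> by (intro mult_le_mono1) simp
  finally show ?thesis .
qed

lemma frame_entry: "p < s \<Longrightarrow> u < BQ \<Longrightarrow> frame M (M(aT + p * BQ + u := v))"
  using row_less[of p u] by (auto simp: frame_def aE_def)

lemma table_upd:
  assumes "table g M p" "p \<le> p'" "u < BQ"
  shows "table g (M(aT + p' * BQ + u := v)) p"
proof -
  have "aT + i * BQ + j \<noteq> aT + p' * BQ + u" if "i < p" "j < BQ" for i j
  proof -
    have "i * BQ + j < Suc i * BQ" using that by simp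
    also have "\<dots> \<le> p' * BQ" using that assms(2) by (intro mult_le_mono1) simp
    finally show ?thesis by simp
  qed
  then show ?thesis using assms(1) by (simp add: table_def)
qed

lemma tableD: "table g M p \<Longrightarrow> p' < p \<Longrightarrow> u < BQ \<Longrightarrow> entry_ok g p' u (M (aT +
    p' * BQ + u))"
  by (simp add: table_def)

lemma addr: "aS \<le> 9 * Z" "aT \<le> 10 * Z" "aE \<le> 11 * Z" "aK \<le> 12 * Z"
  using bounds(1,3,4,5,16) by (simp_all add: aS_def aT_def aE_def aK_def)

lemma digsum_less_BQ: "u < BQ \<Longrightarrow> digsum B u \<le> Z"
  using digsum_le[OF B_pos, of u] bounds(3) by linarith

lemma wp_prod:
  assumes R: "const_regs R" "R 36 = u" "u < BQ" "R 37 = 0" "R 34 = aT + a * BQ" "R 35 = aT + b * BQ"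
    and M: "static M" "table g M p" "a < p" "b < p" "p < s"
    and Q: "\<And>R'. pres 37 R R' \<Longrightarrow> (0 < R' 37 \<longleftrightarrow> (\<exists>x\<le>u. split_ok g a b u
        x)) \<Longrightarrow> R' 37 \<le> BQ \<Longrightarrow>
      (0 < R' 37 \<longrightarrow> R' 37 - 1 \<le> u \<and> split_ok g a b u (R' 37 - 1)) \<Longrightarrow> Q R' M"
  shows "wp w prod_prog Q (21 * BQ + 4) R M"
proof -
  define I where "I j R' M' \<longleftrightarrow> M' = M \<and> pres 37 R R' \<and> R' 39 = u + 1 \<and> R' 38 + j = u +
      1 \<and> R' 37 \<le> BQ \<and>
      (0 < R' 37 \<longleftrightarrow> (\<exists>x<R' 38. split_ok g a b u x)) \<and>
      (0 < R' 37 \<longrightarrow> R' 37 - 1 \<le> u \<and> split_ok g a b u (R' 37 - 1))" for j R' M'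
  have ab: "a * BQ \<le> Z" "b * BQ \<le> Z"
    using M(3-5) bounds(16) by (meson le_trans less_imp_le mult_le_mono1 order.strict_trans)+
  have body: "wp w prod_body (\<lambda>R M. \<exists>v'<v. I v' R M) 19 R' M'" if I: "I v R' M'" and lt: "R' 38 < R' 39"
      for v R' M'
  proof (rule wp_wpc)
    note I' = I[unfolded I_def]
    have c: "const_regs R'" using R(1) I' by (meson const_regs_pres le_refl numeral_le_iff semiring_norm le_numeral_extra)
    note c' = c[unfolded const_regs_def]
    define x where "x = R' 38"
    have x: "x \<le> u" "x < BQ" "u - x < BQ" using I' lt R(3) by (auto simp: x_def)
    have p37: "pres 37 R R'" using I' by simp
    have e: "R' 36 = u" "R' 34 = aT + a * BQ" "R' 35 = aT + b * BQ" using presD[OF p37] R by simp_all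
    define ta tb where "ta = M (aT + a * BQ + x)" and "tb = M (aT + b * BQ + (u - x))"
    have "entry_ok g a x ta" "entry_ok g b (u - x) tb"
      unfolding ta_def tb_def using M x by (simp_all only: tableD)
    then have t: "0 < ta \<longleftrightarrow> reaches g a x" "0 < tb \<longleftrightarrow> reaches g b (u - x)" "ta
        \<le> Z" "tb \<le> Z"
      using bounds(3) by (auto simp: entry_ok_def)
    have S: "M (aS + x) = digsum B x" "M (aS + (u - x)) = digsum B (u - x)" "M (aS + u) = digsum B u"
      using M(1) x R(3) by (simp_all only: staticD)
    have b: "aT + a * BQ + x \<le> w" "aT + b * BQ + (u - x) \<le> w" "aS + x \<le> w" "aS + (u - x) \<le> w" "aS + u
        \<le> w" "x + 1 \<le> w"
      using ab addr x R(3) bounds(1,3) by (intro w_small; linarith)+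
    have b2: "ta * tb \<le> w" "digsum B x + digsum B (u - x) \<le> w"
      using t digsum_less_BQ[of x] digsum_less_BQ[of "u - x"] x by (intro w_mult w_add; linarith)+
    have nxt: "\<exists>v'<v. I v' R'' M"
      if "pres 37 R R''" "R'' 39 = u + 1" "R'' 38 = x + 1" "R'' 37 = (if split_ok g a b u x then x + 1 else R' 37)" for R''
    proof (intro exI[of _ "v - 1"] conjI)
      show "v - 1 < v" using I' x by (simp add: x_def)
      show "I (v - 1) R'' M"
        unfolding I_def using that I' x by (auto simp: x_def less_Suc_eq)
    qed
    have so: "split_ok g a b u x \<longleftrightarrow> 0 < ta * tb \<and> \<not> digsum B u < digsum B x + digsum B (u - x)"
      using t by (auto simp: split_ok_def)
    show "wpc w prod_body (\<lambda>R M. \<exists>v'<v. I v' R M) R' M'"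
    proof -
      have i: "M' = M" "pres 37 R R'" "R' 39 = u + 1" "R' 38 = x" using I' by (simp_all add: x_def)
      consider "\<not> 0 < ta * tb" "\<not> split_ok g a b u x"
        | "0 < ta * tb" "digsum B u < digsum B x + digsum B (u - x)" "\<not> split_ok g a b u x"
        | "0 < ta * tb" "\<not> digsum B u < digsum B x + digsum B (u - x)" "split_ok g a b u x"
        using so by argo
      then show ?thesis
        by cases (use i c' b b2 e S in
          \<open>simp_all add: prod_body_def ta_def[symmetric] tb_def[symmetric] nxt del: One_nat_def zero_less_mult_iff
              nat_0_less_mult_iff mult_eq_0_iff mult_is_0\<close>)
    qed
  qed (simp add: prod_body_def)
  have loop: "wp w (Loop 38 39 prod_body) Q (21 * BQ + 2) R' M"
    if R': "pres 37 R R'" "R' 37 = 0" "R' 38 = 0" "R' 39 = u + 1" for R'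
  proof (rule wp_Loop[where I = I and Tb = 19 and V = "u + 1"])
    show "I (u + 1) R' M" using R' by (simp add: I_def)
    show "Q R' M'" if I: "I v R' M'" "\<not> R' 38 < R' 39" for v R' M'
    proof -
      have e: "R' 38 = u + 1" and "M' = M" using I by (auto simp: I_def)
      have "(\<exists>x<R' 38. split_ok g a b u x) \<longleftrightarrow> (\<exists>x\<le>u. split_ok g a b u x)"
        using e by (auto simp: less_Suc_eq_le)
      then show ?thesis unfolding \<open>M' = M\<close> using I(1) unfolding I_def by (intro Q) simp_all
    qed
    show "(u + 1) * (19 + 2) + 2 \<le> 21 * BQ + 2" using R(3) by simp
  qed (use body in auto)
  have u1: "u + 1 \<le> w" using R(3) bounds(1,3) by (intro w_small) linarith
  define T2 where "T2 = 21 * BQ + 2"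
  have "wp w (Blk [ADD 38 0 0, ADD 39 36 1]) (\<lambda>R M. wp w (Loop 38 39 prod_body) Q T2 R M) 2 R M"
    by (rule wp_Blk) (use R(1)[unfolded const_regs_def] R u1 loop in \<open>simp_all add: T2_def del: One_nat_def\<close>)
  then show ?thesis unfolding prod_prog_def by (rule wp_Seq) (simp add: T2_def)
qed

lemma wp_entry:
  assumes R: "const_regs R" "R 36 = u" "u < BQ" "gate_regs (C ! p) R" "R 29 = aT + p * BQ"
      "R 34 = aT + R 32 * BQ" "R 35 = aT + R 33 * BQ" "\<And>i. C ! p = Var i \<Longrightarrow> R 46 = colour g i"
    and M: "static M" "table g M p" "p < s" and g: "g < G"
    and Q: "\<And>R' v. pres 36 R R' \<Longrightarrow> R' 36 = u + 1 \<Longrightarrow> (\<forall>i. C ! p = Var i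
        \<longrightarrow> R' 46 = R 46) \<Longrightarrow> entry_ok g p u v \<Longrightarrow>
      Q R' (M(aT + p * BQ + u := v))"
  shows "wp w entry_prog Q (21 * BQ + 12) R M"
proof -
  interpret coloured_circuit n C B q "colour g" using g by (rule coloured)
  have rc: "reaches g = reach" by (simp add: reaches_def)
  note R' = R(1)[unfolded const_regs_def]
  have pl: "p < length C" using M(3) by (simp add: s_def)
  have uZ: "u \<le> Z" "u + 1 \<le> Z" using R(3) bounds(3) by linarith+
  have pB: "p * BQ + u \<le> Z" using row_less[OF M(3) R(3)] bounds(16) by linarith
  define tl where "tl = Blk [ADD 60 29 36, STORE 60 37, ADD 36 36 1]"
  have tail: "wp w tl Q 3 R' M"
    if "pres 36 R R'" "R' 36 = u" "\<forall>i. C ! p = Var i \<longrightarrow> R' 46 = R 46" "entry_ok g p u (R' 37)" for R'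
    unfolding tl_def
  proof (rule wp_Blk)
    have b: "aT + p * BQ + u \<le> w" "u + 1 \<le> w" using uZ pB addr bounds(1) by (intro w_small; linarith)+
    have e: "R' 29 = aT + p * BQ" "R' 1 = 1" using that(1) R R' by (simp_all add: presD)
    show "wpb w [ADD 60 29 36, STORE 60 37, ADD 36 36 1] Q R' M"
      using b e that by (simp add: Q del: One_nat_def)
  qed simp
  have "wp w (Cond 30 1 var_prog (Cond 30 2 sum_prog prod_prog)) (\<lambda>R M. wp w tl Q 3 R M)
      (21 * BQ + 8) (R(37 := 0)) M"
    using pl
  proof (cases rule: gate_cases)
    case (Var i)
    have g0: "R 30 = 0" using R(4) Var by (simp add: gate_regs_def)
    have r: "reaches g p u \<longleftrightarrow> u = R 46 \<and> 0 < u" using reach_Var(2)[OF pl Var(1)] R(8)[OF Var(1)]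
        by (simp add: rc)
    have eok: "entry_ok g p u v" if "v = (if u = R 46 \<and> 0 < u then 1 else 0)" for v
      using that r pos(7) Var by (auto simp: entry_ok_def)
    show ?thesis
    proof (rule wp_Cond[where T = "21 * BQ + 6"])
      show "wp w var_prog (\<lambda>R M. wp w tl Q 3 R M) (21 * BQ + 6) (R(37 := 0)) M"
      proof (rule wp_wpc)
        consider "u < R 46" | "R 46 < u" | "u = R 46" "u = 0" | "u = R 46" "0 < u" by linarith
        then show "wpc w var_prog (\<lambda>R M. wp w tl Q 3 R M) (R(37 := 0)) M"
          by cases (use R(2) tail eok in \<open>simp_all add: var_prog_def\<close>)
      qed (simp add: var_prog_def)
    qed (use g0 R' in simp_all)
  next
    case (Union a b)
    have g1: "R 30 = 1" "R 32 = a" "R 33 = b" using R(4) Union by (auto simp: gate_regs_def union_gate_def)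
    define ta tb where "ta = M (aT + a * BQ + u)" and "tb = M (aT + b * BQ + u)"
    have "entry_ok g a u ta" "entry_ok g b u tb" using M R(3) Union(2,3) by (simp_all add: ta_def tb_def table_def)
    then have t: "0 < ta + tb \<longleftrightarrow> reaches g p u" "ta \<le> Z" "tb \<le> Z"
      using reach_union(2)[OF pl Union(1)] bounds(3) by (auto simp: entry_ok_def rc)
    have eok: "entry_ok g p u v" if "v = (if 0 < ta + tb then 1 else 0)" for v
      using that t pos(7) Union(1) by (auto simp: entry_ok_def union_gate_def)
    have aB: "a * BQ \<le> Z" "b * BQ \<le> Z" using Union(2,3) M(3) bounds(16)
      by (meson le_trans less_imp_le mult_le_mono1 order.strict_trans)+
    have bd: "aT + a * BQ + u \<le> w" "aT + b * BQ + u \<le> w" "ta + tb \<le> w" "1 \<le> w"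
      using aB addr uZ t bounds(1) by (intro w_small; linarith)+
    have sum: "wp w sum_prog (\<lambda>R M. wp w tl Q 3 R M) (21 * BQ + 4) (R(37 := 0)) M"
      proof (rule wp_wpc)
        show "wpc w sum_prog (\<lambda>R M. wp w tl Q 3 R M) (R(37 := 0)) M"
          using R' R(2,6,7) g1 bd tail eok
          by (cases "0 < ta + tb") (simp_all add: sum_prog_def ta_def[symmetric] tb_def[symmetric] del: One_nat_def
              add_gr_0 add_is_0)
      qed (use pos(7) in \<open>simp add: sum_prog_def\<close>)
    show ?thesis
    proof (rule wp_Cond[where T = "21 * BQ + 6"])
      show "wp w (Cond 30 2 sum_prog prod_prog) (\<lambda>R M. wp w tl Q 3 R M) (21 * BQ + 6) (R(37 := 0)) M"
        by (rule wp_Cond[where T = "21 * BQ + 4"]) (use g1 R' sum in simp_all)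
    qed (use g1 R' in simp_all)
  next
    case (Prod a b)
    have g1: "R 30 = 2" "R 32 = a" "R 33 = b" using R(4) Prod by (auto simp: gate_regs_def)
    have prod: "wp w prod_prog (\<lambda>R M. wp w tl Q 3 R M) (21 * BQ + 4) (R(37 := 0)) M"
      proof (rule wp_prod[where a = a and b = b and p = p and g = g and u = u])
        fix R3 assume R3: "pres 37 (R(37 := 0)) R3" "0 < R3 37 \<longleftrightarrow> (\<exists>x\<le>u. split_ok g a b u
            x)" "R3 37 \<le> BQ"
          "0 < R3 37 \<longrightarrow> R3 37 - 1 \<le> u \<and> split_ok g a b u (R3 37 - 1)"
        have p3: "pres 36 R R3" using R3(1) by (auto simp: pres_def)
        have "reaches g p u \<longleftrightarrow> (\<exists>x\<le>u. split_ok g a b u x)"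
          using reach_Prod[OF pl Prod(1), of u] R(3) by (simp add: split_ok_def BQ_def rc)
        then have "entry_ok g p u (R3 37)" using R3 Prod(1) by (auto simp: entry_ok_def)
        moreover have "R3 36 = u" using R3(1) R(2) by (simp add: presD)
        ultimately show "wp w tl Q 3 R3 M"
          using p3 Prod(1) by (intro tail) auto
      qed (use R M Prod g1 in simp_all)
    show ?thesis
    proof (rule wp_Cond[where T = "21 * BQ + 6"])
      show "wp w (Cond 30 2 sum_prog prod_prog) (\<lambda>R M. wp w tl Q 3 R M) (21 * BQ + 6) (R(37 := 0)) M"
        by (rule wp_Cond[where T = "21 * BQ + 4"]) (use g1 R' prod in simp_all)
    qed (use g1 R' in simp_all)
  qed
  then have c: "wp w (Cond 30 1 var_prog (Cond 30 2 sum_prog prod_prog) ;; tl) Q (21 * BQ + 11) (R(37 := 0)) M"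
    by (rule wp_Seq) simp
  have "wp w (Blk [ADD 37 0 0]) (\<lambda>R M. wp w (Cond 30 1 var_prog (Cond 30 2 sum_prog prod_prog) ;; tl) Q
      (21 * BQ + 11) R M) 1 R M"
    using R' c by (intro wp_Blk) (simp_all del: One_nat_def)
  then show ?thesis unfolding entry_prog_def tl_def by (rule wp_Seq) simp
qed

definition "colour_time = 2 * k * (13 * q + 26) + 19"
definition "gate_time = 45 + colour_time + BQ * (21 * BQ + 14)"
definition "table_time = s * (gate_time + 3) + 3"
definition "search_time = BQ * 15 + 6"
definition "guess_time = G * (table_time + search_time + 5) + 4"

lemma wp_gate:
  assumes R: "const_regs R" "R 25 = g" "R 28 = p" and g: "g < G" and p: "p < s"
    and M: "static M" "table g M p"
    and Q: "\<And>R' M'. pres 29 R R' \<Longrightarrow> frame M M' \<Longrightarrow> static M' \<Longrightarrow> table g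
        M' (Suc p) \<Longrightarrow> Q R' M'"
  shows "wp w gate_prog Q gate_time R M"
proof -
  have pl: "p < length C" using p by (simp add: s_def)
  have idx: "i * BQ \<le> Z" if "i < n \<or> i < s" for i
    using that bounds(16,17) by (meson le_trans less_imp_le mult_le_mono1)
  define prep where "prep = [MULT 29 28 15, ADD 29 29 20, MULT 34 32 15, ADD 34 34 20, MULT 35 33 15, ADD 35 35 20, ADD 36 0 0]"
  define T3 where "T3 = BQ * (21 * BQ + 14) + 2"
  have loop: "wp w (Loop 36 15 entry_prog) Q T3 R3 M"
    if R3: "pres 29 R R3" "gate_regs (C ! p) R3" "R3 29 = aT + p * BQ" "R3 34 = aT + R3 32 * BQ" "R3 35 = aT + R3 33 * BQ"
      "R3 36 = 0" "\<And>i. C ! p = Var i \<Longrightarrow> R3 46 = colour g i" for R3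
  proof -
    define I where "I j R' M' \<longleftrightarrow> pres 36 R3 R' \<and> frame M M' \<and> static M' \<and> table g M' p
        \<and> R' 36 + j = BQ \<and>
        (\<forall>u<R' 36. entry_ok g p u (M' (aT + p * BQ + u))) \<and> (\<forall>i. C ! p = Var i \<longrightarrow> R'
            46 = colour g i)" for j R' M'
    show ?thesis
    proof (rule wp_Loop[where I = I and Tb = "21 * BQ + 12" and V = BQ])
      show "I BQ R3 M" using R3 M frame_refl by (simp add: I_def)
      show "Q R' M'" if I: "I v R' M'" "\<not> R' 36 < R' 15" for v R' M'
      proof -
        have p36: "pres 36 R3 R'" using I by (simp add: I_def)
        have "R' 15 = BQ" using presD[OF p36, of 15] presD[OF R3(1), of 15] R(1) by (simp add: const_regs_def)
        then have e: "R' 36 = BQ" using I by (auto simp: I_def)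
        have "table g M' (Suc p)" using I(1) e by (auto simp: I_def table_def less_Suc_eq)
        moreover have "pres 29 R R'" using R3(1) p36 by (rule pres_trans) simp
        ultimately show ?thesis using I(1) Q by (simp add: I_def)
      qed
      show "wp w entry_prog (\<lambda>R M. \<exists>v'<v. I v' R M) (21 * BQ + 12) R' M'"
        if I: "I v R' M'" and lt: "R' 36 < R' 15" for v R' M'
      proof -
        have p36: "pres 36 R3 R'" using I by (simp add: I_def)
        have p29: "pres 29 R R'" using R3(1) p36 by (rule pres_trans) simp
        have c: "const_regs R'" using R(1) p29 by (rule const_regs_pres) simp
        have u: "R' 36 < BQ" using lt c by (simp add: const_regs_def)
        have gr: "gate_regs (C ! p) R'" using R3(2) presD[OF p36] by (simp add: gate_regs_def split: gate.splits)
        show ?thesis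
        proof (rule wp_entry[where g = g and p = p and u = "R' 36"])
          fix R4 v' assume R4: "pres 36 R' R4" "R4 36 = R' 36 + 1" "\<forall>i. C ! p = Var i \<longrightarrow> R4 46 = R' 46"
            and e: "entry_ok g p (R' 36) v'"
          let ?M = "M'(aT + p * BQ + R' 36 := v')"
          have "frame M' ?M" using frame_entry p u by blast
          then have "frame M ?M" "static ?M" using I frame_trans static_frame by (auto simp: I_def)
          moreover have "table g ?M p" using I u by (intro table_upd) (auto simp: I_def)
          moreover have "pres 36 R3 R4" using p36 R4(1) by (rule pres_trans) simp
          moreover have "\<forall>x<R4 36. entry_ok g p x (?M (aT + p * BQ + x))"
            using I e R4(2) by (auto simp: I_def less_Suc_eq)
          ultimately have "I (v - 1) R4 ?M" using I R4 u by (auto simp: I_def)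
          moreover have "v - 1 < v" using I u by (auto simp: I_def)
          ultimately show "\<exists>v''<v. I v'' R4 ?M" by blast
        qed (use c u gr R3 presD[OF p36] I p g in \<open>auto simp: I_def\<close>)
      qed
    qed (simp add: T3_def)
  qed
  have mid: "wp w (Blk prep ;; Loop 36 15 entry_prog) Q (T3 + 7) R2 M"
    if R2: "pres 29 R R2" "gate_regs (C ! p) R2" "\<And>i. C ! p = Var i \<Longrightarrow> R2 46 = colour g i" for R2
  proof -
    \<comment> \<open>At a leaf, registers \<open>32\<close> and \<open>33\<close> hold a variable
      number instead of a gate number. The row addresses are computed all the same, so they must fit
      into a word in both cases.\<close>
    have "R2 32 < n \<or> R2 32 < s" "R2 33 < n \<or> R2 33 < s"
      using pl p R2(2) by (cases rule: gate_cases; auto simp: gate_regs_def union_gate_def)+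
    then have ab: "R2 32 * BQ \<le> Z" "R2 33 * BQ \<le> Z" using idx by blast+
    have pB: "p * BQ \<le> Z" using idx p by blast
    have b: "p * BQ \<le> w" "R2 32 * BQ \<le> w" "R2 33 * BQ \<le> w" "p * BQ + aT \<le> w" "R2 32 * BQ + aT \<le> w"
        "R2 33 * BQ + aT \<le> w"
      using ab pB addr by (intro w_small; linarith)+
    have c: "const_regs R2" using R(1) R2(1) by (rule const_regs_pres) simp
    have "wp w (Blk prep) (\<lambda>R M. wp w (Loop 36 15 entry_prog) Q T3 R M) 7 R2 M"
      unfolding prep_def
      by (rule wp_Blk)
        (use c[unfolded const_regs_def] b presD[OF R2(1), of 28] R(3) R2 loop in
          \<open>simp_all add: add.commute gate_regs_def del: One_nat_def cong: gate.case_cong\<close>)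
    then show ?thesis by (rule wp_Seq) simp
  qed
  have cnd: "wp w (Cond 30 1 (Blk [ADD 40 32 0] ;; colour_prog) (Blk []) ;; Blk prep ;; Loop 36 15 entry_prog) Q
      (colour_time + 3 + (T3 + 7)) R1 M"
    if R1: "pres 29 R R1" "gate_regs (C ! p) R1" for R1
  proof -
    have c: "const_regs R1" using R(1) R1(1) by (rule const_regs_pres) simp
    note c' = c[unfolded const_regs_def]
    have "wp w (Cond 30 1 (Blk [ADD 40 32 0] ;; colour_prog) (Blk []))
        (\<lambda>R M. wp w (Blk prep ;; Loop 36 15 entry_prog) Q (T3 + 7) R M) (colour_time + 3) R1 M"
    proof (cases "\<exists>i. C ! p = Var i")
      case True
      then obtain i where i: "C ! p = Var i" by blast
      have ri: "R1 30 = 0" "R1 32 = i" "R1 33 = i" using R1(2) i by (simp_all add: gate_regs_def)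
      have iN: "i < n" using gmonos_Var(1)[OF pl i] .
      have iw: "i \<le> w" using iN bounds(5) by (intro w_small) linarith
      show ?thesis
      proof (rule wp_Cond[where T = "colour_time + 1"])
        have col: "wp w colour_prog (\<lambda>R M. wp w (Blk prep ;; Loop 36 15 entry_prog) Q (T3 + 7) R M) colour_time
            (R1(40 := i)) M"
          unfolding colour_time_def
        proof (rule wp_colour)
          show "(R1(40 := i)) 25 < G" "(R1(40 := i)) 40 < n" "const_regs (R1(40 := i))"
            using presD[OF R1(1), of 25] R(2) g iN c by simp_all
          fix R2 assume R2: "pres 41 (R1(40 := i)) R2" "R2 46 = colour ((R1(40 := i)) 25) ((R1(40 := i)) 40)"
          have "pres 29 R1 R2" using R2(1) by (auto simp: pres_def)
          then have "pres 29 R R2" using R1(1) pres_trans by blast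
          moreover have "gate_regs (C ! p) R2" using R1(2) presD[OF R2(1)] i by (simp add: gate_regs_def)
          moreover have "R2 46 = colour g i" using R2(2) presD[OF R1(1), of 25] R(2) by simp
          ultimately show "wp w (Blk prep ;; Loop 36 15 entry_prog) Q (T3 + 7) R2 M"
            using i by (intro mid) auto
        qed
        have "wp w (Blk [ADD 40 32 0]) (\<lambda>R M. wp w colour_prog (\<lambda>R M. wp w (Blk prep ;; Loop 36 15
            entry_prog) Q (T3 + 7) R M) colour_time R M) 1 R1 M"
          by (rule wp_Blk) (use c' ri iw col in \<open>simp_all del: One_nat_def\<close>)
        then show "wp w (Blk [ADD 40 32 0] ;; colour_prog) (\<lambda>R M. wp w (Blk prep ;; Loop 36 15 entry_prog) Q (T3
            + 7) R M) (colour_time + 1) R1 M"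
          by (rule wp_Seq) simp
      qed (use c' ri in simp_all)
    next
      case False
      with pl have "0 < R1 30" using R1(2) by (cases rule: gate_cases) (auto simp: gate_regs_def union_gate_def)
      then have nv: "\<not> R1 30 < R1 1" using c' by simp
      show ?thesis
        by (rule wp_Cond[where T = "colour_time + 1"]; (rule wp_Blk)?) (use nv False R1 mid in auto)
    qed
    then show ?thesis by (rule wp_Seq) simp
  qed
  have "wp w load_prog (\<lambda>R M. wp w (Cond 30 1 (Blk [ADD 40 32 0] ;; colour_prog) (Blk []) ;; Blk prep ;; Loop 36
      15 entry_prog) Q
      (colour_time + 3 + (T3 + 7)) R M) 15 R M"
  proof (rule wp_load)
    show "\<forall>j<5 + 4 * s. M j = input ! j" using M(1) by (simp add: static_def)
    fix R1 assume "\<And>i. i \<notin> {30, 31, 32, 33, 60, 61} \<Longrightarrow> R1 i = R i" "gate_regs (C ! R 28) R1"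
    then show "wp w (Cond 30 1 (Blk [ADD 40 32 0] ;; colour_prog) (Blk []) ;; Blk prep ;; Loop 36 15 entry_prog) Q
      (colour_time + 3 + (T3 + 7)) R1 M" using R(3) by (intro cnd) (auto simp: pres_def)
  qed (use R p in auto)
  then show ?thesis
    unfolding gate_prog_def prep_def by (rule wp_Seq) (simp add: gate_time_def T3_def)
qed

lemma wp_table:
  assumes R: "const_regs R" "R 25 = g" and g: "g < G" and M: "static M"
    and Q: "\<And>R' M'. pres 28 R R' \<Longrightarrow> frame M M' \<Longrightarrow> static M' \<Longrightarrow> table g
        M' s \<Longrightarrow> Q R' M'"
  shows "wp w table_prog Q table_time R M"
proof -
  define I where "I j R' M' \<longleftrightarrow> pres 28 R R' \<and> frame M M' \<and> static M' \<and> table g M' (R'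
      28) \<and> R' 28 + j = s" for j R' M'
  define T2 where "T2 = s * (gate_time + 3) + 2"
  have loop: "wp w (Loop 28 6 (gate_prog ;; Blk [ADD 28 28 1])) Q T2 (R(28 := 0)) M"
  proof (rule wp_Loop[where I = I and Tb = "gate_time + 1" and V = s])
    show "I s (R(28 := 0)) M" using M frame_refl by (simp add: I_def table_def)
    show "Q R' M'" if I: "I v R' M'" "\<not> R' 28 < R' 6" for v R' M'
    proof -
      have p28: "pres 28 R R'" using I by (simp add: I_def)
      have "R' 6 = s" using presD[OF p28, of 6] R(1) by (simp add: const_regs_def)
      then have "R' 28 = s" using I by (auto simp: I_def)
      then show ?thesis using I Q by (simp add: I_def)
    qed
    show "wp w (gate_prog ;; Blk [ADD 28 28 1]) (\<lambda>R M. \<exists>v'<v. I v' R M) (gate_time + 1) R' M'"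
      if I: "I v R' M'" and lt: "R' 28 < R' 6" for v R' M'
    proof -
      have p28: "pres 28 R R'" using I by (simp add: I_def)
      have c: "const_regs R'" using R(1) p28 by (rule const_regs_pres) simp
      have ps: "R' 28 < s" using lt c by (simp add: const_regs_def)
      have "wp w gate_prog (\<lambda>R M. wp w (Blk [ADD 28 28 1]) (\<lambda>R M. \<exists>v'<v. I v' R M) 1 R M) gate_time R' M'"
      proof (rule wp_gate[where g = g and p = "R' 28"])
        fix R2 M2 assume 2: "pres 29 R' R2" "frame M' M2" "static M2" "table g M2 (Suc (R' 28))"
        have e: "R2 28 = R' 28" "R2 1 = 1" using presD[OF 2(1)] c by (simp_all add: const_regs_def)
        have b: "R' 28 + 1 \<le> w" using ps bounds(4) by (intro w_small) linarith
        have "pres 28 R R2" using p28 2(1) by (rule pres_trans) simp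
        moreover have "frame M M2" using I 2(2) frame_trans by (auto simp: I_def)
        ultimately have "I (v - 1) (R2(28 := R' 28 + 1)) M2"
          using 2 I ps by (simp add: I_def)
        moreover have "v - 1 < v" using I ps by (auto simp: I_def)
        ultimately have "\<exists>v'<v. I v' (R2(28 := R' 28 + 1)) M2" by blast
        then show "wp w (Blk [ADD 28 28 1]) (\<lambda>R M. \<exists>v'<v. I v' R M) 1 R2 M2"
          using e b by (intro wp_Blk) (simp_all del: One_nat_def)
      qed (use c g ps I presD[OF p28, of 25] R(2) in \<open>auto simp: I_def\<close>)
      then show ?thesis by (rule wp_Seq) simp
    qed
  qed (simp add: T2_def algebra_simps)
  have "wp w (Blk [ADD 28 0 0]) (\<lambda>R M. wp w (Loop 28 6 (gate_prog ;; Blk [ADD 28 28 1])) Q T2 R M) 1 R M"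
    using R(1)[unfolded const_regs_def] loop by (intro wp_Blk) (simp_all del: One_nat_def)
  then show ?thesis unfolding table_prog_def by (rule wp_Seq) (simp add: table_time_def T2_def)
qed

definition found :: "nat \<Rightarrow> nat \<Rightarrow> bool" where
  "found g u \<longleftrightarrow> u < BQ \<and> reaches g out u \<and> digsum B u = k"

lemma wp_search:
  assumes R: "const_regs R" and M: "static M" "table g M s"
    and Q: "\<And>R'. pres 26 R R' \<Longrightarrow> R' 26 = 1 \<and> found g (R' 27) \<or> R' 26 = 0 \<and> (\<forall>u.
        \<not> found g u) \<Longrightarrow> Q R' M"
  shows "wp w search_prog Q search_time R M"
proof -
  note R' = R[unfolded const_regs_def]
  define I where "I j R' M' \<longleftrightarrow> M' = M \<and> pres 26 R R' \<and> R' 29 = aT + out * BQ \<and> R' 36 +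
      j = BQ \<and>
      (R' 26 = 1 \<and> found g (R' 27) \<or> R' 26 = 0 \<and> (\<forall>u<R' 36. \<not> found g u))" for j R' M'
  have oB: "out * BQ \<le> Z" using out bounds(16) unfolding s_def
    by (meson le_trans less_imp_le mult_le_mono1)
  have body: "wp w search_body (\<lambda>R M. \<exists>v'<v. I v' R M) 13 R' M'" if I: "I v R' M'" and lt: "R' 36 < R'
      15" for v R' M'
  proof (rule wp_wpc)
    note I' = I[unfolded I_def]
    have p26: "pres 26 R R'" using I' by simp
    have c: "const_regs R'" using R p26 by (rule const_regs_pres) simp
    note c' = c[unfolded const_regs_def]
    define u where "u = R' 36"
    have u: "u < BQ" using lt c' by (simp add: u_def)
    define t where "t = M (aT + out * BQ + u)"
    have "entry_ok g out u t" unfolding t_def using tableD[OF M(2) _ u] out by (simp add: s_def)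
    then have t: "0 < t \<longleftrightarrow> reaches g out u" by (simp add: entry_ok_def)
    have S: "M (aS + u) = digsum B u" using M(1) u by (rule staticD)
    have b: "aT + out * BQ + u \<le> w" "aS + u \<le> w" "u + 1 \<le> w" "u \<le> w" "1 \<le> w"
      using oB u bounds(1,3) addr by (intro w_small; linarith)+
    have v: "v - 1 < v" using I' u by (auto simp: u_def)
    have nxt: "\<exists>v'<v. I v' R'' M"
      if "pres 26 R R''" "R'' 29 = aT + out * BQ" "R'' 36 = u + 1"
        "if found g u then R'' 26 = 1 \<and> R'' 27 = u else R'' 26 = R' 26 \<and> R'' 27 = R' 27" for R''
    proof (intro exI[of _ "v - 1"] conjI v)
      show "I (v - 1) R'' M"
        unfolding I_def using that I' u by (auto simp: u_def less_Suc_eq split: if_splits)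
    qed
    have f: "found g u \<longleftrightarrow> 0 < t \<and> \<not> digsum B u < k \<and> \<not> k < digsum B u"
      using t u by (auto simp: found_def)
    show "wpc w search_body (\<lambda>R M. \<exists>v'<v. I v' R M) R' M'"
      using I' c' b S f
      by (simp add: search_body_def u_def[symmetric] t_def[symmetric] nxt del: One_nat_def)
  qed (simp add: search_body_def)
  define T2 where "T2 = BQ * 15 + 2"
  have loop: "wp w (Loop 36 15 search_body) Q T2 R1 M"
    if R1: "pres 26 R R1" "R1 29 = aT + out * BQ" "R1 36 = 0" "R1 26 = 0" for R1
  proof (rule wp_Loop[where I = I and Tb = 13 and V = BQ])
    show "I BQ R1 M" using R1 by (simp add: I_def)
    show "Q R' M'" if I: "I v R' M'" "\<not> R' 36 < R' 15" for v R' M'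
    proof -
      have p26: "pres 26 R R'" using I by (simp add: I_def)
      have "R' 15 = BQ" using presD[OF p26, of 15] R by (simp add: const_regs_def)
      then have "R' 36 = BQ" using I by (auto simp: I_def)
      then have "R' 26 = 1 \<and> found g (R' 27) \<or> R' 26 = 0 \<and> (\<forall>u. \<not> found g u)"
        using I by (auto simp: I_def found_def)
      then show ?thesis using I Q p26 by (simp add: I_def)
    qed
  qed (use body in \<open>auto simp: T2_def\<close>)
  have b: "out * BQ \<le> w" "out * BQ + aT \<le> w" using oB addr by (intro w_small; linarith)+
  have "wp w (Blk [ADD 26 0 0, ADD 36 0 0, MULT 29 7 15, ADD 29 29 20]) (\<lambda>R M. wp w (Loop 36 15 search_body) Q T2
      R M) 4 R M"
    by (rule wp_Blk) (use R' b loop in \<open>simp_all add: add.commute del: One_nat_def\<close>)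
  then show ?thesis unfolding search_prog_def by (rule wp_Seq) (simp add: search_time_def T2_def)
qed

lemma wp_guess:
  assumes R: "const_regs R" "R 24 = G" and M: "static M"
    and Q: "\<And>R' M' g. pres 24 R R' \<Longrightarrow> frame M M' \<Longrightarrow> static M' \<Longrightarrow>
      R' 26 = 1 \<and> g < G \<and> table g M' s \<and> found g (R' 27) \<or> R' 26 = 0 \<and> (\<forall>g<G. \<forall>u.
          \<not> found g u) \<Longrightarrow> Q R' M'"
  shows "wp w guess_prog Q guess_time R M"
proof -
  note R' = R(1)[unfolded const_regs_def]
  define I where "I j R' M' \<longleftrightarrow> pres 24 R R' \<and> frame M M' \<and> static M' \<and>
      (R' 24 = 0 \<and> R' 26 = 1 \<and> (\<exists>g<G. table g M' s \<and> found g (R' 27)) \<or>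
       R' 24 = G \<and> R' 26 = 0 \<and> R' 25 + j = G \<and> (\<forall>g<R' 25. \<forall>u. \<not> found g u))" for j R' M'
  define tl where "tl = Cond 0 26 (Blk [ADD 24 0 0]) (Blk [ADD 25 25 1])"
  define T2 where "T2 = G * (table_time + search_time + 5) + 2"
  have loop: "wp w (Loop 25 24 (table_prog ;; search_prog ;; tl)) Q T2 (R(25 := 0, 26 := 0)) M"
  proof (rule wp_Loop[where I = I and Tb = "table_time + search_time + 3" and V = G])
    show "I G (R(25 := 0, 26 := 0)) M" using M frame_refl R by (simp add: I_def)
    show "Q R' M'" if I: "I v R' M'" "\<not> R' 25 < R' 24" for v R' M'
    proof -
      have "pres 24 R R'" "frame M M'" "static M'" using I by (auto simp: I_def)
      moreover have "\<exists>g. R' 26 = 1 \<and> g < G \<and> table g M' s \<and> found g (R' 27) \<or> R' 26 = 0 \<and>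
          (\<forall>g<G. \<forall>u. \<not> found g u)"
        using I by (auto simp: I_def)
      ultimately show ?thesis using Q by blast
    qed
    show "wp w (table_prog ;; search_prog ;; tl) (\<lambda>R M. \<exists>v'<v. I v' R M) (table_time + search_time + 3) R' M'"
      if I: "I v R' M'" and lt: "R' 25 < R' 24" for v R' M'
    proof -
      define g where "g = R' 25"
      have p24: "pres 24 R R'" "frame M M'" "static M'" using I by (auto simp: I_def)
      have c: "const_regs R'" using R(1) p24(1) by (rule const_regs_pres) simp
      have g: "g < G" "R' 24 = G" "g + v = G" "\<forall>g'<g. \<forall>u. \<not> found g' u" using I lt by (auto simp:
          I_def g_def)
      have v: "v - 1 < v" using g by simp
      have "wp w table_prog (\<lambda>R M. wp w (search_prog ;; tl) (\<lambda>R M. \<exists>v'<v. I v' R M) (search_time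
          + 3) R M) table_time R' M'"
      proof (rule wp_table[where g = g])
        fix R2 M2 assume 2: "pres 28 R' R2" "frame M' M2" "static M2" "table g M2 s"
        have c2: "const_regs R2" using c 2(1) by (rule const_regs_pres) simp
        have fr: "frame M M2" using p24(2) 2(2) by (rule frame_trans)
        have "wp w search_prog (\<lambda>R M. wp w tl (\<lambda>R M. \<exists>v'<v. I v' R M) 3 R M) search_time R2 M2"
        proof (rule wp_search[where g = g])
          fix R3 assume 3: "pres 26 R2 R3" "R3 26 = 1 \<and> found g (R3 27) \<or> R3 26 = 0 \<and> (\<forall>u. \<not>
              found g u)"
          have c3: "const_regs R3" using c2 3(1) by (rule const_regs_pres) simp
          note c3' = c3[unfolded const_regs_def]
          have e: "R3 24 = G" "R3 25 = g" using presD[OF 3(1)] presD[OF 2(1)] g(2) by (simp_all add: g_def)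
          have p3: "pres 24 R R3" using pres_trans[OF pres_trans[OF p24(1) 2(1)] 3(1)] by simp
          have b: "g + 1 \<le> w" using g(1) bounds(2) by (intro w_small) linarith
          show "wp w tl (\<lambda>R M. \<exists>v'<v. I v' R M) 3 R3 M2"
            using 3(2)
          proof (elim disjE conjE)
            assume f: "R3 26 = 1" "found g (R3 27)"
            have "I (v - 1) (R3(24 := 0)) M2" using p3 fr 2 f g(1) by (auto simp: I_def)
            then have "\<exists>v'<v. I v' (R3(24 := 0)) M2" using v by blast
            then show ?thesis unfolding tl_def
              using c3' f by (intro wp_wpc) (simp_all del: One_nat_def)
          next
            assume f: "R3 26 = 0" "\<forall>u. \<not> found g u"
            have "I (v - 1) (R3(25 := g + 1)) M2" using p3 fr 2 f g e v by (auto simp: I_def less_Suc_eq)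
            then have "\<exists>v'<v. I v' (R3(25 := g + 1)) M2" using v by blast
            then show ?thesis unfolding tl_def
              using c3' f b e by (intro wp_wpc) (simp_all del: One_nat_def)
          qed
        qed (use c2 2 in auto)
        then show "wp w (search_prog ;; tl) (\<lambda>R M. \<exists>v'<v. I v' R M) (search_time + 3) R2 M2" by (rule wp_Seq) simp
      qed (use c g p24 in \<open>auto simp: g_def\<close>)
      then show ?thesis by (rule wp_Seq) simp
    qed
  qed (simp add: T2_def)
  have "wp w (Blk [ADD 25 0 0, ADD 26 0 0]) (\<lambda>R M. wp w (Loop 25 24 (table_prog ;; search_prog ;; tl)) Q T2 R M) 2 R M"
    using R' loop by (intro wp_Blk) (simp_all del: One_nat_def)
  then show ?thesis unfolding guess_prog_def tl_def by (rule wp_Seq) (simp add: guess_time_def T2_def)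
qed

section \<open>Traceback of a witness monomial\<close>

definition "realizes' g = coloured_circuit.realizes n C B (colour g)"

text \<open>Passing to a child keeps the degree and lowers the gate number; a product splits the
  degree between children of lower number. So this potential falls from at most
  \<open>k * s\<close>. It bounds the number of steps, the stack height and the exponents, even if
  gates are visited repeatedly.\<close>

definition pot :: "(nat \<times> nat) list \<Rightarrow> nat" where
  "pot st = (\<Sum>(p, u)\<leftarrow>st. digsum B u * (p + 1))"

lemma pot_simps [simp]: "pot [] = 0" "pot ((p, u) # st) = digsum B u * (p + 1) + pot st" "pot (st @ st') = pot st + pot st'"
  by (simp_all add: pot_def)

text \<open>Invariant of the traceback: completing the exponents \<open>E\<close> collected so far by arbitrary monomials for
  the pairs of gates and codes on the stack \<open>st\<close> always gives a monomial for the output.\<close>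

definition pending :: "nat \<Rightarrow> nat \<Rightarrow> monomial \<Rightarrow> (nat \<times> nat) list \<Rightarrow>
    bool" where
  "pending g u0 E st \<longleftrightarrow>
     (\<forall>(p, u)\<in>set st. p < s \<and> reaches g p u) \<and>
     (\<forall>ms. list_all2 (\<lambda>(p, u) m. realizes' g p u m) st ms \<longrightarrow> realizes' g out u0 (E +
         sum_list ms)) \<and>
     (\<forall>i<n. Poly_Mapping.lookup E i + pot st \<le> k * s) \<and> length st + pot st \<le> 1 + k * s"

lemma pending_Var:
  assumes t: "pending g u0 E (st @ [(p, u)])" and v: "C ! p = Var i" and g: "g < G"
  shows "pending g u0 (E + Poly_Mapping.single i 1) st" "pot st < pot (st @ [(p, u)])"
proof -
  interpret coloured_circuit n C B q "colour g" using g by (rule coloured)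
  have rl: "realizes' g = realizes" "reaches g = reach" by (simp_all add: realizes'_def reaches_def)
  have p: "p < length C" "reach p u" using t by (auto simp: pending_def rl s_def)
  have r: "realizes p u (Poly_Mapping.single i 1)"
    using reach_Var[OF p(1) v] p(2) by simp
  have d: "0 < digsum B u" using reach_pos[OF p(2,1)] .
  show lt: "pot st < pot (st @ [(p, u)])" using d by simp
  show "pending g u0 (E + Poly_Mapping.single i 1) st"
    unfolding pending_def
  proof (intro conjI allI impI)
    fix ms assume "list_all2 (\<lambda>(p, u) m. realizes' g p u m) st ms"
    then have "list_all2 (\<lambda>(p, u) m. realizes' g p u m) (st @ [(p, u)]) (ms @ [Poly_Mapping.single i 1])"
      using r by (auto simp: rl intro!: list_all2_appendI)
    then have "realizes' g out u0 (E + sum_list (ms @ [Poly_Mapping.single i 1]))" using t by (auto simp: pending_def)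
    then show "realizes' g out u0 (E + Poly_Mapping.single i 1 + sum_list ms)" by (simp add: ac_simps)
  next
    fix j assume j: "j < n"
    have "Poly_Mapping.lookup E j + pot (st @ [(p, u)]) \<le> k * s" using t j unfolding pending_def by blast
    moreover have "Poly_Mapping.lookup (E + Poly_Mapping.single i 1) j \<le> Poly_Mapping.lookup E j + 1"
      by (simp add: lookup_add lookup_single when_def)
    ultimately show "Poly_Mapping.lookup (E + Poly_Mapping.single i 1) j + pot st \<le> k * s" using lt by linarith
  next
    have "length (st @ [(p, u)]) + pot (st @ [(p, u)]) \<le> 1 + k * s" using t unfolding pending_def by blast
    then show "length st + pot st \<le> 1 + k * s" using lt by simp
  qed (use t in \<open>auto simp: pending_def\<close>)
qed

text \<open>One rewriting step at the top of the stack: the monomials for \<open>new\<close> are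
  summed to one monomial for the replaced pair. The premise
  \<open>length new + pot new \<le> pot [(p, u)]\<close> pays for the potential and for the stack
  height at once.\<close>

lemma pending_replace:
  assumes t: "pending g u0 E (st @ [(p, u)])" and g: "g < G"
    and new: "\<forall>(p', u')\<in>set new. p' < s \<and> reaches g p' u'"
    and re: "\<And>ms. list_all2 (\<lambda>(p, u) m. realizes' g p u m) new ms \<Longrightarrow> realizes' g p u (sum_list ms)"
    and lt: "length new + pot new \<le> pot [(p, u)]" "new \<noteq> []"
  shows "pending g u0 E (st @ new)" "pot (st @ new) < pot (st @ [(p, u)])"
proof -
  show lt': "pot (st @ new) < pot (st @ [(p, u)])" using lt by (cases new) auto
  show "pending g u0 E (st @ new)"
    unfolding pending_def
  proof (intro conjI allI impI)
    fix ms assume "list_all2 (\<lambda>(p, u) m. realizes' g p u m) (st @ new) ms"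
    then obtain ms1 ms2 where ms: "ms = ms1 @ ms2" "list_all2 (\<lambda>(p, u) m. realizes' g p u m) st ms1"
      "list_all2 (\<lambda>(p, u) m. realizes' g p u m) new ms2" by (auto simp: list_all2_append1)
    then have "list_all2 (\<lambda>(p, u) m. realizes' g p u m) (st @ [(p, u)]) (ms1 @ [sum_list ms2])"
      using re by (auto intro!: list_all2_appendI)
    then have "realizes' g out u0 (E + sum_list (ms1 @ [sum_list ms2]))" using t by (auto simp: pending_def)
    then show "realizes' g out u0 (E + sum_list ms)" by (simp add: ms(1))
  next
    fix j assume j: "j < n"
    have "Poly_Mapping.lookup E j + pot (st @ [(p, u)]) \<le> k * s" using t j unfolding pending_def by blast
    then show "Poly_Mapping.lookup E j + pot (st @ new) \<le> k * s" using lt' by linarith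
  next
    have "length (st @ [(p, u)]) + pot (st @ [(p, u)]) \<le> 1 + k * s" using t unfolding pending_def by blast
    then show "length (st @ new) + pot (st @ new) \<le> 1 + k * s" using lt(1) by simp
  qed (use t new in \<open>auto simp: pending_def\<close>)
qed

lemma pending_child:
  assumes t: "pending g u0 E (st @ [(p, u)])" and g: "g < G"
    and c: "c < p" "reaches g c u" "\<And>m. realizes' g c u m \<Longrightarrow> realizes' g p u m"
  shows "pending g u0 E (st @ [(c, u)])" "pot (st @ [(c, u)]) < pot (st @ [(p, u)])"
proof -
  interpret coloured_circuit n C B q "colour g" using g by (rule coloured)
  have rl: "realizes' g = realizes" "reaches g = reach" by (simp_all add: realizes'_def reaches_def)
  have p: "p < length C" "reach p u" using t by (auto simp: pending_def rl s_def)
  have d: "0 < digsum B u" using reach_pos[OF p(2,1)] .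
  have "digsum B u * Suc (c + 1) \<le> digsum B u * (p + 1)" using c(1) by (intro mult_le_mono2) simp
  then have "length [(c, u)] + pot [(c, u)] \<le> pot [(p, u)]" using d by simp
  note pr = pending_replace[OF t g _ _ this]
  show "pending g u0 E (st @ [(c, u)])" "pot (st @ [(c, u)]) < pot (st @ [(p, u)])"
    using c p(1) by (intro pr; auto simp: list_all2_Cons1 s_def)+
qed

lemma pending_Prod:
  assumes t: "pending g u0 E (st @ [(p, u)])" and v: "C ! p = Prod [a, b]" and g: "g < G"
    and x: "x \<le> u" "split_ok g a b u x"
  shows "pending g u0 E (st @ [(a, x), (b, u - x)])" "pot (st @ [(a, x), (b, u - x)]) < pot (st @ [(p, u)])"
proof -
  interpret coloured_circuit n C B q "colour g" using g by (rule coloured)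
  have rl: "realizes' g = realizes" "reaches g = reach" by (simp_all add: realizes'_def reaches_def)
  have p: "p < length C" "reach p u" using t by (auto simp: pending_def rl s_def)
  have ab: "a < p" "b < p" using gmonos_Prod(1,2)[OF p(1) v] .
  have x': "reach a x" "reach b (u - x)" "digsum B x + digsum B (u - x) \<le> digsum B u"
    using x(2) by (simp_all add: split_ok_def rl)
  \<comment> \<open>Both parts have positive digit sum, so \<open>digsum B u\<close> is at least
    two. Since both children have numbers below \<open>p\<close>, this surplus pays for the two new
    stack entries.\<close>
  have d: "0 < digsum B x" "0 < digsum B (u - x)"
    using reach_pos x' ab p(1) by (meson order.strict_trans)+
  have "digsum B x * (a + 1) + digsum B (u - x) * (b + 1) \<le> digsum B x * p + digsum B (u - x) * p"
    using ab by (intro add_mono mult_le_mono2) auto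
  also have "\<dots> = (digsum B x + digsum B (u - x)) * p" by (simp add: add_mult_distrib)
  also have "\<dots> \<le> digsum B u * p" using x'(3) by (rule mult_le_mono1)
  finally have "length [(a, x), (b, u - x)] + pot [(a, x), (b, u - x)] \<le> pot [(p, u)]"
    using d x'(3) by simp
  note pr = pending_replace[OF t g _ _ this]
  have re: "realizes' g p u (sum_list ms)" if ms: "list_all2 (\<lambda>(p, u) m. realizes' g p u m) [(a, x), (b, u - x)]
      ms" for ms
  proof -
    obtain m1 m2 where "ms = [m1, m2]" "realizes a x m1" "realizes b (u - x) m2"
      using ms by (auto simp: list_all2_Cons1 rl)
    then show ?thesis using realizes_Prod[OF p(1) v, of x m1 "u - x" m2] x(1) x'(3) by (simp add: rl)
  qed
  show "pending g u0 E (st @ [(a, x), (b, u - x)])" "pot (st @ [(a, x), (b, u - x)]) < pot (st @ [(p, u)])"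
    using x' ab p(1) re by (intro pr; auto simp: rl s_def)+
qed

definition stack :: "(nat \<Rightarrow> nat) \<Rightarrow> (nat \<times> nat) list \<Rightarrow> bool" where
  "stack M st \<longleftrightarrow> (\<forall>j<length st. M (j + j + aK) = fst (st ! j) \<and> M (j + j + aK + 1) = snd
      (st ! j))"

lemma stack_snoc:
  "stack M (st @ [(p, u)]) \<longleftrightarrow>
     stack M st \<and> M (length st + length st + aK) = p \<and> M (length st + length st + aK + 1) = u"
  by (auto simp: stack_def nth_append less_Suc_eq)

lemma stack_upd:
  assumes "x < aK \<or> length st + length st + aK \<le> x" shows "stack (M(x := v)) st \<longleftrightarrow> stack M st"
proof -
  have "j + j + aK \<noteq> x \<and> j + j + aK + 1 \<noteq> x" if "j < length st" for j
    using that assms by auto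
  then show ?thesis by (auto simp: stack_def)
qed

definition "trace_time = 43 * (k * s) + 6"
definition "output_time = 7 * n + 4"

lemma wp_trace:
  assumes R: "const_regs R" "R 27 = u0" and g: "g < G" "found g u0"
    and M: "static M" "table g M s" "\<forall>i<n. M (aE + i) = 0"
    and Q: "\<And>R' M' m. pres 23 R R' \<Longrightarrow> realizes' g out u0 m \<Longrightarrow> \<forall>i<n. M' (aE +
        i) = Poly_Mapping.lookup m i \<Longrightarrow> Q R' M'"
  shows "wp w trace_prog Q trace_time R M"
proof -
  interpret coloured_circuit n C B q "colour g" using g(1) by (rule coloured)
  have rl: "realizes' g = realizes" "reaches g = reach" by (simp_all add: realizes'_def reaches_def)
  note R' = R(1)[unfolded const_regs_def]
  define I where "I j R' M' \<longleftrightarrow> pres 23 R R' \<and> (\<forall>x<aE. M' x = M x) \<and>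
      (\<exists>st E. R' 23 = length st \<and> stack M' st \<and> (\<forall>i<n. M' (aE + i) = Poly_Mapping.lookup E i) \<and>
         pending g u0 E st \<and> pot st \<le> j)" for j R' M'
  have body: "wp w (pop_prog ;; load_prog ;; push_prog) (\<lambda>R M. \<exists>v'<v. I v' R M) 41 R1 M1"
    if I: "I v R1 M1" and lt: "R1 0 < R1 23" for v R1 M1
  proof -
    have p23: "pres 23 R R1" and MM: "\<forall>x<aE. M1 x = M x" using I by (auto simp: I_def)
    have c: "const_regs R1" using R(1) p23 by (rule const_regs_pres) simp
    note c' = c[unfolded const_regs_def]
    obtain st0 E where st0: "R1 23 = length st0" "stack M1 st0" "\<forall>i<n. M1 (aE + i) = Poly_Mapping.lookup E i"
      "pending g u0 E st0" "pot st0 \<le> v" using I by (auto simp: I_def)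
    have "st0 \<noteq> []" using lt c' st0(1) by auto
    then obtain st p u where st: "st0 = st @ [(p, u)]" by (metis rev_exhaust surj_pair)
    define l where "l = length st"
    have tp: "pending g u0 E (st @ [(p, u)])" using st0(4) st by simp
    have ps: "p < s" and rp: "reach p u" using tp by (auto simp: pending_def rl)
    have pl: "p < length C" using ps by (simp add: s_def)
    have uB: "u < BQ" using rp by (simp add: reach_def BQ_def)
    have len: "R1 23 = l + 1" using st0(1) st by (simp add: l_def)
    have sk: "stack M1 st" "M1 (l + l + aK) = p" "M1 (l + l + aK + 1) = u"
      using st0(2) unfolding st stack_snoc l_def by auto
    have lks: "l \<le> k * s" using tp by (simp add: pending_def l_def)
    have b: "l \<le> w" "l + l \<le> w" "l + l + aK \<le> w" "l + l + aK + 1 \<le> w" "l + l + aK + 2 \<le> w" "l + l +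
        aK + 3 \<le> w" "l + 1 \<le> w" "l + 2 \<le> w"
      using lks bounds(1,18) addr by (intro w_small; linarith)+
    have st1: "static M1" using M(1) MM by (simp add: static_def aE_def aT_def aS_def)
    have tb1: "table g M1 s" unfolding table_def
    proof (intro allI impI)
      fix p' u' assume pu: "p' < s" "u' < BQ"
      then have "aT + p' * BQ + u' < aE" using row_less[of p' u'] by (simp add: aE_def)
      then show "entry_ok g p' u' (M1 (aT + p' * BQ + u'))" using MM tableD[OF M(2) pu] by simp
    qed
    have rowZ: "aT + i * BQ + u \<le> w" "i * BQ \<le> w" "i * BQ + aT \<le> w" if "i < s" for i
      using row_less[OF that uB] bounds(16) addr by (intro w_small; linarith)+
    have nxt: "\<exists>v'<v. I v' R2 M2"
      if "pres 23 R R2" "R2 23 = length st2" "stack M2 st2" "\<forall>x<aE. M2 x = M x"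
        "\<forall>i<n. M2 (aE + i) = Poly_Mapping.lookup E2 i" "pending g u0 E2 st2" "pot st2 < pot (st @ [(p, u)])" for
            R2 M2 st2 E2
    proof (intro exI[of _ "pot st2"] conjI)
      show "pot st2 < v" using that(7) st0(5) st by simp
      show "I (pot st2) R2 M2" unfolding I_def using that by blast
    qed
    have E1: "\<forall>i<n. M1 (aE + i) = Poly_Mapping.lookup E i" by (rule st0(3))
    have aEK: "aE + i \<noteq> x" if "i < n" "aK \<le> x" for i x using that by (simp add: aK_def)
    have push: "wp w push_prog (\<lambda>R M. \<exists>v'<v. I v' R M) 20 R2 M1"
      if R2: "pres 23 R R2" "R2 23 = l" "R2 28 = p" "R2 36 = u" "gate_regs (C ! p) R2" for R2
    proof (rule wp_wpc)
      have c2: "const_regs R2" using R(1) R2(1) by (rule const_regs_pres) simp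
      note c2' = c2[unfolded const_regs_def]
      from pl show "wpc w push_prog (\<lambda>R M. \<exists>v'<v. I v' R M) R2 M1"
      proof (cases rule: gate_cases)
        case (Var i)
        have gr: "R2 30 = 0" "R2 32 = i" using R2(5) Var by (simp_all add: gate_regs_def)
        have Ei: "M1 (aE + i) \<le> k * s" using E1 Var(2) tp by (simp add: pending_def) (meson le_trans le_add1)
        have bb: "aE + i \<le> w" "M1 (aE + i) + 1 \<le> w"
          using Var(2) bounds(1,5,18) addr Ei by (intro w_small; linarith)+
        have fin: "\<exists>v'<v. I v' R3 (M1(aE + i := M1 (aE + i) + 1))" if "pres 23 R R3" "R3 23 = l" for R3
        proof (rule nxt[OF that(1)])
          show "R3 23 = length st" using that by (simp add: l_def)
          show "stack (M1(aE + i := M1 (aE + i) + 1)) st" using sk(1) Var(2) by (subst stack_upd) (auto simp: aK_def)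
          show "\<forall>j<n. (M1(aE + i := M1 (aE + i) + 1)) (aE + j) = Poly_Mapping.lookup (E + Poly_Mapping.single i 1) j"
            using E1 by (simp add: lookup_add lookup_single when_def)
          show "\<forall>x<aE. (M1(aE + i := M1 (aE + i) + 1)) x = M x" using MM by simp
          show "pending g u0 (E + Poly_Mapping.single i 1) st" "pot st < pot (st @ [(p, u)])"
            using pending_Var[OF tp Var(1) g(1)] .
        qed
        show ?thesis using gr c2' bb fin R2 by (simp add: push_prog_def del: One_nat_def)
      next
        case (Union a b')
        have gr: "R2 30 = 1" "R2 32 = a" "R2 33 = b'" using R2(5) Union(1) by (auto simp: gate_regs_def union_gate_def)
        have "entry_ok g a u (M1 (aT + a * BQ + u))" using tableD[OF tb1 _ uB, of a] Union(2) ps by simp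
        then have t: "0 < M1 (a * BQ + aT + u) \<longleftrightarrow> reach a u" by (simp add: entry_ok_def rl add.commute)
        \<comment> \<open>If the left child has no entry for \<open>u\<close>, the right child must
          have one, because the union gate reaches \<open>u\<close>.\<close>
        define cc where "cc = (if 0 < M1 (a * BQ + aT + u) then a else b')"
        have rc: "reach cc u" "cc < p" using rp reach_union(2)[OF pl Union(1)] t Union(2,3) by (auto simp: cc_def)
        have fin: "\<exists>v'<v. I v' R3 (M1(l + l + aK + 1 := u, l + l + aK := cc))" if "pres 23 R R3" "R3 23 = l + 1" for R3
        proof (rule nxt[OF that(1)])
          show "R3 23 = length (st @ [(cc, u)])" using that by (simp add: l_def)
          show "stack (M1(l + l + aK + 1 := u, l + l + aK := cc)) (st @ [(cc, u)])"
            using sk(1) by (simp add: stack_snoc stack_upd l_def)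
          show "\<forall>x<aE. (M1(l + l + aK + 1 := u, l + l + aK := cc)) x = M x" using MM by (simp add: aK_def)
          show "\<forall>i<n. (M1(l + l + aK + 1 := u, l + l + aK := cc)) (aE + i) = Poly_Mapping.lookup E i"
            using E1 aEK by simp
          show "pending g u0 E (st @ [(cc, u)])" "pot (st @ [(cc, u)]) < pot (st @ [(p, u)])"
            using pending_child[OF tp g(1), of cc] rc reach_union(1)[OF pl Union(1), of u] by (auto simp: rl cc_def
                split: if_splits)
        qed
        show ?thesis using gr c2' b fin R2 rowZ[of a] Union(2) ps
          by (cases "0 < M1 (a * BQ + aT + u)") (simp_all add: push_prog_def cc_def del: One_nat_def)
      next
        case (Prod a b')
        have gr: "R2 30 = 2" "R2 32 = a" "R2 33 = b'" using R2(5) Prod by (auto simp: gate_regs_def)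
        have eo: "entry_ok g p u (M1 (aT + p * BQ + u))" using tableD[OF tb1 ps uB] .
        define x where "x = M1 (p * BQ + aT + u) - 1"
        have x: "x \<le> u" "split_ok g a b' u x"
          using eo Prod(1) rp by (auto simp: entry_ok_def rl x_def add.commute)
        define M2 where "M2 = M1(l + l + aK := a, l + l + aK + 1 := x, l + l + aK + 1 + 1 := b', l + l + aK + 1 + 1 + 1 := u - x)"
        have fin: "\<exists>v'<v. I v' R3 M2" if "pres 23 R R3" "R3 23 = l + 2" for R3
        proof (rule nxt[OF that(1)])
          show "R3 23 = length (st @ [(a, x), (b', u - x)])" using that by (simp add: l_def)
          have "stack M2 ((st @ [(a, x)]) @ [(b', u - x)])"
            unfolding stack_snoc using sk(1) by (simp add: M2_def stack_upd l_def)
          then show "stack M2 (st @ [(a, x), (b', u - x)])" by simp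
          show "\<forall>x<aE. M2 x = M x" using MM by (simp add: M2_def aK_def)
          show "\<forall>i<n. M2 (aE + i) = Poly_Mapping.lookup E i" using E1 aEK by (simp add: M2_def)
          show "pending g u0 E (st @ [(a, x), (b', u - x)])" "pot (st @ [(a, x), (b', u - x)]) < pot (st @ [(p, u)])"
            using pending_Prod[OF tp Prod(1) g(1) x] .
        qed
        show ?thesis using gr c2' b fin R2 rowZ[of p] ps
          by (simp add: push_prog_def M2_def x_def del: One_nat_def)
      qed
    qed (simp add: push_prog_def)
    have load: "wp w (load_prog ;; push_prog) (\<lambda>R M. \<exists>v'<v. I v' R M) 35 R2 M1"
      if R2: "pres 23 R R2" "R2 23 = l" "R2 28 = p" "R2 36 = u" for R2
    proof -
      have c2: "const_regs R2" using R(1) R2(1) by (rule const_regs_pres) simp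
      have "wp w load_prog (\<lambda>R M. wp w push_prog (\<lambda>R M. \<exists>v'<v. I v' R M) 20 R M) 15 R2 M1"
      proof (rule wp_load)
        fix R3 assume R3: "\<And>i. i \<notin> {30, 31, 32, 33, 60, 61} \<Longrightarrow> R3 i = R2 i" "gate_regs (C ! R2 28) R3"
        have "pres 23 R R3" using R2(1) R3(1) by (auto simp: pres_def)
        then show "wp w push_prog (\<lambda>R M. \<exists>v'<v. I v' R M) 20 R3 M1"
          using R3 R2 by (intro push) auto
      qed (use c2 R2 ps st1 in \<open>auto simp: static_def\<close>)
      then show ?thesis by (rule wp_Seq) simp
    qed
    have "wp w pop_prog (\<lambda>R M. wp w (load_prog ;; push_prog) (\<lambda>R M. \<exists>v'<v. I v' R M) 35 R M) 6 R1 M1"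
      unfolding pop_prog_def
      by (rule wp_Blk) (use c' len b sk load p23 in \<open>simp_all del: One_nat_def\<close>)
    then show ?thesis by (rule wp_Seq) simp
  qed
  define T2 where "T2 = 43 * (k * s) + 2"
  have loop: "wp w (Loop 0 23 (pop_prog ;; load_prog ;; push_prog)) Q T2 R1 M1"
    if R1: "pres 23 R R1" "R1 23 = 1" "M1 = M(aK := out, aK + 1 := u0)" for R1 M1
  proof (rule wp_Loop[where I = I and Tb = 41 and V = "k * s"])
    show "I (k * s) R1 M1"
      unfolding I_def
    proof (intro conjI exI)
      show "R1 23 = length [(out, u0)]" using R1 by simp
      show "stack M1 [(out, u0)]" using R1 by (simp add: stack_def)
      show "\<forall>x<aE. M1 x = M x" using R1(3) by (simp add: aK_def)
      show "\<forall>i<n. M1 (aE + i) = Poly_Mapping.lookup 0 i" using R1(3) M(3) by (simp add: aK_def)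
      have pk: "pot [(out, u0)] \<le> k * s"
      proof -
        have "k * (out + 1) \<le> k * s" using out by (intro mult_le_mono2) (simp add: s_def)
        then show ?thesis using g(2) by (simp add: found_def)
      qed
      then show "pot [(out, u0)] \<le> k * s" .
      show "pending g u0 0 [(out, u0)]"
        using pk g(2) out by (auto simp: pending_def found_def s_def list_all2_Cons1 simp del: pot_simps)
    qed (rule R1(1))
    show "Q R' M'" if I: "I v R' M'" "\<not> R' 0 < R' 23" for v R' M'
    proof -
      have p23: "pres 23 R R'" using I by (simp add: I_def)
      have "R' 0 = 0" using presD[OF p23, of 0] R by (simp add: const_regs_def)
      then obtain E where "\<forall>i<n. M' (aE + i) = Poly_Mapping.lookup E i" "pending g u0 E []" using I by (auto simp: I_def)
      then show ?thesis using Q[OF p23, of E] by (simp add: pending_def)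
    qed
  qed (use body in \<open>auto simp: T2_def\<close>)
  have b: "aK + 1 \<le> w" "1 \<le> w" using bounds(1) addr by (intro w_small; linarith)+
  have "wp w (Blk [ADD 23 1 0, STORE 22 7, ADD 60 22 1, STORE 60 27])
      (\<lambda>R M. wp w (Loop 0 23 (pop_prog ;; load_prog ;; push_prog)) Q T2 R M) 4 R M"
    by (rule wp_Blk) (use R' R(2) b loop in \<open>simp_all del: One_nat_def\<close>)
  then show ?thesis unfolding trace_prog_def by (rule wp_Seq) (simp add: trace_time_def T2_def)
qed

lemma wp_output:
  assumes R: "const_regs R"
    and Q: "\<And>R' M'. M' 0 = 1 \<Longrightarrow> \<forall>i<n. M' (i + 1) = M (aE + i) \<Longrightarrow> Q R' M'"
  shows "wp w output_prog Q output_time R M"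
proof -
  note R' = R[unfolded const_regs_def]
  define I where "I j R' M' \<longleftrightarrow> pres 23 R R' \<and> R' 36 + j = n \<and> (\<forall>i<R' 36. M' (i + 1)
      = M (aE + i)) \<and>
      (\<forall>i<n. R' 36 \<le> i \<longrightarrow> M' (aE + i) = M (aE + i))" for j R' M'
  \<comment> \<open>The target \<open>i + 1\<close> lies below the source \<open>aE + i\<close>, so
    copying upwards never overwrites an exponent that is still to be read.\<close>
  have aE1: "1 < aE" by (simp add: aE_def aT_def aS_def)
  have b1: "1 \<le> w" using bounds(1) by (intro w_small) linarith
  have loop: "wp w (Loop 36 3 (Blk [ADD 60 21 36, LOAD 60 60, ADD 61 36 1, STORE 61 60, ADD 36 36 1]))
      (\<lambda>R M. wp w (Blk [STORE 0 1]) Q 1 R M) (7 * n + 2) (R(36 := 0)) M"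
  proof (rule wp_Loop[where I = I and Tb = 5 and V = n])
    show "I n (R(36 := 0)) M" by (simp add: I_def)
    show "wp w (Blk [STORE 0 1]) Q 1 R' M'" if I: "I v R' M'" "\<not> R' 36 < R' 3" for v R' M'
    proof -
      have p23: "pres 23 R R'" using I by (simp add: I_def)
      have c: "R' 0 = 0" "R' 1 = 1" "R' 3 = n" using presD[OF p23] R by (simp_all add: const_regs_def)
      then have e: "R' 36 = n" using I by (auto simp: I_def)
      have "Q R' (M'(0 := 1))" using I(1) e by (intro Q) (auto simp: I_def)
      then show ?thesis using c by (intro wp_Blk) (simp_all del: One_nat_def)
    qed
    show "wp w (Blk [ADD 60 21 36, LOAD 60 60, ADD 61 36 1, STORE 61 60, ADD 36 36 1]) (\<lambda>R M. \<exists>v'<v. I v'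
        R M) 5 R' M'"
      if I: "I v R' M'" and lt: "R' 36 < R' 3" for v R' M'
    proof (rule wp_Blk)
      have p23: "pres 23 R R'" using I by (simp add: I_def)
      have c: "const_regs R'" using R p23 by (rule const_regs_pres) simp
      note c' = c[unfolded const_regs_def]
      define i where "i = R' 36"
      have i: "i < n" using lt c' by (simp add: i_def)
      have b: "aE + i \<le> w" "i + 1 \<le> w" using i bounds(1,5) addr by (intro w_small; linarith)+
      have "I (v - 1) (R'(60 := M' (aE + i), 61 := i + 1, 36 := i + 1)) (M'(i + 1 := M' (aE + i)))"
        using I i aE1 by (auto simp: I_def i_def less_Suc_eq)
      moreover have "v - 1 < v" using I i by (auto simp: I_def i_def)
      ultimately have "\<exists>v'<v. I v' (R'(60 := M' (aE + i), 61 := i + 1, 36 := i + 1)) (M'(i + 1 := M' (aE + i)))" by blast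
      then show "wpb w [ADD 60 21 36, LOAD 60 60, ADD 61 36 1, STORE 61 60, ADD 36 36 1] (\<lambda>R M. \<exists>v'<v. I
          v' R M) R' M'"
        using c' b by (simp add: i_def[symmetric] del: One_nat_def)
    qed simp
  qed simp
  have "wp w (Loop 36 3 (Blk [ADD 60 21 36, LOAD 60 60, ADD 61 36 1, STORE 61 60, ADD 36 36 1]) ;; Blk [STORE 0 1])
      Q (7 * n + 3) (R(36 := 0)) M" using loop by (rule wp_Seq) simp
  then have "wp w (Blk [ADD 36 0 0]) (\<lambda>R M. wp w (Loop 36 3 (Blk [ADD 60 21 36, LOAD 60 60, ADD 61 36 1, STORE 61
      60, ADD 36 36 1]) ;; Blk [STORE 0 1])
      Q (7 * n + 3) R M) 1 R M"
    using R' by (intro wp_Blk) (simp_all del: One_nat_def)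
  then show ?thesis unfolding output_prog_def by (rule wp_Seq) (simp add: output_time_def)
qed

section \<open>Initialisation of constants and of the digit-sum table\<close>

lemma wp_doubling:
  assumes ab: "a \<noteq> b" "a \<noteq> 2" "R 2 = 2" and j: "R a = 2 ^ j" "j \<le> e" and e: "R b \<le> 2 ^ e" "2 ^ e \<le> Z"
    and less: "\<And>i. j \<le> i \<Longrightarrow> Suc i \<le> e \<Longrightarrow> 2 ^ i < R b" and Q: "Q (R(a := 2 ^ e)) M"
  shows "wp w (Loop a b (Blk [MULT a a 2])) Q (3 * 2 ^ e + 2) R M"
proof -
  define I where "I v R' M' \<longleftrightarrow> M' = M \<and> (\<exists>i. R' = R(a := 2 ^ i) \<and> j \<le> i \<and> i
      \<le> e \<and> e \<le> i + v)" for v R' M'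
  show ?thesis
  proof (rule wp_Loop[where I = I and Tb = 1 and V = "2 ^ e"])
    \<comment> \<open>The iteration bound \<open>2 ^ e\<close> is far above the true
      \<open>e - j\<close>, but the resulting cost is still dominated by the number of
      guesses.\<close>
    have "e \<le> j + 2 ^ e" using less_exp[of e] by linarith
    moreover have "R = R(a := 2 ^ j)" unfolding j(1)[symmetric] by simp
    ultimately show "I (2 ^ e) R M" unfolding I_def using j(2) by blast
    show "Q R' M'" if I: "I v R' M'" "\<not> R' a < R' b" for v R' M'
    proof -
      obtain i where i: "R' = R(a := 2 ^ i)" "j \<le> i" "i \<le> e" "M' = M" using I(1) unfolding I_def by blast
      then have "\<not> 2 ^ i < R b" using I(2) ab by simp
      then have "i = e" using less[OF i(2)] i(3) by (meson Suc_leI le_neq_implies_less)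
      then show ?thesis using i Q by simp
    qed
    show "wp w (Blk [MULT a a 2]) (\<lambda>R M. \<exists>v'<v. I v' R M) 1 R' M'" if I: "I v R' M'" and lt: "R' a < R'
        b" for v R' M'
    proof (rule wp_Blk)
      obtain i where i: "R' = R(a := 2 ^ i)" "j \<le> i" "i \<le> e" "e \<le> i + v" "M' = M" using I unfolding I_def by blast
      have "2 ^ i < R b" using lt i ab by simp
      then have "i \<noteq> e" using e(1) by auto
      then have ie: "Suc i \<le> e" using i(3) by simp
      then have "(2::nat) ^ Suc i \<le> 2 ^ e" by (rule power_increasing) simp
      then have b: "2 ^ i * 2 \<le> w" using e(2) by (intro w_small) simp
      have "I (v - 1) (R(a := 2 ^ Suc i)) M" unfolding I_def using i ie by (intro conjI refl exI[of _ "Suc i"]) auto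
      moreover have "v - 1 < v" using i(4) ie by simp
      ultimately have "\<exists>v'<v. I v' (R(a := 2 ^ i * 2)) M" by (auto simp: mult.commute)
      then show "wpb w [MULT a a 2] (\<lambda>R M. \<exists>v'<v. I v' R M) R' M'"
        using i(1,5) b ab by simp
    qed simp
  qed simp
qed

lemma wp_init1:
  assumes R: "R = (\<lambda>_. 0)" and M: "M 0 = n" "M 1 = r" "M 2 = k" "M 3 = s" "M 4 = out"
    and Q: "\<And>R'. R' 0 = 0 \<and> R' 1 = 1 \<and> R' 2 = 2 \<and> R' 3 = n \<and> R' 4 = r \<and> R' 5 = k \<and> R'
        6 = s \<and> R' 7 = out \<and>
      R' 8 = B \<and> R' 9 = K \<and> R' 10 = MU \<and> R' 11 = Lam \<and> R' 13 = D \<and> R' 14 = q \<and> R' 18 = 2 *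
          k \<Longrightarrow> Q R' M"
  shows "wp w init_prog1 Q (29 + 3 * K + 3 * MU + 3 * Lam) R M"
proof -
  define F where "F R' \<longleftrightarrow> R' 0 = 0 \<and> R' 1 = 1 \<and> R' 2 = 2 \<and> R' 3 = n \<and> R' 4 = r
      \<and> R' 5 = k \<and> R' 6 = s \<and> R' 7 = out \<and>
      R' 8 = B \<and> R' 13 = D \<and> R' 14 = q \<and> R' 18 = 2 * k \<and> R' 62 = k * k * 3 + 1 \<and> R' 63 = 4 * k"
          for R' :: "nat \<Rightarrow> nat"
  have lamZ: "2 ^ lam \<le> Z" "2 ^ kap \<le> Z" "2 ^ mu \<le> Z" using bounds by (simp_all add: Lam_def K_def MU_def)
  have inc: "2 * 2 ^ i \<le> (2::nat) ^ e" if "Suc i \<le> e" for i e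
    using power_increasing[OF that, of "2::nat"] by simp
  define loop3 where "loop3 = Blk [ADD 11 9 0] ;; Loop 11 3 (Blk [MULT 11 11 2])"
  define loop2 where "loop2 = Loop 10 63 (Blk [MULT 10 10 2]) ;; loop3"
  define loop1 where "loop1 = Loop 9 62 (Blk [MULT 9 9 2]) ;; loop2"
  have l3: "wp w loop3 Q (3 * Lam + 3) R1 M" if F: "F R1" "R1 9 = K" "R1 10 = MU" for R1
  proof -
    have "wp w (Loop 11 3 (Blk [MULT 11 11 2])) Q (3 * Lam + 2) (R1(11 := K)) M"
      unfolding Lam_def
    proof (rule wp_doubling[where j = kap])
      show "2 ^ i < (R1(11 := K)) 3" if "kap \<le> i" "Suc i \<le> lam" for i
        using inc[OF that(2)] lam(3) that F by (auto simp: F_def)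
      show "Q (R1(11 := K, 11 := 2 ^ lam)) M" using F by (intro Q) (simp add: F_def Lam_def)
    qed (use F lam(1,2) lamZ in \<open>auto simp: F_def K_def\<close>)
    moreover have "K \<le> w" using bounds by (intro w_small) linarith
    ultimately have "wp w (Blk [ADD 11 9 0]) (\<lambda>R M. wp w (Loop 11 3 (Blk [MULT 11 11 2])) Q (3 * Lam + 2) R M) 1 R1 M"
      using F by (intro wp_Blk) (simp_all add: F_def)
    then show ?thesis unfolding loop3_def by (rule wp_Seq) simp
  qed
  have l2: "wp w loop2 Q (3 * MU + 3 * Lam + 5) R1 M" if F: "F R1" "R1 9 = K" "R1 10 = 1" for R1
    unfolding loop2_def
  proof (rule wp_Seq)
    show "wp w (Loop 10 63 (Blk [MULT 10 10 2])) (\<lambda>R M. wp w loop3 Q (3 * Lam + 3) R M) (3 * MU + 2) R1 M"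
      unfolding MU_def
    proof (rule wp_doubling[where j = 0])
      show "2 ^ i < R1 63" if "0 \<le> i" "Suc i \<le> mu" for i
        using inc[OF that(2)] mu(2) F by (simp add: F_def)
      show "wp w loop3 Q (3 * Lam + 3) (R1(10 := 2 ^ mu)) M" using F by (intro l3) (simp_all add: F_def MU_def)
    qed (use F mu lamZ in \<open>auto simp: F_def\<close>)
  qed simp
  have l1: "wp w loop1 Q (3 * K + 3 * MU + 3 * Lam + 7) R1 M" if F: "F R1" "R1 9 = 1" "R1 10 = 1" for R1
    unfolding loop1_def
  proof (rule wp_Seq)
    show "wp w (Loop 9 62 (Blk [MULT 9 9 2])) (\<lambda>R M. wp w loop2 Q (3 * MU + 3 * Lam + 5) R M) (3 * K + 2) R1 M"
      unfolding K_def
    proof (rule wp_doubling[where j = 0])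
      show "2 ^ i < R1 62" if "0 \<le> i" "Suc i \<le> kap" for i
        using inc[OF that(2)] kap(2) F by (simp add: F_def)
      show "wp w loop2 Q (3 * MU + 3 * Lam + 5) (R1(9 := 2 ^ kap)) M" using F by (intro l2) (simp_all add: F_def K_def)
    qed (use F kap lamZ in \<open>auto simp: F_def\<close>)
  qed simp
  have D64: "D = r * 64" by (simp add: D_def)
  have "64 \<le> Z"
  proof -
    have "64 \<le> D" using r1 by (simp add: D_def)
    then show ?thesis using bounds(12) by linarith
  qed
  moreover have kk: "k * k * 3 + 1 \<le> Z" using kap(1) lamZ(2) by linarith
  moreover have "k * k \<le> Z" using kk by linarith
  moreover have "4 * k div r + 1 \<le> 5 * Z" using bounds(14) by (simp add: q_def)
  ultimately have b: "1 \<le> w" "2 \<le> w" "3 \<le> w" "4 \<le> w" "64 \<le> w" "r + 1 \<le> w" "r * 64 \<le> w" "4 * k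
      \<le> w" "4 * k div r + 1 \<le> w"
    "k * 2 \<le> w" "k * k \<le> w" "k * k * 3 \<le> w" "k * k * 3 + 1 \<le> w"
    using bounds(1,6,7,12) unfolding D64 by (intro w_small; linarith)+
  have "wp w (Blk [SETC 1 1, SETC 2 2, LOAD 3 0, LOAD 4 1, LOAD 5 2, SETC 60 3, LOAD 6 60, SETC 60 4, LOAD 7 60,
          ADD 8 4 1, SETC 61 64, MULT 13 4 61, MULT 63 60 5, DIV 14 63 4, ADD 14 14 1, MULT 18 5 2,
          MULT 62 5 5, SETC 61 3, MULT 62 62 61, ADD 62 62 1, ADD 9 1 0, ADD 10 1 0])
     (\<lambda>R M. wp w loop1 Q (3 * K + 3 * MU + 3 * Lam + 7) R M) 22 R M"
    by (rule wp_Blk) (use b M l1 in \<open>simp_all add: R F_def B_def D64 q_def mult.commute[of k 2] del: One_nat_def\<close>)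
  then show ?thesis unfolding init_prog1_def loop1_def loop2_def loop3_def by (rule wp_Seq) simp
qed

lemma wp_init2:
  assumes R: "R 0 = 0 \<and> R 1 = 1 \<and> R 2 = 2 \<and> R 3 = n \<and> R 4 = r \<and> R 5 = k \<and> R 6 = s \<and> R
      7 = out \<and>
      R 8 = B \<and> R 9 = K \<and> R 10 = MU \<and> R 11 = Lam \<and> R 13 = D \<and> R 14 = q \<and> R 18 = 2 * k"
    and Q: "\<And>R'. const_regs R' \<Longrightarrow> R' 24 = G \<Longrightarrow> R' 60 = 0 \<Longrightarrow> Q R' M"
  shows "wp w init_prog2 Q (5 * q + 16 * k + 20) R M"
proof -
  define F where "F R' \<longleftrightarrow> R' 0 = 0 \<and> R' 1 = 1 \<and> R' 2 = 2 \<and> R' 3 = n \<and> R' 4 = r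
      \<and> R' 5 = k \<and> R' 6 = s \<and> R' 7 = out \<and>
      R' 8 = B \<and> R' 9 = K \<and> R' 10 = MU \<and> R' 11 = Lam \<and> R' 12 = Lam div K \<and> R' 13 = D \<and> R'
          14 = q \<and> R' 18 = 2 * k" for R' :: "nat \<Rightarrow> nat"
  define last where "last = Blk [MULT 24 24 16, SETC 60 4, MULT 60 60 6, SETC 61 5, ADD 19 60 61, ADD 20 19 15, MULT 60 6 15,
          ADD 21 20 60, ADD 22 21 3, ADD 60 0 0]"
  define pw where "pw = Loop 61 14 (Blk [MULT 15 15 8, MULT 24 24 13, ADD 61 61 1])"
  define hp where "hp = Loop 61 18 (Blk [MULT 16 16 9, MULT 61 61 2])"
  have l4: "wp w last Q 10 R1 M" if F: "F R1" "R1 15 = BQ" "R1 24 = D ^ q" "R1 16 = HH" for R1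
    unfolding last_def
  proof (rule wp_Blk)
    have GG: "D ^ q * HH = G" by (simp add: G_def mult.commute)
    have a: "4 * s + 5 = aS" "aS + BQ = aT" "aT + s * BQ = aE" "aE + n = aK"
      by (simp_all add: aS_def aT_def aE_def aK_def)
    have b: "G \<le> w" "4 \<le> w" "4 * s \<le> w" "5 \<le> w" "aS \<le> w" "aT \<le> w" "s * BQ \<le> w" "aE \<le> w"
        "aK \<le> w"
      using bounds(1,2,4,16) addr by (intro w_small; linarith)+
    show "wpb w [MULT 24 24 16, SETC 60 4, MULT 60 60 6, SETC 61 5, ADD 19 60 61, ADD 20 19 15, MULT 60 6 15,
          ADD 21 20 60, ADD 22 21 3, ADD 60 0 0] Q R1 M"
      using F a b Q by (simp add: F_def GG const_regs_def)
  qed simp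
  have l3: "wp w (hp ;; last) Q (16 * k + 12) R1 M"
    if F: "F R1" "R1 15 = BQ" "R1 24 = D ^ q" "R1 16 = Lam" "R1 61 = r" for R1
  proof (rule wp_Seq)
    show "wp w hp (\<lambda>R M. wp w last Q 10 R M) (16 * k + 2) R1 M"
      unfolding hp_def
    proof (rule wp_Loop[where Tb = 2 and V = "4 * k" and
          I = "\<lambda>v R' M'. M' = M \<and> (\<exists>i. R' = R1(16 := Lam * K ^ i, 61 := r * 2 ^ i) \<and> i \<le> J
              \<and> J \<le> i + v)"])
      have "J < 2 ^ J" by (rule less_exp)
      also have "2 ^ J \<le> r * 2 ^ J" using pos by simp
      finally have "J \<le> 4 * k" using J_le by linarith
      then show "M = M \<and> (\<exists>i. R1 = R1(16 := Lam * K ^ i, 61 := r * 2 ^ i) \<and> i \<le> J \<and> J \<le> i + 4 * k)"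
        using F by (intro conjI refl exI[of _ 0]) auto
      show "wp w last Q 10 R' M'"
        if I: "M' = M \<and> (\<exists>i. R' = R1(16 := Lam * K ^ i, 61 := r * 2 ^ i) \<and> i \<le> J \<and> J \<le> i +
            v)" "\<not> R' 61 < R' 18" for v R' M'
      proof -
        obtain i where i: "R' = R1(16 := Lam * K ^ i, 61 := r * 2 ^ i)" "i \<le> J" "M' = M" using I(1) by blast
        have "2 * k \<le> r * 2 ^ i" using I(2) i F by (simp add: F_def)
        then have "J \<le> i" unfolding J_def by (rule Least_le)
        then have "i = J" using i by simp
        then show ?thesis unfolding i(3) using F i(1) by (intro l4) (simp_all add: F_def HH_def)
      qed
      show "wp w (Blk [MULT 16 16 9, MULT 61 61 2])
          (\<lambda>R' M'. \<exists>v'<v. M' = M \<and> (\<exists>i. R' = R1(16 := Lam * K ^ i, 61 := r * 2 ^ i) \<and> i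
              \<le> J \<and> J \<le> i + v')) 2 R' M'"
        if I: "M' = M \<and> (\<exists>i. R' = R1(16 := Lam * K ^ i, 61 := r * 2 ^ i) \<and> i \<le> J \<and> J \<le> i +
            v)" and lt: "R' 61 < R' 18" for v R' M'
      proof (rule wp_Blk)
        obtain i where i: "R' = R1(16 := Lam * K ^ i, 61 := r * 2 ^ i)" "i \<le> J" "J \<le> i + v" "M' = M" using I by blast
        have lt2: "r * 2 ^ i < 2 * k" using lt i F by (simp add: F_def)
        then have "i \<noteq> J" using J_ge by auto
        then have il: "i < J" using i by simp
        have "K ^ Suc i \<le> K ^ J" using il pos by (intro power_increasing) auto
        then have "Lam * K ^ Suc i \<le> Lam * K ^ J" by (rule mult_le_mono2)
        moreover have "Lam * K ^ Suc i = Lam * K ^ i * K" by simp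
        ultimately have "Lam * K ^ i * K \<le> Z" using bounds(8) unfolding HH_def by linarith
        then have b: "Lam * K ^ i * K \<le> w" "r * 2 ^ i * 2 \<le> w" using lt2 bounds(6) by (intro w_small; linarith)+
        have upd: "R'(16 := Lam * K ^ i * K, 61 := r * 2 ^ i * 2) = R1(16 := Lam * K ^ Suc i, 61 := r * 2 ^ Suc i)"
          unfolding i(1) by (intro ext) (simp add: mult_ac)
        have "\<exists>j. R'(16 := Lam * K ^ i * K, 61 := r * 2 ^ i * 2) = R1(16 := Lam * K ^ j, 61 := r * 2 ^ j) \<and>
            j \<le> J \<and> J \<le> j + (v - 1)"
          by (intro exI[of _ "Suc i"] conjI upd) (use i il in auto)
        moreover have "v - 1 < v" using i il by simp
        ultimately have "\<exists>v'<v. M' = M \<and> (\<exists>j. R'(16 := Lam * K ^ i * K, 61 := r * 2 ^ i * 2) = R1(16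
            := Lam * K ^ j, 61 := r * 2 ^ j) \<and> j \<le> J \<and> J \<le> j + v')"
          using i(4) by blast
        then show "wpb w [MULT 16 16 9, MULT 61 61 2]
          (\<lambda>R' M'. \<exists>v'<v. M' = M \<and> (\<exists>i. R' = R1(16 := Lam * K ^ i, 61 := r * 2 ^ i) \<and> i
              \<le> J \<and> J \<le> i + v')) R' M'"
          using i(1) b F by (simp add: F_def)
      qed simp
    qed simp
  qed simp
  have l23: "wp w (Blk [ADD 16 11 0, ADD 61 4 0] ;; hp ;; last) Q (16 * k + 14) R1 M"
    if F: "F R1" "R1 15 = BQ" "R1 24 = D ^ q" for R1
  proof -
    have b: "Lam \<le> w" "r \<le> w" using bounds by (intro w_small; linarith)+
    have "wp w (Blk [ADD 16 11 0, ADD 61 4 0]) (\<lambda>R M. wp w (hp ;; last) Q (16 * k + 12) R M) 2 R1 M"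
      by (rule wp_Blk) (use F b l3[of "R1(16 := Lam, 61 := r)"] in \<open>simp_all add: F_def\<close>)
    then show ?thesis by (rule wp_Seq) simp
  qed
  have l2: "wp w (pw ;; Blk [ADD 16 11 0, ADD 61 4 0] ;; hp ;; last) Q (5 * q + 16 * k + 16) R1 M"
    if F: "F R1" "R1 15 = 1" "R1 24 = 1" "R1 61 = 0" for R1
  proof (rule wp_Seq)
    show "wp w pw (\<lambda>R M. wp w (Blk [ADD 16 11 0, ADD 61 4 0] ;; hp ;; last) Q (16 * k + 14) R M) (5 * q + 2) R1 M"
      unfolding pw_def
    proof (rule wp_Loop[where Tb = 3 and V = q and
          I = "\<lambda>v R' M'. M' = M \<and> (\<exists>i. R' = R1(15 := B ^ i, 24 := D ^ i, 61 := i) \<and> i + v = q)"])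
      show "M = M \<and> (\<exists>i. R1 = R1(15 := B ^ i, 24 := D ^ i, 61 := i) \<and> i + q = q)"
        using F by (intro conjI refl exI[of _ 0]) auto
      show "wp w (Blk [ADD 16 11 0, ADD 61 4 0] ;; hp ;; last) Q (16 * k + 14) R' M'"
        if I: "M' = M \<and> (\<exists>i. R' = R1(15 := B ^ i, 24 := D ^ i, 61 := i) \<and> i + v = q)" "\<not> R' 61 <
            R' 14" for v R' M'
      proof -
        obtain i where i: "R' = R1(15 := B ^ i, 24 := D ^ i, 61 := i)" "i + v = q" "M' = M" using I(1) by blast
        have "i = q" using I(2) i F by (simp add: F_def)
        then show ?thesis unfolding i(3) using F i(1) by (intro l23) (simp_all add: F_def BQ_def)
      qed
      show "wp w (Blk [MULT 15 15 8, MULT 24 24 13, ADD 61 61 1])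
          (\<lambda>R' M'. \<exists>v'<v. M' = M \<and> (\<exists>i. R' = R1(15 := B ^ i, 24 := D ^ i, 61 := i) \<and> i
              + v' = q)) 3 R' M'"
        if I: "M' = M \<and> (\<exists>i. R' = R1(15 := B ^ i, 24 := D ^ i, 61 := i) \<and> i + v = q)" and lt: "R' 61 <
            R' 14" for v R' M'
      proof (rule wp_Blk)
        obtain i where i: "R' = R1(15 := B ^ i, 24 := D ^ i, 61 := i)" "i + v = q" "M' = M" using I by blast
        have iq: "i < q" using lt i F by (simp add: F_def)
        have "B ^ Suc i \<le> B ^ q" "D ^ Suc i \<le> D ^ q" using iq pos by (intro power_increasing; simp)+
        then have "B ^ i * B \<le> Z" "D ^ i * D \<le> Z" using bounds(3,15) by (simp_all add: BQ_def mult.commute)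
        then have b: "B ^ i * B \<le> w" "D ^ i * D \<le> w" "i + 1 \<le> w" using iq bounds(14) by (intro w_small; linarith)+
        have upd: "R'(15 := B ^ i * B, 24 := D ^ i * D, 61 := i + 1) = R1(15 := B ^ Suc i, 24 := D ^ Suc i, 61 := Suc i)"
          unfolding i(1) by (intro ext) (simp add: mult.commute)
        have "\<exists>j. R'(15 := B ^ i * B, 24 := D ^ i * D, 61 := i + 1) = R1(15 := B ^ j, 24 := D ^ j, 61 := j)
            \<and> j + (v - 1) = q"
          by (intro exI[of _ "Suc i"] conjI upd) (use i iq in auto)
        moreover have "v - 1 < v" using i iq by simp
        ultimately have "\<exists>v'<v. M' = M \<and> (\<exists>j. R'(15 := B ^ i * B, 24 := D ^ i * D, 61 := i + 1) =
            R1(15 := B ^ j, 24 := D ^ j, 61 := j) \<and> j + v' = q)"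
          using i(3) by blast
        then show "wpb w [MULT 15 15 8, MULT 24 24 13, ADD 61 61 1]
          (\<lambda>R' M'. \<exists>v'<v. M' = M \<and> (\<exists>i. R' = R1(15 := B ^ i, 24 := D ^ i, 61 := i) \<and> i
              + v' = q)) R' M'"
          using i(1) b F by (simp add: F_def)
      qed simp
    qed simp
  qed simp
  have b: "1 \<le> w" using bounds(1) by (intro w_small) linarith
  have "wp w (Blk [DIV 12 11 9, ADD 15 1 0, ADD 24 1 0, ADD 61 0 0])
      (\<lambda>R M. wp w (pw ;; Blk [ADD 16 11 0, ADD 61 4 0] ;; hp ;; last) Q (5 * q + 16 * k + 16) R M) 4 R M"
    by (rule wp_Blk) (use R b l2 in \<open>simp_all add: F_def del: One_nat_def\<close>)
  then show ?thesis unfolding init_prog2_def pw_def hp_def last_def by (rule wp_Seq) simp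
qed

lemma wp_digsum:
  assumes R: "const_regs R" "R 24 = G" "R 60 = 0" and M: "\<forall>j<5 + 4 * s. M j = input ! j" "\<forall>j\<ge>5 + 4 *
      s. M j = 0"
    and Q: "\<And>R' M'. const_regs R' \<Longrightarrow> R' 24 = G \<Longrightarrow> static M' \<Longrightarrow>
        \<forall>i<n. M' (aE + i) = 0 \<Longrightarrow> Q R' M'"
  shows "wp w (Loop 60 15 digsum_body) Q (11 * BQ + 2) R M"
proof -
  define I where "I v R' M' \<longleftrightarrow> pres 25 R R' \<and> R' 60 + v = BQ \<and> (\<forall>u<R' 60. M' (aS +
      u) = digsum B u) \<and>
      (\<forall>x. x < aS \<or> aS + R' 60 \<le> x \<longrightarrow> M' x = M x)" for v R' M'
  show ?thesis
  proof (rule wp_Loop[where I = I and Tb = 9 and V = BQ])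
    show "I BQ R M" using R by (simp add: I_def)
    show "Q R' M'" if I: "I v R' M'" "\<not> R' 60 < R' 15" for v R' M'
    proof -
      have p25: "pres 25 R R'" using I by (simp add: I_def)
      have c: "const_regs R'" using R(1) p25 by (rule const_regs_pres) simp
      have e: "R' 60 = BQ" using I c by (simp add: I_def const_regs_def)
      have fr: "\<forall>x. x < aS \<or> aT \<le> x \<longrightarrow> M' x = M x" using I e by (simp add: I_def aT_def)
      have "static M'" using M(1) fr I e by (simp add: static_def I_def aS_def)
      moreover have "\<forall>i<n. M' (aE + i) = 0" using fr M(2) by (simp add: aE_def aT_def aS_def)
      ultimately show ?thesis using Q[OF c] presD[OF p25, of 24] R(2) by simp
    qed
    show "wp w digsum_body (\<lambda>R M. \<exists>v'<v. I v' R M) 9 R' M'" if I: "I v R' M'" and lt: "R' 60 < R' 15" for v R' M'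
      unfolding digsum_body_def
    proof (rule wp_Blk)
      have p25: "pres 25 R R'" using I by (simp add: I_def)
      have c: "const_regs R'" using R(1) p25 by (rule const_regs_pres) simp
      note c' = c[unfolded const_regs_def]
      define u where "u = R' 60"
      have u: "u < BQ" using lt c' by (simp add: u_def)
      \<comment> \<open>For \<open>u = 0\<close> the recurrence reads the very cell that is being
        filled, which still holds its initial zero.\<close>
      have prev: "M' (u div B + aS) = digsum B (u div B)"
      proof (cases "u = 0")
        case True
        then show ?thesis using I M(2) by (simp add: I_def u_def aS_def)
      next
        case False
        then have "u div B < u" using B_pos by simp
        moreover have "\<forall>x<R' 60. M' (aS + x) = digsum B x" using I by (simp add: I_def)
        ultimately show ?thesis unfolding u_def[symmetric] by (simp add: add.commute[of _ aS])
      qed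
      have val: "digsum B (u div B) + u mod B = digsum B u" using digsum_rec[OF B_pos, of u] by simp
      have uw: "u \<le> w" "u div B * B \<le> w" "u div B + aS \<le> w" "digsum B u \<le> w" "u + aS \<le> w" "u + 1 \<le> w"
        using u bounds(1,3) addr digsum_less_BQ[OF u] div_times_less_eq_dividend[of u B] div_le_dividend[of u B]
        by (intro w_small; linarith)+
      have nxt: "\<exists>v'<v. I v' R2 (M'(u + aS := digsum B u))" if "pres 25 R R2" "R2 60 = u + 1" for R2
      proof (intro exI[of _ "v - 1"] conjI)
        show "v - 1 < v" using I u by (auto simp: I_def u_def)
        show "I (v - 1) R2 (M'(u + aS := digsum B u))"
          using that I u by (auto simp: I_def u_def less_Suc_eq add.commute)
      qed
      show "wpb w [DIV 61 60 8, MULT 62 61 8, SUB 62 60 62, ADD 61 61 19, LOAD 61 61, ADD 61 61 62,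
          ADD 62 60 19, STORE 62 61, ADD 60 60 1] (\<lambda>R M. \<exists>v'<v. I v' R M) R' M'"
        using c' uw prev val nxt p25 u_def by (simp add: mod_by_div del: One_nat_def)
    qed simp
  qed simp
qed

end

section \<open>Estimates for the number of guesses and the total work\<close>

lemma log2_le: "0 < y \<Longrightarrow> log 2 y \<le> 2 * y" for y :: real
proof -
  assume y: "0 < y"
  have "ln (1 / 2 :: real) \<le> 1 / 2 - 1" by (rule ln_le_minus_one) simp
  then have l2: "1 / 2 \<le> ln (2 :: real)" by (simp add: ln_div)
  have "ln y \<le> y" using ln_le_minus_one[OF y] by simp
  also have "y \<le> 2 * y * ln 2" using l2 y by (simp add: mult.commute mult_left_mono[of "1 / 2" "ln 2" "2 * y"])
  finally show ?thesis using l2 by (simp add: log_def divide_le_eq)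
qed

context guesses
begin

definition "rho = real k / real r"

lemma rho_ge_1: "1 \<le> rho" and r_rho: "real r * rho = real k" and r_le_k: "real r \<le> real k"
  using r1 rk by (simp_all add: rho_def field_simps)

lemma J_log: "real J \<le> 2 + log 2 rho"
proof -
  have "real r * 2 ^ J < real (4 * k)" using J_le by (metis of_nat_less_iff of_nat_mult of_nat_numeral of_nat_power)
  then have "2 ^ J < 4 * rho" using r1 by (simp add: rho_def field_simps)
  then have "2 powr real J < 4 * rho" by (simp add: powr_realpow)
  then have "real J < log 2 (4 * rho)" using rho_ge_1 by (subst less_log_iff) auto
  also have "log 2 (4 * rho) = log 2 4 + log 2 rho" using rho_ge_1 by (simp add: log_mult)
  also have "log 2 4 = (2::real)" using log_nat_power[of 2 2 2] by simp
  finally show ?thesis by simp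
qed

text \<open>For the square, \<open>log 2 rho\<close> is twice the logarithm of
  \<open>sqrt rho\<close>, hence at most \<open>4 * sqrt rho\<close>. A linear bound on the squared
  logarithm is what turns rho^(O(log rho)) into 2^(O(rho)).\<close>

lemma log_rho_bounds: "0 \<le> log 2 rho" "log 2 rho \<le> 2 * rho" "(log 2 rho)\<^sup>2 \<le> 16 * rho"
proof -
  show l0: "0 \<le> log 2 rho" using rho_ge_1 by simp
  show "log 2 rho \<le> 2 * rho" using rho_ge_1 by (intro log2_le) simp
  have "log 2 rho = 2 * log 2 (sqrt rho)" using rho_ge_1 by (simp add: log_def ln_sqrt)
  also have "\<dots> \<le> 4 * sqrt rho" using log2_le[of "sqrt rho"] rho_ge_1 by simp
  finally have "(log 2 rho)\<^sup>2 \<le> (4 * sqrt rho)\<^sup>2" using l0 by (intro power_mono)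
  then show "(log 2 rho)\<^sup>2 \<le> 16 * rho" using rho_ge_1 by (simp add: power_mult_distrib)
qed

lemma r_powr_mono: "a \<le> b \<Longrightarrow> real r powr a \<le> real r powr b"
  using r1 by (intro powr_mono) auto

text \<open>Substituting \<open>k = r * rho\<close> separates \<open>k ^ (2 * J)\<close>: the power
  of \<open>r\<close> goes into the main term, and the power of \<open>rho\<close> becomes
  \<open>2\<close> to the exponent \<open>4 * log 2 rho + 2 * (log 2 rho)\<^sup>2\<close>, at most
  \<open>8 * rho + 32 * rho\<close>.\<close>

lemma K_pow_J: "real (K ^ J) \<le> 64 * real k ^ 7 * real r powr (4 * rho) * 2 powr (40 * rho)"
proof -
  have "real K \<le> 6 * (real k)\<^sup>2" using kap(2) unfolding K_def power2_eq_square
    by (metis of_nat_le_iff of_nat_mult of_nat_numeral)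
  then have "real (K ^ J) \<le> (6 * (real k)\<^sup>2) ^ J" unfolding of_nat_power by (rule power_mono) simp
  also have "\<dots> = 6 ^ J * (real k) ^ (2 * J)" by (simp add: power_mult_distrib power_mult)
  also have "(real k) ^ (2 * J) = real r ^ (2 * J) * rho ^ (2 * J)" by (simp add: r_rho[symmetric] power_mult_distrib)
  \<comment> \<open>\<open>6 ^ J\<close> is at most the cube of \<open>2 ^ J\<close>, and
    \<open>2 ^ J\<close> is at most \<open>4 * k\<close>.\<close>
  also have "6 ^ J \<le> 64 * real k ^ 3"
  proof -
    have "real r * 2 ^ J < real (4 * k)" using J_le by (metis of_nat_less_iff of_nat_mult of_nat_numeral of_nat_power)
    moreover have "1 * 2 ^ J \<le> real r * 2 ^ J" using r1 by (intro mult_right_mono) auto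
    ultimately have "2 ^ J \<le> 4 * real k" unfolding of_nat_mult of_nat_numeral by linarith
    then have "(2 ^ J) ^ 3 \<le> (4 * real k) ^ 3" by (intro power_mono) auto
    moreover have "(6::real) ^ J \<le> 8 ^ J" by (intro power_mono) auto
    moreover have "(8::real) ^ J = (2 ^ J) ^ 3" by (simp add: power_mult[symmetric] mult.commute[of J] power_mult)
    ultimately show ?thesis by (simp add: power_mult_distrib)
  qed
  also have "real r ^ (2 * J) \<le> real k ^ 4 * real r powr (4 * rho)"
  proof -
    have "real r ^ (2 * J) = real r powr (2 * real J)" using r1 by (simp add: powr_realpow[symmetric])
    also have "\<dots> \<le> real r powr (4 + 4 * rho)" using J_log log_rho_bounds(2) by (intro r_powr_mono) simp
    also have "\<dots> = real r ^ 4 * real r powr (4 * rho)" using r1 by (simp add: powr_add powr_realpow)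
    also have "\<dots> \<le> real k ^ 4 * real r powr (4 * rho)" using r_le_k by (intro mult_right_mono power_mono) auto
    finally show ?thesis .
  qed
  also have "rho ^ (2 * J) \<le> 2 powr (40 * rho)"
  proof -
    have "rho ^ (2 * J) = rho powr (2 * real J)" using rho_ge_1 by (simp add: powr_realpow[symmetric])
    also have "\<dots> = 2 powr (log 2 rho * (2 * real J))" using rho_ge_1 by (simp add: powr_powr[symmetric])
    also have "\<dots> \<le> 2 powr (40 * rho)"
    proof (rule powr_mono)
      have "log 2 rho * (2 * real J) \<le> log 2 rho * (2 * (2 + log 2 rho))"
        using J_log log_rho_bounds(1) by (intro mult_left_mono) auto
      also have "\<dots> = 4 * log 2 rho + 2 * (log 2 rho)\<^sup>2" by (simp add: algebra_simps power2_eq_square)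
      also have "\<dots> \<le> 40 * rho" using log_rho_bounds(2,3) by simp
      finally show "log 2 rho * (2 * real J) \<le> 40 * rho" .
    qed simp
    finally show ?thesis .
  qed
  finally have "real (K ^ J) \<le> 64 * real k ^ 3 * (real k ^ 4 * real r powr (4 * rho) * 2 powr (40 * rho))"
    using rho_ge_1 by (simp add: mult_mono mult_left_mono mult_right_mono)
  then show ?thesis by (simp add: power_add[symmetric] mult_ac)
qed

lemma q_le: "real q \<le> 4 * rho + 1"
proof -
  have "real (4 * k div r * r) \<le> real (4 * k)" by (simp only: of_nat_le_iff div_times_less_eq_dividend)
  then have "real (4 * k div r) \<le> real (4 * k) / real r" using r1 by (simp add: pos_le_divide_eq)
  then show ?thesis by (simp add: q_def rho_def)
qed

lemma r_pow_q: "real r ^ q \<le> real k * real r powr (4 * rho)"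
proof -
  have "real r ^ q = real r powr real q" using r1 by (simp add: powr_realpow)
  also have "\<dots> \<le> real r powr (4 * rho + 1)" using q_le by (rule r_powr_mono)
  also have "\<dots> = real r * real r powr (4 * rho)" using r1 by (simp add: powr_add)
  also have "\<dots> \<le> real k * real r powr (4 * rho)" using r_le_k by (intro mult_right_mono) auto
  finally show ?thesis .
qed

lemma two_pow_q: "2 ^ q \<le> 2 * 2 powr (4 * rho)"
proof -
  have "2 ^ q = 2 powr real q" by (simp add: powr_realpow)
  also have "\<dots> \<le> 2 powr (4 * rho + 1)" using q_le by (intro powr_mono) auto
  also have "\<dots> = 2 * 2 powr (4 * rho)" by (simp add: powr_add)
  finally show ?thesis .
qed

lemma D_pow_q: "real (D ^ q) \<le> 64 * real k * real r powr (4 * rho) * 2 powr (24 * rho)"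
proof -
  have "real (D ^ q) = (2 ^ q) ^ 6 * real r ^ q"
    by (simp add: D_def power_mult_distrib power_mult[symmetric] mult.commute[of q]) (simp add: power_mult)
  also have "\<dots> \<le> (2 * 2 powr (4 * rho)) ^ 6 * (real k * real r powr (4 * rho))"
    using two_pow_q r_pow_q by (intro mult_mono power_mono) auto
  also have "(2 * 2 powr (4 * rho)) ^ 6 = 64 * 2 powr (24 * rho)"
    by (simp add: power_mult_distrib powr_realpow[symmetric] powr_powr)
  finally show ?thesis by (simp add: mult_ac)
qed

lemma BQ_sq: "real (BQ * BQ) \<le> 4 * real k ^ 2 * real r powr (8 * rho) * 2 powr (8 * rho)"
proof -
  have "real BQ = (real r + 1) ^ q" by (simp add: BQ_def B_def add.commute)
  also have "\<dots> \<le> (2 * real r) ^ q" using r1 by (intro power_mono) auto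
  also have "\<dots> \<le> (2 * 2 powr (4 * rho)) * (real k * real r powr (4 * rho))"
    unfolding power_mult_distrib using two_pow_q r_pow_q by (intro mult_mono) auto
  finally have "real BQ * real BQ \<le> ((2 * 2 powr (4 * rho)) * (real k * real r powr (4 * rho))) * ((2 * 2 powr (4 *
      rho)) * (real k * real r powr (4 * rho)))"
    by (intro mult_mono) auto
  also have "\<dots> = 4 * real k ^ 2 * (real r powr (4 * rho) * real r powr (4 * rho)) * (2 powr (4 * rho) * 2 powr (4 * rho))"
    by (simp add: power2_eq_square mult_ac)
  also have "\<dots> = 4 * real k ^ 2 * real r powr (8 * rho) * 2 powr (8 * rho)"
    by (simp add: powr_add[symmetric])
  finally show ?thesis by simp
qed

lemma Lam_le: "real Lam \<le> 12 * real n * real k ^ 2"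
proof -
  have "Lam \<le> 2 * n * K"
    using lam(3)
  proof
    assume "lam = kap"
    then have "Lam = K" unfolding Lam_def K_def by simp
    then show ?thesis using n0 by simp
  next
    assume "2 ^ lam < 2 * n"
    moreover have "2 * n \<le> 2 * n * K" by (simp add: K_def)
    ultimately show ?thesis unfolding Lam_def by linarith
  qed
  also have "\<dots> \<le> 2 * n * (6 * (k * k))" using kap(2) unfolding K_def by (intro mult_le_mono2)
  finally have "real Lam \<le> real (2 * n * (6 * (k * k)))" by (simp only: of_nat_le_iff)
  then show ?thesis by (simp add: power2_eq_square mult_ac)
qed

text \<open>The exponents add up to \<open>4 + 4 + 8 = 16\<close> times \<open>rho\<close> for
  \<open>r\<close> and \<open>40 + 24 + 8 = 72\<close> times \<open>rho\<close> for
  \<open>2\<close>. The numerical constant is below \<open>3 ^ 17\<close> and so absorbed by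
  \<open>k ^ 17\<close>, which with \<open>k ^ 14\<close> gives \<open>k ^ 31\<close>.\<close>

lemma work_bound:
  "real (500 * (G * s * (k * k) * (BQ * BQ))) \<le> time_bound 31 72 n r k s"
proof -
  have k3: "3 \<le> real k" using r1 rk by simp
  have lg: "1 \<le> log 2 (real n + 1)" using n0 by simp
  have "real G \<le> (12 * real n * real k ^ 2) * (64 * real k ^ 7 * real r powr (4 * rho) * 2 powr (40 * rho)) *
      (64 * real k * real r powr (4 * rho) * 2 powr (24 * rho))"
    unfolding G_def HH_def of_nat_mult using Lam_le K_pow_J D_pow_q by (intro mult_mono) auto
  then have "real G * real s * (real k * real k) * real (BQ * BQ) \<le>
      (12 * real n * real k ^ 2) * (64 * real k ^ 7 * real r powr (4 * rho) * 2 powr (40 * rho)) *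
      (64 * real k * real r powr (4 * rho) * 2 powr (24 * rho)) * real s * (real k * real k) *
      (4 * real k ^ 2 * real r powr (8 * rho) * 2 powr (8 * rho))"
    using BQ_sq by (intro mult_mono) auto
  also have "\<dots> = 196608 * (real n * real s) * (real k ^ 2 * real k ^ 7 * real k * real k * real k * real k ^ 2) *
      (real r powr (4 * rho) * real r powr (4 * rho) * real r powr (8 * rho)) * (2 powr (40 * rho) * 2 powr (24 * rho) *
          2 powr (8 * rho))"
    by (simp add: mult_ac)
  also have "real k ^ 2 * real k ^ 7 * real k * real k * real k * real k ^ 2 = real k ^ 14"
    by (simp add: power_numeral_reduce mult_ac)
  also have "real r powr (4 * rho) * real r powr (4 * rho) * real r powr (8 * rho) = real r powr (16 * rho)"
    by (simp add: powr_add[symmetric])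
  also have "2 powr (40 * rho) * 2 powr (24 * rho) * 2 powr (8 * rho) = 2 powr (72 * rho)"
    by (simp add: powr_add[symmetric])
  finally have main: "real G * real s * (real k * real k) * real (BQ * BQ) \<le>
      196608 * ((real n * real s) * real k ^ 14 * real r powr (16 * rho) * 2 powr (72 * rho))" by (simp only: mult.assoc)
  have "real (500 * (G * s * (k * k) * (BQ * BQ))) = 500 * (real G * real s * (real k * real k) * real (BQ * BQ))"
    by simp
  also have "\<dots> \<le> 98304000 * ((real n * real s) * real k ^ 14 * real r powr (16 * rho) * 2 powr (72 * rho))"
    using main by linarith
  also have "\<dots> \<le> real k ^ 17 * ((real n * real s) * real k ^ 14 * real r powr (18 * rho) * 2 powr (72 * rho))"
  proof (rule mult_mono)
    have "(98304000::real) \<le> 3 ^ 17" by simp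
    also have "\<dots> \<le> real k ^ 17" using k3 by (intro power_mono) auto
    finally show "98304000 \<le> real k ^ 17" .
    show "(real n * real s) * real k ^ 14 * real r powr (16 * rho) * 2 powr (72 * rho)
        \<le> (real n * real s) * real k ^ 14 * real r powr (18 * rho) * 2 powr (72 * rho)"
      using rho_ge_1 by (intro mult_right_mono mult_left_mono r_powr_mono) auto
  qed auto
  also have "\<dots> = real k ^ 31 * real s * real r powr (18 * rho) * 2 powr (72 * rho) * real n * 1"
    by (simp add: power_add[symmetric] mult_ac)
  also have "\<dots> \<le> real k ^ 31 * real s * real r powr (18 * rho) * 2 powr (72 * rho) * real n * (log 2 (real n + 1)) ^ 3"
    using lg by (intro mult_left_mono one_le_power) auto
  finally show ?thesis by (simp add: time_bound_def rho_def)
qed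

end

lemma guesses_exist:
  assumes "1 < r" "r < k" "0 < n"
  shows "\<exists>kap mu lam. guesses n r k kap mu lam"
proof -
  have ex: "\<exists>j. y < 2 ^ j \<and> 2 ^ j \<le> 2 * y" if "0 < y" for y :: nat
  proof -
    define j where "j = (LEAST j. y < 2 ^ j)"
    have j: "y < 2 ^ j" unfolding j_def by (rule LeastI[of _ y]) (rule less_exp)
    have "j \<noteq> 0" using j that by (intro notI) simp
    then obtain i where i: "j = Suc i" by (cases j) auto
    have "\<not> y < 2 ^ i" using not_less_Least[of i "\<lambda>j. y < 2 ^ j"] i unfolding j_def by simp
    then show ?thesis using j i by (intro exI[of _ j]) simp
  qed
  obtain kap where kap: "3 * (k * k) < 2 ^ kap" "2 ^ kap \<le> 6 * (k * k)"
    using ex[of "3 * (k * k)"] assms by auto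
  \<comment> \<open>Starting from \<open>4 * k - 1\<close> makes the lower bound non-strict and the
    upper bound strict, as the locale demands.\<close>
  obtain mu where mu: "4 * k - 1 < 2 ^ mu" "2 ^ mu \<le> 2 * (4 * k - 1)"
    using ex[of "4 * k - 1"] assms by auto
  \<comment> \<open>The first hash maps to \<open>2 ^ kap\<close> keys, so its universe must be at
    least that large even for small \<open>n\<close>.\<close>
  obtain lam where lam: "kap \<le> lam" "n \<le> 2 ^ lam" "lam = kap \<or> 2 ^ lam < 2 * n"
  proof (cases "n \<le> 2 ^ kap")
    case True
    then show ?thesis using that by blast
  next
    case False
    then have "2 ^ kap \<le> n - 1" by simp
    moreover have "(0::nat) < 2 ^ kap" by simp
    ultimately have "0 < n - 1" by linarith
    from ex[OF this] obtain l where l: "n - 1 < 2 ^ l" "2 ^ l \<le> 2 * (n - 1)" by blast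
    have "(2::nat) ^ kap < 2 ^ l" using \<open>2 ^ kap \<le> n - 1\<close> l(1) by linarith
    then have "kap \<le> l" by simp
    moreover have "n \<le> 2 ^ l" "2 ^ l < 2 * n" using l \<open>0 < n - 1\<close> by linarith+
    ultimately show ?thesis using that by blast
  qed
  have "guesses n r k kap mu lam"
    using assms kap mu lam by unfold_locales auto
  then show ?thesis by blast
qed

context machine
begin

section \<open>Assembling correctness, running time and word size\<close>

lemma length_input: "length input = 5 + 4 * s"
proof -
  have "length (concat (map encode_gate xs)) = 4 * length xs" for xs
    by (induction xs) (simp_all add: length_encode_gate)
  then show ?thesis by (simp add: input_def encode_instance_def s_def)
qed

lemma fits_initial: "fits w (initial input)"
proof -
  have Zw: "x \<le> Z \<Longrightarrow> x \<le> w" for x by (intro w_small) simp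
  have "64 \<le> D" using r1 by (simp add: D_def)
  then have Z2: "64 \<le> Z" using bounds(12) by linarith
  have oZ: "out \<le> Z" using out bounds(4) by (simp add: s_def)
  have sZ: "length C \<le> Z" using bounds(4) by (simp add: s_def)
  have gate: "y \<le> Z" if g: "g \<in> set C" and y: "y \<in> set (encode_gate g)" for g y
  proof -
    obtain p where p: "p < length C" "g = C ! p" using g by (auto simp: in_set_conv_nth)
    have pZ: "p \<le> Z" using p sZ by linarith
    from p(1) show ?thesis
    proof (cases rule: gate_cases)
      case (Var i)
      then show ?thesis using y p bounds(5) by auto
    next
      case (Union a b)
      then show ?thesis using y p pZ Z2 unfolding union_gate_def by (elim disjE conjE) auto
    next
      case (Prod a b)
      then show ?thesis using y p pZ Z2 by auto
    qed
  qed
  have "y \<le> Z" if "y \<in> set input" for y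
    using that gate bounds(5-7) oZ sZ by (auto simp: input_def encode_instance_def)
  then show ?thesis using Zw by (simp add: fits_def initial_def)
qed

text \<open>Completeness: \<open>colouring_exists\<close>, applied to the exponents as weights on
  the support, supplies a guess whose table contains the code of the monomial.\<close>

lemma not_found_no_monomial:
  assumes "\<forall>g<G. \<forall>u. \<not> found g u"
  shows "\<not> rk_monomial_of n r k (circuit_poly C out) m"
proof
  assume m: "rk_monomial_of n r k (circuit_poly C out) m"
  let ?A = "Poly_Mapping.keys m"
  have A: "?A \<subseteq> {..<n}" and le: "\<forall>i<n. Poly_Mapping.lookup m i \<le> r" and k: "(\<Sum>i<n.
      Poly_Mapping.lookup m i) = k"
    using m by (auto simp: rk_monomial_of_def rk_monomial_def)
  have "sum (Poly_Mapping.lookup m) ?A \<le> k"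
    unfolding k[symmetric] using A by (intro sum_mono2) auto
  moreover have "0 < Poly_Mapping.lookup m i \<and> Poly_Mapping.lookup m i \<le> r" if "i \<in> ?A" for i
  proof -
    have "i < n" using that A by blast
    then show ?thesis using that le by (simp add: in_keys_iff)
  qed
  ultimately obtain g c where g: "g < G" and c: "\<And>i. i \<in> ?A \<Longrightarrow> colour g i = B ^ c i \<and> c i < q"
    and cls: "\<And>j. (\<Sum>i | i \<in> ?A \<and> c i = j. Poly_Mapping.lookup m i) \<le> r"
    using colouring_exists[OF A, of "Poly_Mapping.lookup m"] by blast
  interpret coloured_circuit n C B q "colour g" using g by (rule coloured)
  have "\<exists>u. reach out u \<and> digsum B u = k"
  proof (rule rk_monomial_reach)
    show "rk_monomial_of n r k (gpoly out) m" using m by (simp add: circuit_poly_def)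
    show "(\<Sum>i | i \<in> ?A \<and> c i = j. Poly_Mapping.lookup m i) < B" for j
      using cls[of j] by (simp add: B_def)
  qed (rule c)
  then obtain u where "found g u" by (auto simp: found_def reaches_def reach_def BQ_def)
  then show False using assms g by blast
qed

lemma found_monomial:
  assumes "g < G" "found g u" "realizes' g out u m"
  shows "rk_monomial_of n r k (circuit_poly C out) m"
proof -
  interpret coloured_circuit n C B q "colour g" using assms(1) by (rule coloured)
  show ?thesis
    using realizes_rk_monomial[of out u m k r] assms(2,3) out
    by (simp add: realizes'_def found_def B_def circuit_poly_def)
qed

definition "prog_time = (29 + 3 * K + 3 * MU + 3 * Lam) + ((5 * q + 16 * k + 20) + ((11 * BQ + 2) +
  (guess_time + (trace_time + output_time + 2))))"

lemma wp_rk: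
  "wp w rk_prog (\<lambda>_ M. correct_output n r k (circuit_poly C out) M) prog_time (\<lambda>_. 0) (mem (initial input))"
proof -
  define M0 where "M0 = mem (initial input)"
  let ?Q = "\<lambda>(_ :: nat \<Rightarrow> nat) M. correct_output n r k (circuit_poly C out) M"
  define fin where "fin = Cond 0 26 (trace_prog ;; output_prog) (Blk [STORE 0 0])"
  have f: "wp w fin ?Q (trace_time + output_time + 2) R M"
    if R: "const_regs R" and M: "static M" "\<forall>i<n. M (aE + i) = 0"
      and c: "R 26 = 1 \<and> g < G \<and> table g M s \<and> found g (R 27) \<or> R 26 = 0 \<and> (\<forall>g<G.
          \<forall>u. \<not> found g u)" for R M g
    unfolding fin_def
  proof (rule wp_Cond[where T = "trace_time + output_time"])
    assume "R 0 < R 26"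
    then have fg: "g < G" "table g M s" "found g (R 27)" using c by auto
    have "wp w trace_prog (\<lambda>R M. wp w output_prog ?Q output_time R M) trace_time R M"
    proof (rule wp_trace[OF R refl fg(1,3) M(1) fg(2) M(2)])
      fix R1 M1 m assume 1: "pres 23 R R1" "realizes' g out (R 27) m" "\<forall>i<n. M1 (aE + i) = Poly_Mapping.lookup m i"
      have c1: "const_regs R1" using R 1(1) by (rule const_regs_pres) simp
      have rk: "rk_monomial_of n r k (circuit_poly C out) m" using fg(1,3) 1(2) by (rule found_monomial)
      show "wp w output_prog ?Q output_time R1 M1"
      proof (rule wp_output[OF c1])
        fix M2 :: "nat \<Rightarrow> nat" assume "M2 0 = 1" "\<forall>i<n. M2 (i + 1) = M1 (aE + i)"
        then show "correct_output n r k (circuit_poly C out) M2"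
          using rk 1(3) unfolding correct_output_def by auto
      qed
    qed
    then show "wp w (trace_prog ;; output_prog) ?Q (trace_time + output_time) R M" by (rule wp_Seq) simp
  next
    assume z: "\<not> R 0 < R 26"
    have R0: "R 0 = 0" using R by (simp add: const_regs_def)
    then have "\<forall>g<G. \<forall>u. \<not> found g u" using c z by auto
    then have "correct_output n r k (circuit_poly C out) (M(0 := 0))"
      using not_found_no_monomial by (simp add: correct_output_def)
    then show "wp w (Blk [STORE 0 0]) ?Q (trace_time + output_time) R M"
      using R0 by (intro wp_Blk) (simp_all add: output_time_def)
  qed simp
  have g: "wp w (guess_prog ;; fin) ?Q (guess_time + (trace_time + output_time + 2)) R M"
    if R: "const_regs R" "R 24 = G" and M: "static M" "\<forall>i<n. M (aE + i) = 0" for R M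
  proof (rule wp_Seq[OF wp_guess[OF R M(1)] order.refl])
    fix R1 M1 g assume 1: "pres 24 R R1" "frame M M1" "static M1"
      "R1 26 = 1 \<and> g < G \<and> table g M1 s \<and> found g (R1 27) \<or> R1 26 = 0 \<and> (\<forall>g<G.
          \<forall>u. \<not> found g u)"
    have "const_regs R1" using R(1) 1(1) by (rule const_regs_pres) simp
    moreover have "\<forall>i<n. M1 (aE + i) = 0" using M(2) 1(2) by (simp add: frame_def)
    ultimately show "wp w fin ?Q (trace_time + output_time + 2) R1 M1" using 1 f by blast
  qed
  have inp: "\<forall>j<5 + 4 * s. M0 j = input ! j" "\<forall>j\<ge>5 + 4 * s. M0 j = 0"
    by (simp_all add: M0_def initial_def length_input)
  have "wp w rk_prog ?Q prog_time (\<lambda>_. 0) M0"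
    unfolding rk_prog_def prog_time_def fin_def[symmetric]
  proof (rule wp_Seq[OF wp_init1[OF refl] order.refl])
    show "M0 0 = n" "M0 1 = r" "M0 2 = k" "M0 3 = s" "M0 4 = out"
      using inp(1) by (simp_all add: input_def encode_instance_def s_def)
    fix R1 :: "nat \<Rightarrow> nat" assume 1: "R1 0 = 0 \<and> R1 1 = 1 \<and> R1 2 = 2 \<and> R1 3 = n \<and> R1 4 = r
        \<and> R1 5 = k \<and> R1 6 = s \<and> R1 7 = out \<and>
      R1 8 = B \<and> R1 9 = K \<and> R1 10 = MU \<and> R1 11 = Lam \<and> R1 13 = D \<and> R1 14 = q \<and> R1 18 = 2 * k"
    show "wp w (init_prog2 ;; Loop 60 15 digsum_body ;; guess_prog ;; fin) ?Q
        (5 * q + 16 * k + 20 + (11 * BQ + 2 + (guess_time + (trace_time + output_time + 2)))) R1 M0"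
    proof (rule wp_Seq[OF wp_init2[OF 1] order.refl])
      fix R2 assume 2: "const_regs R2" "R2 24 = G" "R2 60 = 0"
      show "wp w (Loop 60 15 digsum_body ;; guess_prog ;; fin) ?Q
          (11 * BQ + 2 + (guess_time + (trace_time + output_time + 2))) R2 M0"
        by (rule wp_Seq[OF wp_digsum[OF 2 inp] order.refl]) (rule g)
    qed
  qed
  then show ?thesis by (simp add: M0_def)
qed

lemma prog_time_le: "prog_time \<le> 500 * (G * s * (k * k) * (BQ * BQ))"
proof -
  have le: "x \<le> x * y" "x \<le> y * x" if "0 < y" for x y :: nat using that by simp_all
  define b kk where "b = BQ * BQ" and "kk = k * k"
  \<comment> \<open>Nested names for the products turn the nonlinear comparison into a chain of
    linear ones, one for each loop level.\<close>
  define Y1 Y2 Y where "Y1 = kk * b" and "Y2 = s * Y1" and "Y = G * Y2"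
  have p: "0 < b" "0 < kk" "0 < Y1" "0 < Y2" "0 < Y" using pos by (simp_all add: b_def kk_def Y1_def Y2_def Y_def)
  have h: "kk \<le> Y1" "b \<le> Y1" "Y1 \<le> Y2" "Y2 \<le> Y" "G \<le> Y" "s \<le> Y2" "k \<le> kk" "BQ \<le> b" "BQ *
      BQ \<le> b"
    unfolding Y1_def Y2_def Y_def b_def kk_def using le pos by (simp_all)
  have "4 * k div r \<le> 4 * k" by simp
  then have q: "q \<le> 5 * k" using pos(12) unfolding q_def by linarith
  have "2 * k * (13 * q + 26) \<le> 2 * k * (91 * k)"
  proof (rule mult_le_mono2)
    have "13 * q + 26 \<le> 65 * k + 26 * 1" using q by linarith
    also have "\<dots> \<le> 91 * k" using pos(12) by linarith
    finally show "13 * q + 26 \<le> 91 * k" .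
  qed
  also have "\<dots> = 182 * kk" by (simp add: kk_def)
  finally have "colour_time \<le> 201 * kk" using p(2) unfolding colour_time_def by linarith
  moreover have "BQ * (21 * BQ + 14) = 21 * b + 14 * BQ" by (simp add: b_def algebra_simps)
  ultimately have gt: "gate_time \<le> 281 * Y1" using h p(3) unfolding gate_time_def by linarith
  have "s * (gate_time + 3) \<le> s * (284 * Y1)" using gt p(3) by (intro mult_le_mono2) linarith
  also have "\<dots> = 284 * Y2" by (simp add: Y2_def)
  finally have tt: "table_time \<le> 287 * Y2" using p(4) unfolding table_time_def by linarith
  have st: "search_time \<le> 21 * Y2" using h p(4) unfolding search_time_def by linarith
  have "G * (table_time + search_time + 5) \<le> G * (313 * Y2)" using tt st p(4) by (intro mult_le_mono2) linarith
  also have "\<dots> = 313 * Y" by (simp add: Y_def)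
  finally have gg: "guess_time \<le> 317 * Y" using p(5) unfolding guess_time_def by linarith
  have HG: "HH \<le> G" using pos by (simp add: G_def)
  have LH: "Lam \<le> HH" using pos by (simp add: HH_def)
  have KL: "K \<le> Lam" using dvd_imp_le[OF K_dvd_Lam] pos by simp
  have nL: "n \<le> Lam" using lam(2) by (simp add: Lam_def)
  have "k * s \<le> kk * s" using h(7) by (rule mult_le_mono1)
  also have "\<dots> \<le> Y2" using p(1) by (simp add: Y2_def Y1_def)
  finally have ks: "k * s \<le> Y" using h by linarith
  have tr: "trace_time + output_time \<le> 43 * Y + 7 * n + 10" using ks unfolding trace_time_def output_time_def by linarith
  have "prog_time \<le> 500 * Y"
    unfolding prog_time_def using gg tr HG LH KL nL MU_le_K q h p by linarith
  then show ?thesis by (simp add: Y_def Y2_def Y1_def b_def kk_def mult_ac)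
qed

text \<open>\<open>Z\<close> has the factors of the work bound and an extra \<open>n\<close>, which
  is itself at most \<open>G\<close>; so \<open>Z\<close> is at most the square of the work and
  \<open>w\<close> a multiple of its fourth power. The fifth power of \<open>500\<close> absorbs the
  factor \<open>10000\<close>.\<close>

lemma w_le: "w \<le> (500 * (G * s * (k * k) * (BQ * BQ))) ^ 5"
proof -
  define Y where "Y = G * s * (k * k) * (BQ * BQ)"
  have Y0: "0 < Y" using pos by (simp add: Y_def)
  have "n \<le> Lam" using lam(2) by (simp add: Lam_def)
  also have "Lam \<le> G" using pos by (simp add: G_def HH_def)
  also have "G \<le> Y" using pos by (simp add: Y_def)
  finally have "n \<le> Y" .
  have "Z = (G * s * k * BQ) * n" by (simp add: Z_def mult_ac)
  also have "\<dots> \<le> Y * Y"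
  proof (rule mult_le_mono)
    have "G * s * k * BQ \<le> (G * s * k * BQ) * (k * BQ)" using pos by simp
    then show "G * s * k * BQ \<le> Y" by (simp add: Y_def mult_ac)
  qed fact
  finally have "Z \<le> Y * Y" .
  then have "Z * Z \<le> (Y * Y) * (Y * Y)" by (intro mult_le_mono)
  then have "w \<le> 10000 * ((Y * Y) * (Y * Y))" unfolding w_def by linarith
  also have "\<dots> = 10000 * Y ^ 4" by (simp add: power_numeral_reduce)
  also have "\<dots> \<le> 500 ^ 5 * Y ^ 5"
    using Y0 by (intro mult_le_mono power_increasing) auto
  also have "\<dots> = (500 * Y) ^ 5" by (simp only: power_mult_distrib)
  finally show ?thesis by (simp add: Y_def)
qed

end

theorem theorem5p8:
  shows "\<exists>(P :: program) (a :: nat) (b :: nat) (c :: nat).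
    \<forall>(n :: nat) (r :: nat) (k :: nat) (C :: gates) (out :: nat).
      1 < r \<longrightarrow> r < k \<longrightarrow> non_canceling_circuit n C out \<longrightarrow>
      (\<exists>M. computes_within P (encode_instance n r k C out)
              (time_bound a b n r k (length C))
              (time_bound a b n r k (length C) ^ c) M \<and>
           correct_output n r k (circuit_poly C out) M)"
\<comment> \<open>The exponents \<open>31\<close> and \<open>72\<close> come from
  \<open>work_bound\<close>, the exponent \<open>5\<close> of the word size from
  \<open>w_le\<close>.\<close>
proof (rule exI[of _ "comp 0 rk_prog"], rule exI[of _ 31], rule exI[of _ 72], rule exI[of _ 5], intro allI impI)
  fix n r k :: nat and C :: gates and out :: nat
  assume r: "1 < r" "r < k" and C: "non_canceling_circuit n C out"
  have ok: "\<forall>p<length C. gate_ok n p (C ! p)" and out: "out < length C"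
    using C by (simp_all add: non_canceling_circuit_def)
  \<comment> \<open>The first node has no predecessors and no node has fan-in zero, so it is a
    variable.\<close>
  have "0 < n"
  proof -
    have "gate_ok n 0 (C ! 0)" using ok out by (cases C) auto
    then show ?thesis by (cases "C ! 0") (auto simp: length_Suc_conv numeral_2_eq_2)
  qed
  then obtain kap mu lam where "guesses n r k kap mu lam" using guesses_exist r by blast
  then interpret machine n r k kap mu lam C out
    unfolding machine_def machine_axioms_def circuit_def using ok out by blast
  define Y where "Y = 500 * (G * s * (k * k) * (BQ * BQ))"
  have T: "real Y \<le> time_bound 31 72 n r k (length C)"
    using work_bound[of s] by (simp add: Y_def s_def)
  have time: "real prog_time \<le> time_bound 31 72 n r k (length C)"
    using prog_time_le T by (simp add: Y_def[symmetric])
  have "real w \<le> real Y ^ 5" using w_le unfolding Y_def[symmetric] by (metis of_nat_le_iff of_nat_power)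
  also have "\<dots> \<le> time_bound 31 72 n r k (length C) ^ 5" using T by (intro power_mono) auto
  finally have words: "real w \<le> time_bound 31 72 n r k (length C) ^ 5" .
  have "\<exists>M R. computes_within (comp 0 rk_prog) input (time_bound 31 72 n r k (length C))
      (time_bound 31 72 n r k (length C) ^ 5) M \<and> correct_output n r k (circuit_poly C out) M"
    using wp_computes[OF wp_rk fits_initial time words] by simp
  then show "\<exists>M. computes_within (comp 0 rk_prog) (encode_instance n r k C out) (time_bound 31 72 n r k (length C))
      (time_bound 31 72 n r k (length C) ^ 5) M \<and> correct_output n r k (circuit_poly C out) M"
    by (simp add: input_def)
qed

end
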